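(* Let $(A,A^*,\mathcal{D})$ be a Lie-Nijenhuis bialgebroid over $M$, with Lie algebroid structures $([\cdot,\cdot],\rho)$ on $A$ and $([\cdot,\cdot]_*,\rho_* )$ on $A^*$ and $\mathcal{D}=(D,l,r)$, and let $\pi\in\mathfrak{X}^2(M)$ be the associated Poisson structure defined by $\pi^\sharp=\rho_*\circ\rho^*$. Then: (i) $(\pi,r)$ is a Poisson-Nijenhuis structure on $M$; (ii) the bracket $[a,b]_l=[l(a),b]+[a,l(b)]-l([a,b])$ is a Lie algebroid bracket on $A$ for which $((A,[\cdot,\cdot]_l,\rho\circ l),(A^*,[\cdot,\cdot]_*,\rho_* ))$ is a Lie bialgebroid; (iii) $((A,[\cdot,\cdot]_l,\rho\circ l),(A^*,[\cdot,\cdot]_*,\rho_* ),\mathcal{D})$ is a Lie-Nijenhuis bialgebroid.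
   Context: **Generalized derivations of degree 1.** For a vector bundle $E\to M$, a generalized derivation of degree 1 is a triple $\mathcal{D}=(D,l,r)$ with $D:\Gamma(E)\to\Omega^1(M,E)$ $\mathbb{R}$-linear and $l:E\to E$, $r:TM\to TM$ vector bundle endomorphisms over the identity, such that $D_X(fu)=fD_X(u)+(\mathcal{L}_Xf)\,l(u)-(\mathcal{L}_{r(X)}f)\,u$ for $u\in\Gamma(E)$, $f\in C^\infty(M)$, $X\in\mathfrak{X}(M)$. The space of these is $\mathrm{GDer}^1(E)$. The dual $\mathcal{D}^\top=(D^\top,l^*,r)\in\mathrm{GDer}^1(E^* )$ is defined by $\langle D^\top_X(\mu),u\rangle=\mathcal{L}_X\langle\mu,l(u)\rangle-\mathcal{L}_{r(X)}\langle\mu,u\rangle-\langle\mu,D_X(u)\rangle$. The condition $[\mathcal{D},\mathcal{D}]=0$ (graded Lie bracket of generalized derivations) amounts to: the Nijenhuis torsion of $r$ vanishes; $D_X\circ l=l\circ D_X$ for all $X$; and $D_XD_Y(u)-D_YD_X(u)-D_{[r(Y),X]+[Y,r(X)]-r([Y,X])}(u)+l(D_{[Y,X]}(u))=0$ for all $X,Y,u$. **IM (1,1)-tensors.** If $(A,[\cdot,\cdot],\rho)$ is a Lie algebroid over $M$, $\mathcal{D}=(D,l,r)\in \mathrm{GDer}^1(A)$ is an IM (1,1)-tensor if for all $a,b\in\Gamma(A)$, $X\in\mathfrak{X}(M)$: (IM1) $D_X([a,b])=[a,D_X(b)]-[b,D_X(a)]+D_{[\rho(b),X]}(a)-D_{[\rho(a),X]}(b)$;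 (IM2) $l([a,b])=[a,l(b)]-D_{\rho(b)}(a)$; (IM3) $r([\rho(a),X])=[\rho(a),r(X)]-\rho(D_X(a))$; (IM4) $r\circ\rho=\rho\circ l$. **Lie-Nijenhuis bialgebroid.** $(A,A^*,\mathcal{D})$ with $(A,A^* )$ a Lie bialgebroid and $\mathcal{D}\in\mathrm{GDer}^1(A)$ such that $\mathcal{D}$ is an IM (1,1)-tensor on $A$, $\mathcal{D}^\top$ is an IM (1,1)-tensor on $A^*$, and $[\mathcal{D},\mathcal{D}]=0$. **Poisson-Nijenhuis structures.** Write $\pi^\sharp(\alpha)=\pi(\alpha,\cdot)$ and $[\alpha,\beta]_B=\mathcal{L}_{B^\sharp(\alpha)}\beta-i_{B^\sharp(\beta)}d\alpha$ for a bivector field $B$. A Poisson bivector $\pi$ and $r:TM\to TM$ are compatible if $r\circ\pi^\sharp=\pi^\sharp\circ r^*$ and $[\alpha,\beta]_{\pi_r}=[r^*\alpha,\beta]_\pi+[\alpha,r^*\beta]_\pi-r^*([\alpha,\beta]_\pi)$ for all 1-forms $\alpha,\beta$, where $\pi_r^\sharp=r\circ\pi^\sharp$. $(\pi,r)$ is Poisson-Nijenhuis if moreover the Nijenhuis torsion of $r$ vanishes. *)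

theory Defs
  imports "HOL-Analysis.Analysis" "HOL-Library.Function_Algebras"
begin

section \<open>Pointwise real vector space structure on functions\<close>

text \<open>
  Fibres of dual and tangent bundles are spaces of real-valued functions.  The additive structure
  comes from \<^theory>\<open>HOL-Library.Function_Algebras\<close>.
\<close>

instantiation "fun" :: (type, real_vector) real_vector
begin

definition scaleR_fun :: "real \<Rightarrow> ('a \<Rightarrow> 'b) \<Rightarrow> 'a \<Rightarrow> 'b" where
  "scaleR_fun c f = (\<lambda>x. c *\<^sub>R f x)"

instance
  by standard (auto simp: scaleR_fun_def plus_fun_def fun_eq_iff scaleR_add_right scaleR_add_left)

end

section \<open>Smooth manifolds\<close>

text \<open>
  \<open>R\<^sup>n\<close> is \<open>Euclidean_space n\<close>, the sequences vanishing from index \<open>n\<close> on (so \<open>n = 0\<close> is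
  allowed).  The predicate \<open>C_k k n S f\<close> is used for \<open>S\<close> open in \<open>R\<^sup>n\<close>; the topology of
  \<open>Euclidean_space n\<close> is the one induced from the product topology on \<open>nat \<Rightarrow> real\<close>.
\<close>

primrec C_k :: "nat \<Rightarrow> nat \<Rightarrow> (nat \<Rightarrow> real) set \<Rightarrow> ((nat \<Rightarrow> real) \<Rightarrow> real) \<Rightarrow> bool" where
  "C_k 0 n S f \<longleftrightarrow> continuous_on S f"
| "C_k (Suc k) n S f \<longleftrightarrow> continuous_on S f \<and>
     (\<forall>i<n. \<exists>g. (\<forall>x\<in>S. ((\<lambda>t. f (x(i := t))) has_real_derivative g x) (at (x i))) \<and> C_k k n S g)"

definition C_infinity :: "nat \<Rightarrow> (nat \<Rightarrow> real) set \<Rightarrow> ((nat \<Rightarrow> real) \<Rightarrow> real) \<Rightarrow> bool" where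
  "C_infinity n S f \<longleftrightarrow> (\<forall>k. C_k k n S f)"

text \<open>The underlying topological space of a manifold is the whole type \<open>'m\<close>.\<close>

record 'm manifold =
  mdim :: nat
  charts :: "('m set \<times> ('m \<Rightarrow> nat \<Rightarrow> real)) set"

definition smooth_manifold :: "'m::{t2_space, second_countable_topology} manifold \<Rightarrow> bool" where
  "smooth_manifold M \<longleftrightarrow>
     (\<Union>(U, \<phi>)\<in>charts M. U) = UNIV \<and>
     (\<forall>(U, \<phi>)\<in>charts M. open U \<and> openin (Euclidean_space (mdim M)) (\<phi> ` U) \<and>
        homeomorphic_map (top_of_set U) (subtopology (Euclidean_space (mdim M)) (\<phi> ` U)) \<phi>) \<and>
     (\<forall>(U, \<phi>)\<in>charts M. \<forall>(V, \<psi>)\<in>charts M. \<forall>i<mdim M.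
        C_infinity (mdim M) (\<phi> ` (U \<inter> V)) (\<lambda>x. \<psi> (inv_into U \<phi> x) i))"

definition smooth_on :: "'m manifold \<Rightarrow> 'm set \<Rightarrow> ('m \<Rightarrow> real) \<Rightarrow> bool" where
  "smooth_on M W f \<longleftrightarrow>
     (\<forall>(U, \<phi>)\<in>charts M. C_infinity (mdim M) (\<phi> ` (U \<inter> W)) (\<lambda>x. f (inv_into U \<phi> x)))"

definition smooth_functions :: "'m manifold \<Rightarrow> ('m \<Rightarrow> real) set" where
  "smooth_functions M = {f. smooth_on M UNIV f}"

section \<open>Vector bundles\<close>

text \<open>
  A bundle is given by its fibres, which are linear subspaces of an ambient real vector space
  type, together with its set of smooth global sections.
\<close>

record ('m, 'v) vbundle =
  fibre :: "'m \<Rightarrow> 'v set"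
  sections :: "('m \<Rightarrow> 'v) set"

definition local_frame :: "nat \<Rightarrow> ('m::topological_space, 'v::real_vector) vbundle \<Rightarrow> 'm set \<Rightarrow>
    (nat \<Rightarrow> 'm \<Rightarrow> 'v) \<Rightarrow> bool" where
  "local_frame k E U e \<longleftrightarrow> open U \<and>
     (\<forall>p\<in>U. inj_on (\<lambda>i. e i p) {..<k} \<and> independent ((\<lambda>i. e i p) ` {..<k}) \<and>
            span ((\<lambda>i. e i p) ` {..<k}) = fibre E p)"

text \<open>
  The fibres carry a smooth vector bundle structure, given by an atlas \<open>F\<close> of local frames with
  smooth transition matrices, for which the smooth sections are those of \<open>E\<close>.
\<close>

definition vector_bundle ::
    "'m::topological_space manifold \<Rightarrow> ('m, 'v::real_vector) vbundle \<Rightarrow> bool" where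
  "vector_bundle M E \<longleftrightarrow> (\<exists>k F.
     (\<Union>(U, e)\<in>F. U) = UNIV \<and>
     (\<forall>(U, e)\<in>F. local_frame k E U e) \<and>
     (\<forall>(U, e)\<in>F. \<forall>(V, e')\<in>F. \<exists>g. \<forall>j<k.
        (\<forall>i<k. smooth_on M (U \<inter> V) (g i j)) \<and>
        (\<forall>p\<in>U \<inter> V. e' j p = (\<Sum>i<k. g i j p *\<^sub>R e i p))) \<and>
     sections E = {s. (\<forall>p. s p \<in> fibre E p) \<and>
        (\<forall>(U, e)\<in>F. \<exists>c. (\<forall>i<k. smooth_on M U (c i)) \<and>
           (\<forall>p\<in>U. s p = (\<Sum>i<k. c i p *\<^sub>R e i p)))})"

definition linear_between :: "'v::real_vector set \<Rightarrow> 'w::real_vector set \<Rightarrow> ('v \<Rightarrow> 'w) \<Rightarrow> bool" where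
  "linear_between V W F \<longleftrightarrow> (\<forall>u\<in>V. F u \<in> W) \<and>
     (\<forall>u\<in>V. \<forall>v\<in>V. F (u + v) = F u + F v) \<and> (\<forall>c. \<forall>u\<in>V. F (c *\<^sub>R u) = c *\<^sub>R F u)"

definition smul :: "('m \<Rightarrow> real) \<Rightarrow> ('m \<Rightarrow> 'v::real_vector) \<Rightarrow> 'm \<Rightarrow> 'v" (infixr "\<odot>" 75) where
  "f \<odot> s = (\<lambda>p. f p *\<^sub>R s p)"

definition app :: "('m \<Rightarrow> 'v \<Rightarrow> 'w) \<Rightarrow> ('m \<Rightarrow> 'v) \<Rightarrow> 'm \<Rightarrow> 'w" where
  "app F s = (\<lambda>p. F p (s p))"

text \<open>Vector bundle morphisms over the identity; smoothness is tested on smooth sections.\<close>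

definition bundle_map :: "('m, 'v::real_vector) vbundle \<Rightarrow> ('m, 'w::real_vector) vbundle \<Rightarrow>
    ('m \<Rightarrow> 'v \<Rightarrow> 'w) \<Rightarrow> bool" where
  "bundle_map E E' F \<longleftrightarrow> (\<forall>p. linear_between (fibre E p) (fibre E' p) (F p)) \<and>
     (\<forall>s\<in>sections E. app F s \<in> sections E')"

text \<open>
  Covectors are extended by \<open>0\<close> outside the fibre, so that they are determined by their values
  on it.
\<close>

definition dual_bundle ::
    "'m manifold \<Rightarrow> ('m, 'v::real_vector) vbundle \<Rightarrow> ('m, 'v \<Rightarrow> real) vbundle" where
  "dual_bundle M E =
     (let fib = (\<lambda>p. {\<mu>. linear_between (fibre E p) UNIV \<mu> \<and> (\<forall>v. v \<notin> fibre E p \<longrightarrow> \<mu> v = 0)})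
      in \<lparr>fibre = fib,
          sections = {\<mu>. (\<forall>p. \<mu> p \<in> fib p) \<and> (\<forall>s\<in>sections E. app \<mu> s \<in> smooth_functions M)}\<rparr>)"

text \<open>The pairing \<open>\<langle>\<mu>, s\<rangle>\<close> of a section of \<open>E\<^sup>*\<close> with a section of \<open>E\<close>.\<close>

abbreviation pairing :: "('m \<Rightarrow> 'v \<Rightarrow> real) \<Rightarrow> ('m \<Rightarrow> 'v) \<Rightarrow> 'm \<Rightarrow> real" where
  "pairing \<mu> s \<equiv> app \<mu> s"

definition transpose_map :: "('m, 'v) vbundle \<Rightarrow> ('m \<Rightarrow> 'v \<Rightarrow> 'w) \<Rightarrow>
    'm \<Rightarrow> ('w \<Rightarrow> real) \<Rightarrow> 'v \<Rightarrow> real" where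
  "transpose_map E F = (\<lambda>p \<beta> v. if v \<in> fibre E p then \<beta> (F p v) else 0)"

text \<open>
  The section of \<open>E\<^sup>*\<close> determined by its pairing with sections of \<open>E\<close>; it exists uniquely when
  \<open>\<Phi>\<close> is a \<open>C\<^sup>\<infinity>(M)\<close>-linear map from the sections of \<open>E\<close> to \<open>C\<^sup>\<infinity>(M)\<close>.
\<close>

definition dual_section :: "'m manifold \<Rightarrow> ('m, 'v::real_vector) vbundle \<Rightarrow>
    (('m \<Rightarrow> 'v) \<Rightarrow> 'm \<Rightarrow> real) \<Rightarrow> 'm \<Rightarrow> 'v \<Rightarrow> real" where
  "dual_section M E \<Phi> =
     (THE \<mu>. \<mu> \<in> sections (dual_bundle M E) \<and> (\<forall>s\<in>sections E. pairing \<mu> s = \<Phi> s))"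

section \<open>Vector fields and differential forms\<close>

type_synonym 'm tangent = "('m \<Rightarrow> real) \<Rightarrow> real"
type_synonym 'm cotangent = "'m tangent \<Rightarrow> real"
type_synonym 'm vfield = "'m \<Rightarrow> 'm tangent"
type_synonym 'm oneform = "'m \<Rightarrow> 'm cotangent"

definition lie_fun :: "'m vfield \<Rightarrow> ('m \<Rightarrow> real) \<Rightarrow> 'm \<Rightarrow> real" where
  "lie_fun X f = (\<lambda>p. X p f)"

text \<open>
  Tangent vectors at \<open>p\<close> are the derivations of \<open>C\<^sup>\<infinity>(M)\<close> at \<open>p\<close> (extended by \<open>0\<close> to non-smooth
  functions); a vector field is smooth if it maps smooth functions to smooth functions.
\<close>

definition tangent_bundle :: "'m manifold \<Rightarrow> ('m, 'm tangent) vbundle" where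
  "tangent_bundle M =
     (let fib = (\<lambda>p. {v. linear_between (smooth_functions M) UNIV v \<and>
            (\<forall>f\<in>smooth_functions M. \<forall>g\<in>smooth_functions M. v (f * g) = f p * v g + g p * v f) \<and>
            (\<forall>f. f \<notin> smooth_functions M \<longrightarrow> v f = 0)})
      in \<lparr>fibre = fib,
          sections = {X. (\<forall>p. X p \<in> fib p) \<and>
             (\<forall>f\<in>smooth_functions M. lie_fun X f \<in> smooth_functions M)}\<rparr>)"

abbreviation vector_fields :: "'m manifold \<Rightarrow> 'm vfield set" where
  "vector_fields M \<equiv> sections (tangent_bundle M)"

abbreviation cotangent_bundle :: "'m manifold \<Rightarrow> ('m, 'm cotangent) vbundle" where
  "cotangent_bundle M \<equiv> dual_bundle M (tangent_bundle M)"

abbreviation one_forms :: "'m manifold \<Rightarrow> 'm oneform set" where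
  "one_forms M \<equiv> sections (cotangent_bundle M)"

definition vf_bracket :: "'m vfield \<Rightarrow> 'm vfield \<Rightarrow> 'm vfield" where
  "vf_bracket X Y = (\<lambda>p f. X p (lie_fun Y f) - Y p (lie_fun X f))"

definition differential :: "'m manifold \<Rightarrow> ('m \<Rightarrow> real) \<Rightarrow> 'm oneform" where
  "differential M f = (\<lambda>p v. if v \<in> fibre (tangent_bundle M) p then v f else 0)"

text \<open>\<open>(\<L>\<^sub>X \<beta>)(Z)\<close> and \<open>d\<alpha>(X, Y)\<close>, for vector fields \<open>X\<close>, \<open>Y\<close>, \<open>Z\<close>.\<close>

definition lie_form :: "'m vfield \<Rightarrow> 'm oneform \<Rightarrow> 'm vfield \<Rightarrow> 'm \<Rightarrow> real" where
  "lie_form X \<beta> Z = lie_fun X (pairing \<beta> Z) - pairing \<beta> (vf_bracket X Z)"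

definition ext_d :: "'m oneform \<Rightarrow> 'm vfield \<Rightarrow> 'm vfield \<Rightarrow> 'm \<Rightarrow> real" where
  "ext_d \<alpha> X Y =
     lie_fun X (pairing \<alpha> Y) - lie_fun Y (pairing \<alpha> X) - pairing \<alpha> (vf_bracket X Y)"

definition nijenhuis_torsion :: "('m \<Rightarrow> 'm tangent \<Rightarrow> 'm tangent) \<Rightarrow>
    'm vfield \<Rightarrow> 'm vfield \<Rightarrow> 'm vfield" where
  "nijenhuis_torsion r X Y = vf_bracket (app r X) (app r Y)
     - app r (vf_bracket (app r X) Y + vf_bracket X (app r Y) - app r (vf_bracket X Y))"

section \<open>Poisson-Nijenhuis structures\<close>

type_synonym 'm bivector = "'m \<Rightarrow> 'm cotangent \<Rightarrow> 'm cotangent \<Rightarrow> real"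

definition bivector_field :: "'m manifold \<Rightarrow> 'm bivector \<Rightarrow> bool" where
  "bivector_field M \<pi> \<longleftrightarrow>
     (\<forall>p. \<forall>\<alpha>\<in>fibre (cotangent_bundle M) p.
        linear_between (fibre (cotangent_bundle M) p) UNIV (\<pi> p \<alpha>) \<and>
        (\<forall>\<beta>\<in>fibre (cotangent_bundle M) p. \<pi> p \<alpha> \<beta> = - \<pi> p \<beta> \<alpha>)) \<and>
     (\<forall>\<alpha>\<in>one_forms M. \<forall>\<beta>\<in>one_forms M. (\<lambda>p. \<pi> p (\<alpha> p) (\<beta> p)) \<in> smooth_functions M)"

text \<open>\<open>\<pi>\<^sup>\<sharp>(\<alpha>) = \<pi>(\<alpha>, \<cdot>)\<close>, using the identification of \<open>T\<^sub>pM\<close> with its bidual.\<close>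

definition sharp :: "'m manifold \<Rightarrow> 'm bivector \<Rightarrow> 'm \<Rightarrow> 'm cotangent \<Rightarrow> 'm tangent" where
  "sharp M \<pi> = (\<lambda>p \<alpha>. THE v. v \<in> fibre (tangent_bundle M) p \<and>
     (\<forall>\<beta>\<in>fibre (cotangent_bundle M) p. \<beta> v = \<pi> p \<alpha> \<beta>))"

definition poisson_bracket :: "'m manifold \<Rightarrow> 'm bivector \<Rightarrow>
    ('m \<Rightarrow> real) \<Rightarrow> ('m \<Rightarrow> real) \<Rightarrow> 'm \<Rightarrow> real" where
  "poisson_bracket M \<pi> f g = (\<lambda>p. \<pi> p (differential M f p) (differential M g p))"

definition poisson_bivector :: "'m manifold \<Rightarrow> 'm bivector \<Rightarrow> bool" where
  "poisson_bivector M \<pi> \<longleftrightarrow> bivector_field M \<pi> \<and>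
     (\<forall>f\<in>smooth_functions M. \<forall>g\<in>smooth_functions M. \<forall>h\<in>smooth_functions M.
        poisson_bracket M \<pi> f (poisson_bracket M \<pi> g h)
        + poisson_bracket M \<pi> g (poisson_bracket M \<pi> h f)
        + poisson_bracket M \<pi> h (poisson_bracket M \<pi> f g) = 0)"

text \<open>
  The 1-form \<open>[\<alpha>, \<beta>]\<^sub>B = \<L>\<^bsub>B\<^sup>\<sharp>\<alpha>\<^esub> \<beta> - i\<^bsub>B\<^sup>\<sharp>\<beta>\<^esub> d\<alpha>\<close> evaluated on a vector field \<open>Z\<close>; the argument
  \<open>B\<close> below is the map \<open>B\<^sup>\<sharp>\<close>.
\<close>

definition koszul_bracket :: "('m \<Rightarrow> 'm cotangent \<Rightarrow> 'm tangent) \<Rightarrow>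
    'm oneform \<Rightarrow> 'm oneform \<Rightarrow> 'm vfield \<Rightarrow> 'm \<Rightarrow> real" where
  "koszul_bracket B \<alpha> \<beta> Z = lie_form (app B \<alpha>) \<beta> Z - ext_d \<alpha> (app B \<beta>) Z"

text \<open>
  In the last condition \<open>r\<^sup>*([\<alpha>, \<beta>]\<^sub>\<pi>)\<close> evaluated on \<open>Z\<close> is \<open>[\<alpha>, \<beta>]\<^sub>\<pi>\<close> evaluated on \<open>r(Z)\<close>.
\<close>

definition pn_compatible :: "'m manifold \<Rightarrow> 'm bivector \<Rightarrow>
    ('m \<Rightarrow> 'm tangent \<Rightarrow> 'm tangent) \<Rightarrow> bool" where
  "pn_compatible M \<pi> r \<longleftrightarrow>
     (let rt = transpose_map (tangent_bundle M) r; P = sharp M \<pi> in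
      (\<forall>p. \<forall>\<alpha>\<in>fibre (cotangent_bundle M) p. r p (P p \<alpha>) = P p (rt p \<alpha>)) \<and>
      (\<forall>\<alpha>\<in>one_forms M. \<forall>\<beta>\<in>one_forms M. \<forall>Z\<in>vector_fields M.
         koszul_bracket (\<lambda>p \<xi>. r p (P p \<xi>)) \<alpha> \<beta> Z =
           koszul_bracket P (app rt \<alpha>) \<beta> Z + koszul_bracket P \<alpha> (app rt \<beta>) Z
           - koszul_bracket P \<alpha> \<beta> (app r Z)))"

definition poisson_nijenhuis :: "'m manifold \<Rightarrow> 'm bivector \<Rightarrow>
    ('m \<Rightarrow> 'm tangent \<Rightarrow> 'm tangent) \<Rightarrow> bool" where
  "poisson_nijenhuis M \<pi> r \<longleftrightarrow>
     poisson_bivector M \<pi> \<and> bundle_map (tangent_bundle M) (tangent_bundle M) r \<and>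
     pn_compatible M \<pi> r \<and>
     (\<forall>X\<in>vector_fields M. \<forall>Y\<in>vector_fields M. nijenhuis_torsion r X Y = 0)"

section \<open>Generalized derivations of degree 1\<close>

text \<open>
  \<open>D X u\<close> is \<open>D\<^sub>X(u)\<close>; an \<open>E\<close>-valued 1-form is a \<open>C\<^sup>\<infinity>(M)\<close>-linear map from vector fields to
  sections of \<open>E\<close>.
\<close>

definition gder1 :: "'m::topological_space manifold \<Rightarrow> ('m, 'v::real_vector) vbundle \<Rightarrow>
    ('m vfield \<Rightarrow> ('m \<Rightarrow> 'v) \<Rightarrow> 'm \<Rightarrow> 'v) \<Rightarrow> ('m \<Rightarrow> 'v \<Rightarrow> 'v) \<Rightarrow>
    ('m \<Rightarrow> 'm tangent \<Rightarrow> 'm tangent) \<Rightarrow> bool" where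
  "gder1 M E D l r \<longleftrightarrow>
     bundle_map E E l \<and> bundle_map (tangent_bundle M) (tangent_bundle M) r \<and>
     (\<forall>X\<in>vector_fields M. \<forall>u\<in>sections E. D X u \<in> sections E) \<and>
     (\<forall>X\<in>vector_fields M. \<forall>Y\<in>vector_fields M. \<forall>u\<in>sections E. D (X + Y) u = D X u + D Y u) \<and>
     (\<forall>f\<in>smooth_functions M. \<forall>X\<in>vector_fields M. \<forall>u\<in>sections E. D (f \<odot> X) u = f \<odot> D X u) \<and>
     (\<forall>X\<in>vector_fields M. \<forall>u\<in>sections E. \<forall>v\<in>sections E. D X (u + v) = D X u + D X v) \<and>
     (\<forall>X\<in>vector_fields M. \<forall>c. \<forall>u\<in>sections E. D X (c *\<^sub>R u) = c *\<^sub>R D X u) \<and>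
     (\<forall>X\<in>vector_fields M. \<forall>f\<in>smooth_functions M. \<forall>u\<in>sections E.
        D X (f \<odot> u) = f \<odot> D X u + lie_fun X f \<odot> app l u - lie_fun (app r X) f \<odot> u)"

text \<open>The dual of \<open>(D, l, r)\<close> is \<open>(gder_dual M E D l r, transpose_map E l, r)\<close>.\<close>

definition gder_dual :: "'m manifold \<Rightarrow> ('m, 'v::real_vector) vbundle \<Rightarrow>
    ('m vfield \<Rightarrow> ('m \<Rightarrow> 'v) \<Rightarrow> 'm \<Rightarrow> 'v) \<Rightarrow> ('m \<Rightarrow> 'v \<Rightarrow> 'v) \<Rightarrow>
    ('m \<Rightarrow> 'm tangent \<Rightarrow> 'm tangent) \<Rightarrow> 'm vfield \<Rightarrow> ('m \<Rightarrow> 'v \<Rightarrow> real) \<Rightarrow> 'm \<Rightarrow> 'v \<Rightarrow> real" where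
  "gder_dual M E D l r X \<mu> = dual_section M E
     (\<lambda>u. lie_fun X (pairing \<mu> (app l u)) - lie_fun (app r X) (pairing \<mu> u) - pairing \<mu> (D X u))"

text \<open>The condition \<open>[\<D>, \<D>] = 0\<close>, written out in components.\<close>

definition gder_self_commuting :: "'m manifold \<Rightarrow> ('m, 'v::real_vector) vbundle \<Rightarrow>
    ('m vfield \<Rightarrow> ('m \<Rightarrow> 'v) \<Rightarrow> 'm \<Rightarrow> 'v) \<Rightarrow> ('m \<Rightarrow> 'v \<Rightarrow> 'v) \<Rightarrow>
    ('m \<Rightarrow> 'm tangent \<Rightarrow> 'm tangent) \<Rightarrow> bool" where
  "gder_self_commuting M E D l r \<longleftrightarrow>
     (\<forall>X\<in>vector_fields M. \<forall>Y\<in>vector_fields M. nijenhuis_torsion r X Y = 0) \<and>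
     (\<forall>X\<in>vector_fields M. \<forall>u\<in>sections E. D X (app l u) = app l (D X u)) \<and>
     (\<forall>X\<in>vector_fields M. \<forall>Y\<in>vector_fields M. \<forall>u\<in>sections E.
        D X (D Y u) - D Y (D X u)
        - D (vf_bracket (app r Y) X + vf_bracket Y (app r X) - app r (vf_bracket Y X)) u
        + app l (D (vf_bracket Y X) u) = 0)"

section \<open>Lie algebroids and IM (1,1)-tensors\<close>

definition lie_algebroid :: "'m::topological_space manifold \<Rightarrow> ('m, 'v::real_vector) vbundle \<Rightarrow>
    (('m \<Rightarrow> 'v) \<Rightarrow> ('m \<Rightarrow> 'v) \<Rightarrow> 'm \<Rightarrow> 'v) \<Rightarrow> ('m \<Rightarrow> 'v \<Rightarrow> 'm tangent) \<Rightarrow> bool" where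
  "lie_algebroid M A br \<rho> \<longleftrightarrow>
     vector_bundle M A \<and> bundle_map A (tangent_bundle M) \<rho> \<and>
     (\<forall>a\<in>sections A. \<forall>b\<in>sections A. br a b \<in> sections A) \<and>
     (\<forall>a\<in>sections A. \<forall>b\<in>sections A. \<forall>c\<in>sections A. br a (b + c) = br a b + br a c) \<and>
     (\<forall>x. \<forall>a\<in>sections A. \<forall>b\<in>sections A. br a (x *\<^sub>R b) = x *\<^sub>R br a b) \<and>
     (\<forall>a\<in>sections A. \<forall>b\<in>sections A. br a b = - br b a) \<and>
     (\<forall>a\<in>sections A. \<forall>b\<in>sections A. \<forall>c\<in>sections A.
        br a (br b c) + br b (br c a) + br c (br a b) = 0) \<and>
     (\<forall>f\<in>smooth_functions M. \<forall>a\<in>sections A. \<forall>b\<in>sections A.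
        br a (f \<odot> b) = f \<odot> br a b + lie_fun (app \<rho> a) f \<odot> b)"

definition im_tensor :: "'m::topological_space manifold \<Rightarrow> ('m, 'v::real_vector) vbundle \<Rightarrow>
    (('m \<Rightarrow> 'v) \<Rightarrow> ('m \<Rightarrow> 'v) \<Rightarrow> 'm \<Rightarrow> 'v) \<Rightarrow> ('m \<Rightarrow> 'v \<Rightarrow> 'm tangent) \<Rightarrow>
    ('m vfield \<Rightarrow> ('m \<Rightarrow> 'v) \<Rightarrow> 'm \<Rightarrow> 'v) \<Rightarrow> ('m \<Rightarrow> 'v \<Rightarrow> 'v) \<Rightarrow>
    ('m \<Rightarrow> 'm tangent \<Rightarrow> 'm tangent) \<Rightarrow> bool" where
  "im_tensor M A br \<rho> D l r \<longleftrightarrow> gder1 M A D l r \<and>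
     (\<forall>a\<in>sections A. \<forall>b\<in>sections A. \<forall>X\<in>vector_fields M.
        D X (br a b) = br a (D X b) - br b (D X a)
          + D (vf_bracket (app \<rho> b) X) a - D (vf_bracket (app \<rho> a) X) b) \<and>
     (\<forall>a\<in>sections A. \<forall>b\<in>sections A. app l (br a b) = br a (app l b) - D (app \<rho> b) a) \<and>
     (\<forall>a\<in>sections A. \<forall>X\<in>vector_fields M.
        app r (vf_bracket (app \<rho> a) X) = vf_bracket (app \<rho> a) (app r X) - app \<rho> (D X a)) \<and>
     (\<forall>p. \<forall>v\<in>fibre A p. r p (\<rho> p v) = \<rho> p (l p v))"

section \<open>Lie bialgebroids\<close>

text \<open>
  Sections of \<open>\<Lambda>\<^sup>0A\<close>, \<open>\<Lambda>\<^sup>1A\<close>, \<open>\<Lambda>\<^sup>2A\<close> are regarded as forms on \<open>A\<^sup>*\<close>: functions, linear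
  functionals and bilinear functionals on the sections of \<open>A\<^sup>*\<close>; a section \<open>a\<close> of \<open>A\<close> is the
  functional \<open>\<mu> \<mapsto> \<langle>\<mu>, a\<rangle>\<close>.  The Lie algebroid differential of a Lie algebroid \<open>(E, br, \<rho>)\<close> on
  forms of degree 0 and 1 is as follows (for \<open>d\<^sub>*\<close>, take \<open>E = A\<^sup>*\<close>).
\<close>

definition algd_0 :: "('m \<Rightarrow> 'v \<Rightarrow> 'm tangent) \<Rightarrow> ('m \<Rightarrow> real) \<Rightarrow> ('m \<Rightarrow> 'v) \<Rightarrow> 'm \<Rightarrow> real" where
  "algd_0 \<rho> f e = lie_fun (app \<rho> e) f"

definition algd_1 :: "(('m \<Rightarrow> 'v) \<Rightarrow> ('m \<Rightarrow> 'v) \<Rightarrow> 'm \<Rightarrow> 'v) \<Rightarrow> ('m \<Rightarrow> 'v \<Rightarrow> 'm tangent) \<Rightarrow>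
    (('m \<Rightarrow> 'v) \<Rightarrow> 'm \<Rightarrow> real) \<Rightarrow> ('m \<Rightarrow> 'v) \<Rightarrow> ('m \<Rightarrow> 'v) \<Rightarrow> 'm \<Rightarrow> real" where
  "algd_1 br \<rho> \<phi> e1 e2 = lie_fun (app \<rho> e1) (\<phi> e2) - lie_fun (app \<rho> e2) (\<phi> e1) - \<phi> (br e1 e2)"

text \<open>\<open>\<L>\<^sub>a\<mu>\<close> and \<open>d\<^sub>Af\<close> as sections of \<open>A\<^sup>*\<close>.\<close>

definition lie_dual :: "'m manifold \<Rightarrow> ('m, 'v::real_vector) vbundle \<Rightarrow>
    (('m \<Rightarrow> 'v) \<Rightarrow> ('m \<Rightarrow> 'v) \<Rightarrow> 'm \<Rightarrow> 'v) \<Rightarrow> ('m \<Rightarrow> 'v \<Rightarrow> 'm tangent) \<Rightarrow>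
    ('m \<Rightarrow> 'v) \<Rightarrow> ('m \<Rightarrow> 'v \<Rightarrow> real) \<Rightarrow> 'm \<Rightarrow> 'v \<Rightarrow> real" where
  "lie_dual M A br \<rho> a \<mu> =
     dual_section M A (\<lambda>b. lie_fun (app \<rho> a) (pairing \<mu> b) - pairing \<mu> (br a b))"

definition algd_fun :: "'m manifold \<Rightarrow> ('m, 'v::real_vector) vbundle \<Rightarrow>
    ('m \<Rightarrow> 'v \<Rightarrow> 'm tangent) \<Rightarrow> ('m \<Rightarrow> real) \<Rightarrow> 'm \<Rightarrow> 'v \<Rightarrow> real" where
  "algd_fun M A \<rho> f = dual_section M A (algd_0 \<rho> f)"

text \<open>
  Schouten brackets \<open>[a, P]\<close>, \<open>[a, \<Lambda>]\<close>, \<open>[P, f]\<close>, \<open>[\<Lambda>, f]\<close> for \<open>a\<close> a section of \<open>A\<close>, \<open>f\<close> a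
  function, and \<open>P\<close>, \<open>\<Lambda>\<close> of degree 1, 2.  The remaining brackets used below follow from
  \<open>[P, Q] = -(-1)\<^bsup>(p-1)(q-1)\<^esup>[Q, P]\<close>: \<open>[f, P] = -[P, f]\<close> and \<open>[\<Lambda>, a] = -[a, \<Lambda>]\<close>.
\<close>

definition schouten_1_1 :: "'m manifold \<Rightarrow> ('m, 'v::real_vector) vbundle \<Rightarrow>
    (('m \<Rightarrow> 'v) \<Rightarrow> ('m \<Rightarrow> 'v) \<Rightarrow> 'm \<Rightarrow> 'v) \<Rightarrow> ('m \<Rightarrow> 'v \<Rightarrow> 'm tangent) \<Rightarrow> ('m \<Rightarrow> 'v) \<Rightarrow>
    (('m \<Rightarrow> 'v \<Rightarrow> real) \<Rightarrow> 'm \<Rightarrow> real) \<Rightarrow> ('m \<Rightarrow> 'v \<Rightarrow> real) \<Rightarrow> 'm \<Rightarrow> real" where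
  "schouten_1_1 M A br \<rho> a P \<mu> = lie_fun (app \<rho> a) (P \<mu>) - P (lie_dual M A br \<rho> a \<mu>)"

definition schouten_1_2 :: "'m manifold \<Rightarrow> ('m, 'v::real_vector) vbundle \<Rightarrow>
    (('m \<Rightarrow> 'v) \<Rightarrow> ('m \<Rightarrow> 'v) \<Rightarrow> 'm \<Rightarrow> 'v) \<Rightarrow> ('m \<Rightarrow> 'v \<Rightarrow> 'm tangent) \<Rightarrow> ('m \<Rightarrow> 'v) \<Rightarrow>
    (('m \<Rightarrow> 'v \<Rightarrow> real) \<Rightarrow> ('m \<Rightarrow> 'v \<Rightarrow> real) \<Rightarrow> 'm \<Rightarrow> real) \<Rightarrow>
    ('m \<Rightarrow> 'v \<Rightarrow> real) \<Rightarrow> ('m \<Rightarrow> 'v \<Rightarrow> real) \<Rightarrow> 'm \<Rightarrow> real" where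
  "schouten_1_2 M A br \<rho> a \<Lambda> \<mu> \<nu> = lie_fun (app \<rho> a) (\<Lambda> \<mu> \<nu>)
     - \<Lambda> (lie_dual M A br \<rho> a \<mu>) \<nu> - \<Lambda> \<mu> (lie_dual M A br \<rho> a \<nu>)"

definition schouten_1_0 :: "'m manifold \<Rightarrow> ('m, 'v::real_vector) vbundle \<Rightarrow>
    ('m \<Rightarrow> 'v \<Rightarrow> 'm tangent) \<Rightarrow> (('m \<Rightarrow> 'v \<Rightarrow> real) \<Rightarrow> 'm \<Rightarrow> real) \<Rightarrow>
    ('m \<Rightarrow> real) \<Rightarrow> 'm \<Rightarrow> real" where
  "schouten_1_0 M A \<rho> P f = P (algd_fun M A \<rho> f)"

definition schouten_2_0 :: "'m manifold \<Rightarrow> ('m, 'v::real_vector) vbundle \<Rightarrow>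
    ('m \<Rightarrow> 'v \<Rightarrow> 'm tangent) \<Rightarrow>
    (('m \<Rightarrow> 'v \<Rightarrow> real) \<Rightarrow> ('m \<Rightarrow> 'v \<Rightarrow> real) \<Rightarrow> 'm \<Rightarrow> real) \<Rightarrow>
    ('m \<Rightarrow> real) \<Rightarrow> ('m \<Rightarrow> 'v \<Rightarrow> real) \<Rightarrow> 'm \<Rightarrow> real" where
  "schouten_2_0 M A \<rho> \<Lambda> f \<mu> = \<Lambda> \<mu> (algd_fun M A \<rho> f)"

text \<open>
  A Lie bialgebroid: \<open>d\<^sub>*\<close> is a derivation of the Schouten bracket,
  \<open>d\<^sub>*[P, Q] = [d\<^sub>*P, Q] + (-1)\<^bsup>p-1\<^esup>[P, d\<^sub>*Q]\<close>, required on \<open>C\<^sup>\<infinity>(M)\<close> and on the sections of \<open>A\<close>,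
  which generate the sections of \<open>\<Lambda>A\<close> as an algebra.  If the rank of \<open>A\<close> is at least 2, the
  condition for two sections of \<open>A\<close> implies the two others; in rank 1 it is vacuous
  (\<open>\<Lambda>\<^sup>2A = 0\<close>) and would not even make the induced tensor on \<open>M\<close> skew-symmetric.
\<close>

definition lie_bialgebroid :: "'m::topological_space manifold \<Rightarrow> ('m, 'v::real_vector) vbundle \<Rightarrow>
    (('m \<Rightarrow> 'v) \<Rightarrow> ('m \<Rightarrow> 'v) \<Rightarrow> 'm \<Rightarrow> 'v) \<Rightarrow> ('m \<Rightarrow> 'v \<Rightarrow> 'm tangent) \<Rightarrow>
    (('m \<Rightarrow> 'v \<Rightarrow> real) \<Rightarrow> ('m \<Rightarrow> 'v \<Rightarrow> real) \<Rightarrow> 'm \<Rightarrow> 'v \<Rightarrow> real) \<Rightarrow>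
    ('m \<Rightarrow> ('v \<Rightarrow> real) \<Rightarrow> 'm tangent) \<Rightarrow> bool" where
  "lie_bialgebroid M A br \<rho> brs \<rho>s \<longleftrightarrow>
     lie_algebroid M A br \<rho> \<and> lie_algebroid M (dual_bundle M A) brs \<rho>s \<and>
     (\<forall>a\<in>sections A. \<forall>b\<in>sections A.
        \<forall>\<mu>\<in>sections (dual_bundle M A). \<forall>\<nu>\<in>sections (dual_bundle M A).
          algd_1 brs \<rho>s (\<lambda>\<xi>. pairing \<xi> (br a b)) \<mu> \<nu> =
            - schouten_1_2 M A br \<rho> b (algd_1 brs \<rho>s (\<lambda>\<xi>. pairing \<xi> a)) \<mu> \<nu>
            + schouten_1_2 M A br \<rho> a (algd_1 brs \<rho>s (\<lambda>\<xi>. pairing \<xi> b)) \<mu> \<nu>) \<and>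
     (\<forall>a\<in>sections A. \<forall>f\<in>smooth_functions M. \<forall>\<mu>\<in>sections (dual_bundle M A).
        algd_0 \<rho>s (lie_fun (app \<rho> a) f) \<mu> =
          schouten_2_0 M A \<rho> (algd_1 brs \<rho>s (\<lambda>\<xi>. pairing \<xi> a)) f \<mu>
          + schouten_1_1 M A br \<rho> a (algd_0 \<rho>s f) \<mu>) \<and>
     (\<forall>f\<in>smooth_functions M. \<forall>g\<in>smooth_functions M.
        0 = schouten_1_0 M A \<rho> (algd_0 \<rho>s f) g + schouten_1_0 M A \<rho> (algd_0 \<rho>s g) f)"

text \<open>The bivector field \<open>\<pi>\<close> on \<open>M\<close> with \<open>\<pi>\<^sup>\<sharp> = \<rho>\<^sub>* \<circ> \<rho>\<^sup>*\<close>, i.e. \<open>\<pi>(\<alpha>, \<beta>) = \<langle>\<beta>, \<rho>\<^sub>*(\<rho>\<^sup>*\<alpha>)\<rangle>\<close>.\<close>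

definition bialgebroid_bivector :: "('m, 'v) vbundle \<Rightarrow> ('m \<Rightarrow> 'v \<Rightarrow> 'm tangent) \<Rightarrow>
    ('m \<Rightarrow> ('v \<Rightarrow> real) \<Rightarrow> 'm tangent) \<Rightarrow> 'm bivector" where
  "bialgebroid_bivector A \<rho> \<rho>s = (\<lambda>p \<alpha> \<beta>. \<beta> (\<rho>s p (transpose_map A \<rho> p \<alpha>)))"

definition lie_nijenhuis_bialgebroid ::
    "'m::topological_space manifold \<Rightarrow> ('m, 'v::real_vector) vbundle \<Rightarrow>
    (('m \<Rightarrow> 'v) \<Rightarrow> ('m \<Rightarrow> 'v) \<Rightarrow> 'm \<Rightarrow> 'v) \<Rightarrow> ('m \<Rightarrow> 'v \<Rightarrow> 'm tangent) \<Rightarrow>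
    (('m \<Rightarrow> 'v \<Rightarrow> real) \<Rightarrow> ('m \<Rightarrow> 'v \<Rightarrow> real) \<Rightarrow> 'm \<Rightarrow> 'v \<Rightarrow> real) \<Rightarrow>
    ('m \<Rightarrow> ('v \<Rightarrow> real) \<Rightarrow> 'm tangent) \<Rightarrow>
    ('m vfield \<Rightarrow> ('m \<Rightarrow> 'v) \<Rightarrow> 'm \<Rightarrow> 'v) \<Rightarrow> ('m \<Rightarrow> 'v \<Rightarrow> 'v) \<Rightarrow>
    ('m \<Rightarrow> 'm tangent \<Rightarrow> 'm tangent) \<Rightarrow> bool" where
  "lie_nijenhuis_bialgebroid M A br \<rho> brs \<rho>s D l r \<longleftrightarrow>
     lie_bialgebroid M A br \<rho> brs \<rho>s \<and>
     im_tensor M A br \<rho> D l r \<and>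
     im_tensor M (dual_bundle M A) brs \<rho>s (gder_dual M A D l r) (transpose_map A l) r \<and>
     gder_self_commuting M A D l r"

definition deformed_bracket :: "(('m \<Rightarrow> 'v) \<Rightarrow> ('m \<Rightarrow> 'v) \<Rightarrow> 'm \<Rightarrow> 'v::real_vector) \<Rightarrow>
    ('m \<Rightarrow> 'v \<Rightarrow> 'v) \<Rightarrow> ('m \<Rightarrow> 'v) \<Rightarrow> ('m \<Rightarrow> 'v) \<Rightarrow> 'm \<Rightarrow> 'v" where
  "deformed_bracket br l a b = br (app l a) b + br a (app l b) - app l (br a b)"

end

theory Submission
  imports Defs
begin

text \<open>
  Everything is reduced to identities between smooth functions, by pairing with sections of
  \<open>A\<^sup>*\<close>.  The analytic input is that \<open>C\<^sup>\<infinity>(M)\<close>-linear maps on \<open>\<Gamma>(A)\<close> and \<open>\<Gamma>(A\<^sup>*)\<close> are pairings with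
  sections, which follows by cutting off local frames with bump functions.

  The axioms (IM2), (IM4) for \<open>A\<^sup>*\<close> give \<open>d\<^sub>*(l a)(\<mu>, \<nu>) = d\<^sub>*a(\<mu>, l\<^sup>*\<nu>) - \<langle>\<mu>, D\<^bsub>\<rho>\<^sub>*\<nu>\<^esub> a\<rangle>\<close>, and those for
  \<open>A\<close> give \<open>[a, b]\<^sub>l = [l a, b] + D\<^bsub>\<rho> b\<^esub> a\<close> and \<open>\<L>\<^sup>l\<^sub>a \<mu> = \<L>\<^bsub>l a\<^esub> \<mu> - \<theta>(a, \<mu>)\<close> with
  \<open>\<langle>\<theta>(a, \<mu>), c\<rangle> = \<langle>\<mu>, D\<^bsub>\<rho> c\<^esub> a\<rangle>\<close>.  The bialgebroid condition for \<open>a\<close>, \<open>f\<close> identifies the anchor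
  of \<open>i\<^sub>\<nu> d\<^sub>*b\<close> as \<open>\<rho>\<^sub>*(\<L>\<^sub>b \<nu>) - [\<rho> b, \<rho>\<^sub>*\<nu>]\<close>, so that \<open>d\<^sub>*b(\<nu>, \<theta>(a, \<mu>))\<close> is the value of
  \<open>\<langle>\<mu>, D a\<rangle>\<close> on this vector field; with (IM1) for \<open>X = \<rho>\<^sub>*\<nu>\<close> this is the bialgebroid condition of the
  deformed bracket.  The relation \<open>D\<^sub>X \<circ> l = l \<circ> D\<^sub>X\<close> makes the torsion of \<open>l\<close> vanish, and the curvature
  part of \<open>[\<D>, \<D>] = 0\<close> is used only for (IM1) of the deformed bracket.

  On the base, \<open>d\<^sub>*f\<close> is a section of \<open>A\<close> with anchor \<open>-X\<^sub>f\<close>, where \<open>X\<^sub>f = \<pi>\<^sup>\<sharp>(df)\<close>; inserting it into the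
  bialgebroid condition for \<open>a\<close>, \<open>f\<close> yields \<open>[X\<^sub>f, X\<^sub>g] = X\<^bsub>{f, g}\<^esub>\<close>.  The compatibility of the Koszul
  brackets compares (IM3) for \<open>A\<close> with (IM3) for \<open>A\<^sup>*\<close>.
\<close>

section \<open>Calculus of smooth functions\<close>

lemma openin_Euclidean_space_iff:
  "openin (Euclidean_space n) S \<longleftrightarrow> (\<exists>T. open T \<and> S = T \<inter> {x. \<forall>i\<ge>n. x i = 0})"
  by (simp add: Euclidean_space_def euclidean_product_topology openin_subtopology)

text \<open>The derivatives in \<open>C_k\<close> are two-sided at \<open>x i\<close>, so replacing
  \<open>f\<close> by a function that agrees with it only on \<open>S\<close> needs the coordinate
  line through \<open>x\<close> to stay in \<open>S\<close> near \<open>x i\<close>. The bound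
  \<open>i < n\<close> keeps the updated point in the coordinate subspace.\<close>

lemma eventually_fun_upd_in:
  assumes "openin (Euclidean_space n) S" "x \<in> S" "i < n"
  shows "\<forall>\<^sub>F t in nhds (x i). x(i := t) \<in> S"
proof -
  obtain T where T: "open T" "S = T \<inter> {x. \<forall>i\<ge>n. x i = 0}"
    using assms(1) unfolding openin_Euclidean_space_iff by blast
  have "continuous_on UNIV (\<lambda>t. (x(i := t)) j)" for j
    by (cases "j = i") auto
  then have "continuous_on UNIV (\<lambda>t. x(i := t))"
    by (rule continuous_on_coordinatewise_then_product)
  then have "open ((\<lambda>t. x(i := t)) -` T)"
    using T(1) open_vimage by blast
  moreover have "x i \<in> (\<lambda>t. x(i := t)) -` T"
    using assms T by simp
  ultimately have "\<forall>\<^sub>F t in nhds (x i). t \<in> (\<lambda>t. x(i := t)) -` T"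
    by (meson eventually_nhds)
  then show ?thesis
    by eventually_elim (use assms T in auto)
qed

lemma C_k_SucE:
  assumes "C_k (Suc k) n S f" "i < n"
  obtains g where "\<And>x. x \<in> S \<Longrightarrow> ((\<lambda>t. f (x(i := t))) has_real_derivative g x) (at (x i))"
    "C_k k n S g"
  using assms unfolding C_k.simps by blast

lemma C_k_SucI:
  assumes "continuous_on S f"
    "\<And>i. i < n \<Longrightarrow> \<exists>g. (\<forall>x\<in>S. ((\<lambda>t. f (x(i := t))) has_real_derivative g x) (at (x i))) \<and> C_k k n S g"
  shows "C_k (Suc k) n S f"
  using assms unfolding C_k.simps by blast

lemma C_k_continuous_on: "C_k k n S f \<Longrightarrow> continuous_on S f"
  by (cases k) simp_all

lemma C_k_subset: "C_k k n S f \<Longrightarrow> T \<subseteq> S \<Longrightarrow> C_k k n T f"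
proof (induction k arbitrary: f)
  case 0
  then show ?case using continuous_on_subset by auto
next
  case (Suc k)
  show ?case
  proof (rule C_k_SucI)
    show "continuous_on T f" using Suc.prems C_k_continuous_on continuous_on_subset by blast
    fix i assume "i < n"
    from Suc.prems(1) this obtain g where
      "\<And>x. x \<in> S \<Longrightarrow> ((\<lambda>t. f (x(i := t))) has_real_derivative g x) (at (x i))" "C_k k n S g"
      by (rule C_k_SucE) (rule that)
    then show "\<exists>g. (\<forall>x\<in>T. ((\<lambda>t. f (x(i := t))) has_real_derivative g x) (at (x i))) \<and> C_k k n T g"
      using Suc.IH Suc.prems(2) by (intro exI[of _ g]) auto
  qed
qed

text \<open>Beyond continuity, the successor clause of \<open>C_k\<close> constrains only the
  partial derivatives, so lowering the order takes an induction. The product and chain rules use it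
  for the undifferentiated factors.\<close>

lemma C_k_Suc_imp: "C_k (Suc k) n S f \<Longrightarrow> C_k k n S f"
proof (induction k arbitrary: f)
  case 0
  then show ?case by simp
next
  case (Suc k)
  show ?case
  proof (rule C_k_SucI)
    show "continuous_on S f" using Suc.prems by (rule C_k_continuous_on)
    fix i assume "i < n"
    from Suc.prems this obtain g where
      "\<And>x. x \<in> S \<Longrightarrow> ((\<lambda>t. f (x(i := t))) has_real_derivative g x) (at (x i))" "C_k (Suc k) n S g"
      by (rule C_k_SucE) (rule that)
    then show "\<exists>g. (\<forall>x\<in>S. ((\<lambda>t. f (x(i := t))) has_real_derivative g x) (at (x i))) \<and> C_k k n S g"
      using Suc.IH by (intro exI[of _ g]) auto
  qed
qed

text \<open>Openness makes \<open>f\<close> and \<open>g\<close> agree near each point of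
  \<open>S\<close> along every coordinate line, so the partial derivatives chosen for
  \<open>f\<close> serve \<open>g\<close> unchanged.\<close>

lemma C_k_cong:
  assumes "openin (Euclidean_space n) S" "\<And>x. x \<in> S \<Longrightarrow> f x = g x" "C_k k n S f"
  shows "C_k k n S g"
proof (cases k)
  case 0
  then show ?thesis using assms(2,3) continuous_on_cong[of S S f g] by simp
next
  case (Suc j)
  show ?thesis
    unfolding Suc
  proof (rule C_k_SucI)
    show "continuous_on S g"
      using assms(2) C_k_continuous_on[OF assms(3)] continuous_on_cong[of S S f g] by simp
    fix i assume "i < n"
    from assms(3)[unfolded Suc] this obtain g' where
      g': "\<And>x. x \<in> S \<Longrightarrow> ((\<lambda>t. f (x(i := t))) has_real_derivative g' x) (at (x i))" "C_k j n S g'"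
      by (rule C_k_SucE) (rule that)
    have "((\<lambda>t. g (x(i := t))) has_real_derivative g' x) (at (x i))" if "x \<in> S" for x
    proof -
      have "\<forall>\<^sub>F t in nhds (x i). f (x(i := t)) = g (x(i := t))"
        using eventually_fun_upd_in[OF assms(1) that \<open>i < n\<close>] by eventually_elim (rule assms(2))
      from iffD1[OF DERIV_cong_ev[OF refl this refl] g'(1)[OF that]] show ?thesis .
    qed
    then show "\<exists>g'. (\<forall>x\<in>S. ((\<lambda>t. g (x(i := t))) has_real_derivative g' x) (at (x i))) \<and> C_k j n S g'"
      using g'(2) by (intro exI[of _ g']) auto
  qed
qed

lemma continuous_on_local:
  assumes S: "openin (Euclidean_space n) S"
    and loc: "\<And>x. x \<in> S \<Longrightarrow> \<exists>T. x \<in> T \<and> T \<subseteq> S \<and> openin (Euclidean_space n) T \<and> continuous_on T f"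
  shows "continuous_on S f"
  unfolding continuous_on_eq_continuous_within
proof
  fix x assume "x \<in> S"
  then obtain T where T: "x \<in> T" "T \<subseteq> S" "openin (Euclidean_space n) T" "continuous_on T f"
    using loc by blast
  obtain V where V: "open V" "T = V \<inter> {x. \<forall>i\<ge>n. x i = 0}"
    using T(3) unfolding openin_Euclidean_space_iff by blast
  have "S \<subseteq> {x. \<forall>i\<ge>n. x i = 0}"
    using S unfolding openin_Euclidean_space_iff by blast
  \<comment> \<open>Inside the ambient open set \<open>V\<close> the sets \<open>S\<close> and
    \<open>T\<close> coincide, so continuity at \<open>x\<close> within \<open>T\<close> is
    continuity within \<open>S\<close>.\<close>
  then have "S \<inter> V = T \<inter> V" using T(2) V by blast
  then have "at x within S = at x within T"
    using V T(1) by (intro at_within_nhd[of x V]) auto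
  then show "continuous (at x within S) f"
    using T(1,4) by (simp add: continuous_on_eq_continuous_within)
qed

lemma C_k_local:
  assumes S: "openin (Euclidean_space n) S"
    and loc: "\<And>x. x \<in> S \<Longrightarrow> \<exists>T. x \<in> T \<and> T \<subseteq> S \<and> openin (Euclidean_space n) T \<and> C_k k n T f"
  shows "C_k k n S f"
  using loc
proof (induction k arbitrary: f)
  case 0
  show ?case unfolding C_k.simps by (rule continuous_on_local[OF S]) (use 0 in simp)
next
  case (Suc k)
  show ?case
  proof (rule C_k_SucI)
    show "continuous_on S f"
    proof (rule continuous_on_local[OF S])
      fix x assume "x \<in> S"
      then obtain T where "x \<in> T" "T \<subseteq> S" "openin (Euclidean_space n) T" "C_k (Suc k) n T f"
        using Suc.prems[OF \<open>x \<in> S\<close>] by blast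
      then show "\<exists>T. x \<in> T \<and> T \<subseteq> S \<and> openin (Euclidean_space n) T \<and> continuous_on T f"
        using C_k_continuous_on[of "Suc k" n T f] by blast
    qed
    fix i assume "i < n"
    \<comment> \<open>Local witnesses agree on overlaps because derivatives are unique. Taking
      \<open>deriv\<close> glues them into one function on \<open>S\<close> without any choice of
      neighbourhoods.\<close>
    define g where "g = (\<lambda>x. deriv (\<lambda>t. f (x(i := t))) (x i))"
    have *: "\<exists>T. x \<in> T \<and> T \<subseteq> S \<and> openin (Euclidean_space n) T \<and> C_k k n T g \<and>
        ((\<lambda>t. f (x(i := t))) has_real_derivative g x) (at (x i))" if "x \<in> S" for x
    proof -
      obtain T where T: "x \<in> T" "T \<subseteq> S" "openin (Euclidean_space n) T" "C_k (Suc k) n T f"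
        using Suc.prems[OF \<open>x \<in> S\<close>] by blast
      from T(4) \<open>i < n\<close> obtain h where
        h: "\<And>x. x \<in> T \<Longrightarrow> ((\<lambda>t. f (x(i := t))) has_real_derivative h x) (at (x i))" "C_k k n T h"
        by (rule C_k_SucE) (rule that)
      have hg: "h y = g y" if "y \<in> T" for y
        unfolding g_def using DERIV_imp_deriv[OF h(1)[OF that]] by simp
      have "C_k k n T g" using C_k_cong[OF T(3) hg h(2)] .
      moreover have "((\<lambda>t. f (x(i := t))) has_real_derivative g x) (at (x i))"
        using h(1)[OF T(1)] hg[OF T(1)] by simp
      ultimately show ?thesis using T by blast
    qed
    then have "C_k k n S g" by (intro Suc.IH) blast
    then show "\<exists>g. (\<forall>x\<in>S. ((\<lambda>t. f (x(i := t))) has_real_derivative g x) (at (x i))) \<and> C_k k n S g"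
      using * by (intro exI[of _ g]) auto
  qed
qed

section \<open>Sums, products, composites and inverses\<close>

lemma C_k_const: "C_k k n S (\<lambda>x. c)"
  by (induction k arbitrary: c) (auto intro!: exI[of _ "\<lambda>x. 0"])

lemma C_k_add:
  "C_k k n S f \<Longrightarrow> C_k k n S g \<Longrightarrow> C_k k n S (\<lambda>x. f x + g x)"
proof (induction k arbitrary: f g)
  case 0
  then show ?case by (auto intro: continuous_intros)
next
  case (Suc k)
  show ?case
  proof (rule C_k_SucI)
    show "continuous_on S (\<lambda>x. f x + g x)"
      using Suc.prems by (intro continuous_intros C_k_continuous_on)
    fix i assume i: "i < n"
    from Suc.prems(1) i obtain f' where
      f': "\<And>x. x \<in> S \<Longrightarrow> ((\<lambda>t. f (x(i := t))) has_real_derivative f' x) (at (x i))" "C_k k n S f'"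
      by (rule C_k_SucE) (rule that)
    from Suc.prems(2) i obtain g' where
      g': "\<And>x. x \<in> S \<Longrightarrow> ((\<lambda>t. g (x(i := t))) has_real_derivative g' x) (at (x i))" "C_k k n S g'"
      by (rule C_k_SucE) (rule that)
    have "((\<lambda>t. f (x(i := t)) + g (x(i := t))) has_real_derivative f' x + g' x) (at (x i))" if "x \<in> S" for x
      using DERIV_add[OF f'(1)[OF that] g'(1)[OF that]] .
    then show "\<exists>h. (\<forall>x\<in>S. ((\<lambda>t. f (x(i := t)) + g (x(i := t))) has_real_derivative h x) (at (x i))) \<and> C_k k n S h"
      using Suc.IH[OF f'(2) g'(2)] by (intro exI[of _ "\<lambda>x. f' x + g' x"]) auto
  qed
qed

lemma C_k_mult:
  "C_k k n S f \<Longrightarrow> C_k k n S g \<Longrightarrow> C_k k n S (\<lambda>x. f x * g x)"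
proof (induction k arbitrary: f g)
  case 0
  then show ?case by (auto intro: continuous_intros)
next
  case (Suc k)
  show ?case
  proof (rule C_k_SucI)
    show "continuous_on S (\<lambda>x. f x * g x)"
      using Suc.prems by (intro continuous_intros C_k_continuous_on)
    fix i assume i: "i < n"
    from Suc.prems(1) i obtain f' where
      f': "\<And>x. x \<in> S \<Longrightarrow> ((\<lambda>t. f (x(i := t))) has_real_derivative f' x) (at (x i))" "C_k k n S f'"
      by (rule C_k_SucE) (rule that)
    from Suc.prems(2) i obtain g' where
      g': "\<And>x. x \<in> S \<Longrightarrow> ((\<lambda>t. g (x(i := t))) has_real_derivative g' x) (at (x i))" "C_k k n S g'"
      by (rule C_k_SucE) (rule that)
    have "((\<lambda>t. f (x(i := t)) * g (x(i := t))) has_real_derivative f' x * g x + g' x * f x) (at (x i))"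
      if "x \<in> S" for x
      using DERIV_mult[OF f'(1)[OF that] g'(1)[OF that]] by simp
    moreover have "C_k k n S (\<lambda>x. f' x * g x + g' x * f x)"
      using C_k_add[OF Suc.IH[OF f'(2) C_k_Suc_imp[OF Suc.prems(2)]]
          Suc.IH[OF g'(2) C_k_Suc_imp[OF Suc.prems(1)]]] .
    ultimately show "\<exists>h. (\<forall>x\<in>S. ((\<lambda>t. f (x(i := t)) * g (x(i := t))) has_real_derivative h x) (at (x i))) \<and> C_k k n S h"
      by (intro exI[of _ "\<lambda>x. f' x * g x + g' x * f x"]) auto
  qed
qed

text \<open>The outer function comes with the tower \<open>h\<close> of all its derivatives. Each
  use of the chain rule moves one level up the tower, so the induction on \<open>k\<close> has to
  leave \<open>j\<close> arbitrary.\<close>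

lemma C_k_compose:
  assumes h: "\<And>j x. x \<in> T \<Longrightarrow> (h j has_real_derivative h (Suc j) x) (at x)"
    and f: "C_k k n S f" "f ` S \<subseteq> T"
  shows "C_k k n S (\<lambda>x. h j (f x))"
  using f(1)
proof (induction k arbitrary: j)
  have cont: "continuous_on S (\<lambda>x. h j (f x))" if "continuous_on S f" for j
  proof (rule continuous_on_compose2[OF _ that f(2)])
    show "continuous_on T (h j)"
      using DERIV_isCont[OF h] by (intro continuous_at_imp_continuous_on) blast
  qed
  {
    case 0
    then show ?case using cont by simp
  next
    case (Suc k)
    show ?case
    proof (rule C_k_SucI)
      show "continuous_on S (\<lambda>x. h j (f x))" by (intro cont C_k_continuous_on[OF Suc.prems])
      fix i assume "i < n"
      from Suc.prems this obtain f' where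
        f': "\<And>x. x \<in> S \<Longrightarrow> ((\<lambda>t. f (x(i := t))) has_real_derivative f' x) (at (x i))" "C_k k n S f'"
        by (rule C_k_SucE) (rule that)
      have "((\<lambda>t. h j (f (x(i := t)))) has_real_derivative h (Suc j) (f x) * f' x) (at (x i))" if "x \<in> S" for x
        using that f(2) by (intro DERIV_chain2[OF _ f'(1)]) (auto intro!: h)
      moreover have "C_k k n S (\<lambda>x. h (Suc j) (f x) * f' x)"
        using C_k_mult[OF Suc.IH[OF C_k_Suc_imp[OF Suc.prems]] f'(2)] .
      ultimately show "\<exists>g. (\<forall>x\<in>S. ((\<lambda>t. h j (f (x(i := t)))) has_real_derivative g x) (at (x i))) \<and> C_k k n S g"
        by (intro exI[of _ "\<lambda>x. h (Suc j) (f x) * f' x"]) simp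
    qed
  }
qed

lemma C_k_inverse:
  assumes "C_k k n S f" "\<And>x. x \<in> S \<Longrightarrow> f x \<noteq> 0"
  shows "C_k k n S (\<lambda>x. inverse (f x))"
proof -
  \<comment> \<open>The successive derivatives of 1/x on the nonzero reals, as the tower required by
    \<open>C_k_compose\<close>.\<close>
  define h where "h = (\<lambda>j x::real. (-1) ^ j * fact j * inverse x ^ Suc j)"
  have der: "(h j has_real_derivative h (Suc j) x) (at x)" if "x \<in> -{0}" for j x
  proof -
    have "(inverse has_real_derivative - (inverse x ^ Suc (Suc 0))) (at x)"
      using that by (intro DERIV_inverse) simp
    from DERIV_cmult[OF DERIV_power_Suc[OF this, of j], of "(-1) ^ j * fact j"] show ?thesis
      by (simp add: h_def algebra_simps)
  qed
  have img: "f ` S \<subseteq> - {0}"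
    using assms(2) by force
  have "C_k k n S (\<lambda>x. h 0 (f x))"
    using C_k_compose[of "- {0}" h, OF der assms(1) img] .
  then show ?thesis by (simp add: h_def)
qed

text \<open>The \<open>j\<close>-th derivative of \<open>exp (-1/x)\<close> on \<open>x > 0\<close> is \<open>P\<^sub>j(1/x) exp (-1/x)\<close> with \<open>P\<^sub>j\<close> the
  following polynomial.\<close>

primrec flat_poly :: "nat \<Rightarrow> real poly" where
  "flat_poly 0 = 1"
| "flat_poly (Suc j) = monom 1 2 * (flat_poly j - pderiv (flat_poly j))"

definition flat :: "nat \<Rightarrow> real \<Rightarrow> real" where
  "flat j x = (if x \<le> 0 then 0 else poly (flat_poly j) (inverse x) * exp (- inverse x))"

lemma poly_over_exp_tendsto_0:
  fixes p :: "real poly"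
  shows "((\<lambda>y. poly p y * exp (- y)) \<longlongrightarrow> 0) at_top"
proof -
  have "((\<lambda>y. \<Sum>i\<le>degree p. coeff p i * (y ^ i / exp y)) \<longlongrightarrow> (\<Sum>i\<le>degree p. coeff p i * 0)) at_top"
    by (intro tendsto_intros tendsto_power_div_exp_0)
  moreover have "(\<lambda>y. \<Sum>i\<le>degree p. coeff p i * (y ^ i / exp y)) = (\<lambda>y. poly p y * exp (- y))"
    by (simp add: poly_altdef sum_distrib_right exp_minus divide_inverse mult.assoc)
  ultimately show ?thesis by simp
qed

text \<open>For positive \<open>x\<close> this is the recursion of \<open>flat_poly\<close>: the
  derivative of 1/x is minus its square, and the exponential contributes the opposite sign. At 0 the
  difference quotient tends to 0 because the exponential beats every polynomial in 1/x.\<close>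

lemma flat_DERIV: "(flat j has_real_derivative flat (Suc j) x) (at x)"
proof -
  consider "x < 0" | "x = 0" | "x > 0" by linarith
  then show ?thesis
  proof cases
    case 1
    have ev: "\<forall>\<^sub>F y in nhds x. 0 = flat j y"
      using eventually_nhds_in_open[of "{..<0}" x] 1 by (auto simp: flat_def elim: eventually_mono)
    have "((\<lambda>y. 0) has_real_derivative flat (Suc j) x) (at x)"
      using 1 by (simp add: flat_def)
    then show ?thesis using DERIV_cong_ev[OF refl ev refl] by blast
  next
    case 3
    have ev: "\<forall>\<^sub>F y in nhds x. flat j y = poly (flat_poly j) (inverse y) * exp (- inverse y)"
      using eventually_nhds_in_open[of "{0<..}" x] 3 by (auto simp: flat_def elim: eventually_mono)
    have "((\<lambda>y. poly (flat_poly j) (inverse y) * exp (- inverse y)) has_real_derivative flat (Suc j) x) (at x)"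
      using 3 by (auto intro!: derivative_eq_intros DERIV_chain2[OF poly_DERIV]
          simp: flat_def poly_monom algebra_simps power2_eq_square)
    then show ?thesis using DERIV_cong_ev[OF refl ev refl] by blast
  next
    case 2
    have "((\<lambda>h. flat j h / h) \<longlongrightarrow> 0) (at_right 0)"
    proof -
      \<comment> \<open>Prepending a zero coefficient multiplies the polynomial by its variable 1/h,
        which absorbs the division by \<open>h\<close> in the difference quotient.\<close>
      have "((\<lambda>h. poly (pCons 0 (flat_poly j)) (inverse h) * exp (- inverse h)) \<longlongrightarrow> 0) (at_right 0)"
        by (rule filterlim_compose[OF poly_over_exp_tendsto_0 filterlim_inverse_at_top_right])
      then show ?thesis
        by (rule Lim_transform_eventually) (auto simp: eventually_at_filter flat_def field_simps)
    qed
    moreover have "((\<lambda>h. flat j h / h) \<longlongrightarrow> 0) (at_left 0)"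
      by (rule tendsto_eventually) (auto simp: eventually_at_filter flat_def)
    ultimately have "((\<lambda>h. flat j h / h) \<longlongrightarrow> 0) (at 0)"
      using filterlim_split_at by blast
    then show ?thesis using 2 by (simp add: DERIV_def flat_def)
  qed
qed

lemma flat_pos_iff: "flat 0 x > 0 \<longleftrightarrow> x > 0"
  by (auto simp: flat_def)

lemma flat_eq_0_iff: "flat 0 x = 0 \<longleftrightarrow> x \<le> 0"
  by (auto simp: flat_def)

lemma C_k_flat: "C_k k n S f \<Longrightarrow> C_k k n S (\<lambda>x. flat 0 (f x))"
  by (rule C_k_compose[where T = UNIV]) (auto intro: flat_DERIV)

section \<open>Smooth functions on a manifold\<close>

lemma chart_homeomorphism:
  assumes "smooth_manifold M" "(U, \<phi>) \<in> charts M"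
  shows "open U" "inj_on \<phi> U" "\<phi> ` U \<subseteq> {x. \<forall>i\<ge>mdim M. x i = 0}"
    "continuous_on U \<phi>" "continuous_on (\<phi> ` U) (inv_into U \<phi>)"
    "\<And>W. open W \<Longrightarrow> openin (Euclidean_space (mdim M)) (\<phi> ` (U \<inter> W))"
proof -
  have *: "open U" "openin (Euclidean_space (mdim M)) (\<phi> ` U)"
    "homeomorphic_map (top_of_set U) (subtopology (Euclidean_space (mdim M)) (\<phi> ` U)) \<phi>"
    using assms by (auto simp: smooth_manifold_def)
  show "open U" by fact
  show sub: "\<phi> ` U \<subseteq> {x. \<forall>i\<ge>mdim M. x i = 0}"
    using openin_subset[OF *(2)] by (simp add: topspace_Euclidean_space)
  show inj: "inj_on \<phi> U"
    using homeomorphic_imp_injective_map[OF *(3)] by simp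
  \<comment> \<open>The image of the chart lies in the coordinate subspace, so its topology as a
    part of \<open>Euclidean_space\<close> is the one inherited from
    \<open>nat \<Rightarrow> real\<close>, to which \<open>continuous_on\<close> refers.\<close>
  have top: "subtopology (Euclidean_space (mdim M)) (\<phi> ` U) = top_of_set (\<phi> ` U)"
    unfolding Euclidean_space_def subtopology_subtopology euclidean_product_topology
    using sub by (simp add: Int_absorb1)
  obtain g where g: "homeomorphic_maps (top_of_set U) (top_of_set (\<phi> ` U)) \<phi> g"
    using *(3) homeomorphic_map_maps unfolding top by blast
  then have "continuous_on U \<phi>" "continuous_on (\<phi> ` U) g" "\<forall>x\<in>U. g (\<phi> x) = x"
    by (auto simp: homeomorphic_maps_def)
  moreover from this have "inv_into U \<phi> y = g y" if "y \<in> \<phi> ` U" for y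
    using that inj by auto
  ultimately show "continuous_on U \<phi>" "continuous_on (\<phi> ` U) (inv_into U \<phi>)"
    using continuous_on_cong[OF refl, of "\<phi> ` U" "inv_into U \<phi>" g] by blast+
  fix W :: "'a set" assume "open W"
  then have "openin (top_of_set U) (U \<inter> W)"
    by (simp add: openin_open_Int)
  then have "openin (subtopology (Euclidean_space (mdim M)) (\<phi> ` U)) (\<phi> ` (U \<inter> W))"
    using homeomorphic_imp_open_map[OF *(3)] unfolding open_map_def by blast
  then show "openin (Euclidean_space (mdim M)) (\<phi> ` (U \<inter> W))"
    by (rule openin_trans_full[OF _ *(2)])
qed

lemma chart_at:
  assumes "smooth_manifold M"
  obtains U \<phi> where "(U, \<phi>) \<in> charts M" "p \<in> U"
proof -
  have "p \<in> (\<Union>(U, \<phi>)\<in>charts M. U)"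
    using assms by (simp add: smooth_manifold_def)
  then show ?thesis using that by auto
qed

lemma smooth_onD:
  assumes "smooth_on M W f" "(U, \<phi>) \<in> charts M"
  shows "C_k k (mdim M) (\<phi> ` (U \<inter> W)) (\<lambda>x. f (inv_into U \<phi> x))"
  using bspec[OF assms(1)[unfolded smooth_on_def] assms(2)] by (simp add: C_infinity_def)

lemma smooth_onI:
  assumes "\<And>U \<phi> k. (U, \<phi>) \<in> charts M \<Longrightarrow>
    C_k k (mdim M) (\<phi> ` (U \<inter> W)) (\<lambda>x. f (inv_into U \<phi> x))"
  shows "smooth_on M W f"
  using assms by (auto simp: smooth_on_def C_infinity_def)

lemma smooth_on_subset:
  assumes "smooth_on M W f" "V \<subseteq> W"
  shows "smooth_on M V f"
proof (rule smooth_onI)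
  fix U \<phi> k assume "(U, \<phi>) \<in> charts M"
  from smooth_onD[OF assms(1) this]
  show "C_k k (mdim M) (\<phi> ` (U \<inter> V)) (\<lambda>x. f (inv_into U \<phi> x))"
    by (rule C_k_subset) (use assms(2) in auto)
qed

lemma inv_into_chart_mem:
  assumes "smooth_manifold M" "(U, \<phi>) \<in> charts M" "x \<in> \<phi> ` (U \<inter> W)"
  shows "inv_into U \<phi> x \<in> U \<inter> W"
  using assms chart_homeomorphism(2)[OF assms(1,2)] by auto

lemma smooth_on_cong:
  assumes "smooth_manifold M" "open W" "\<And>p. p \<in> W \<Longrightarrow> f p = g p" "smooth_on M W f"
  shows "smooth_on M W g"
proof (rule smooth_onI)
  fix U \<phi> k assume c: "(U, \<phi>) \<in> charts M"
  have "C_k k (mdim M) (\<phi> ` (U \<inter> W)) (\<lambda>x. f (inv_into U \<phi> x))"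
    using smooth_onD[OF assms(4) c] .
  then show "C_k k (mdim M) (\<phi> ` (U \<inter> W)) (\<lambda>x. g (inv_into U \<phi> x))"
    by (rule C_k_cong[rotated -1])
      (use chart_homeomorphism(6)[OF assms(1) c assms(2)] inv_into_chart_mem[OF assms(1) c] assms(3) in auto)
qed

lemma smooth_on_local:
  assumes M: "smooth_manifold M" "open W"
    and loc: "\<And>p. p \<in> W \<Longrightarrow> \<exists>V. p \<in> V \<and> V \<subseteq> W \<and> open V \<and> smooth_on M V f"
  shows "smooth_on M W f"
proof (rule smooth_onI)
  fix U \<phi> k assume c: "(U, \<phi>) \<in> charts M"
  show "C_k k (mdim M) (\<phi> ` (U \<inter> W)) (\<lambda>x. f (inv_into U \<phi> x))"
  proof (rule C_k_local)
    show "openin (Euclidean_space (mdim M)) (\<phi> ` (U \<inter> W))"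
      using chart_homeomorphism(6)[OF M(1) c M(2)] .
    fix x assume "x \<in> \<phi> ` (U \<inter> W)"
    then obtain p where p: "p \<in> U" "p \<in> W" "x = \<phi> p" by blast
    obtain V where V: "p \<in> V" "V \<subseteq> W" "open V" "smooth_on M V f"
      using loc[OF p(2)] by blast
    have "C_k k (mdim M) (\<phi> ` (U \<inter> V)) (\<lambda>x. f (inv_into U \<phi> x))"
      using smooth_onD[OF V(4) c] .
    then show "\<exists>T. x \<in> T \<and> T \<subseteq> \<phi> ` (U \<inter> W) \<and> openin (Euclidean_space (mdim M)) T \<and>
        C_k k (mdim M) T (\<lambda>x. f (inv_into U \<phi> x))"
      using chart_homeomorphism(6)[OF M(1) c V(3)] V p
      by (intro exI[of _ "\<phi> ` (U \<inter> V)"]) auto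
  qed
qed

section \<open>The algebra of smooth functions\<close>

lemma smooth_on_const: "smooth_on M W (\<lambda>p. c)"
  by (intro smooth_onI C_k_const)

lemma smooth_on_add: "smooth_on M W f \<Longrightarrow> smooth_on M W g \<Longrightarrow> smooth_on M W (\<lambda>p. f p + g p)"
  by (rule smooth_onI) (rule C_k_add; rule smooth_onD)

lemma smooth_on_mult: "smooth_on M W f \<Longrightarrow> smooth_on M W g \<Longrightarrow> smooth_on M W (\<lambda>p. f p * g p)"
  by (rule smooth_onI) (rule C_k_mult; rule smooth_onD)

lemma smooth_on_prod:
  "finite I \<Longrightarrow> (\<And>i. i \<in> I \<Longrightarrow> smooth_on M W (f i)) \<Longrightarrow> smooth_on M W (\<lambda>p. \<Prod>i\<in>I. f i p)"
  by (induction I rule: finite_induct) (auto intro: smooth_on_const smooth_on_mult)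

lemma smooth_on_inverse:
  assumes "smooth_manifold M" "smooth_on M W f" "\<And>p. p \<in> W \<Longrightarrow> f p \<noteq> 0"
  shows "smooth_on M W (\<lambda>p. inverse (f p))"
proof (rule smooth_onI)
  fix U \<phi> k assume c: "(U, \<phi>) \<in> charts M"
  show "C_k k (mdim M) (\<phi> ` (U \<inter> W)) (\<lambda>x. inverse (f (inv_into U \<phi> x)))"
    by (rule C_k_inverse[OF smooth_onD[OF assms(2) c]])
      (use assms(3) inv_into_chart_mem[OF assms(1) c] in blast)
qed

lemma smooth_on_flat: "smooth_on M W f \<Longrightarrow> smooth_on M W (\<lambda>p. flat 0 (f p))"
  by (rule smooth_onI) (rule C_k_flat, rule smooth_onD)

text \<open>Read in another chart, a coordinate is a component of a transition map.\<close>

lemma smooth_on_coordinate: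
  assumes "smooth_manifold M" "(U, \<phi>) \<in> charts M" "i < mdim M"
  shows "smooth_on M U (\<lambda>p. \<phi> p i)"
  unfolding smooth_on_def
proof clarify
  fix V \<psi> assume "(V, \<psi>) \<in> charts M"
  then show "C_infinity (mdim M) (\<psi> ` (V \<inter> U)) (\<lambda>x. \<phi> (inv_into V \<psi> x) i)"
    using assms unfolding smooth_manifold_def by blast
qed

lemma smooth_functions_iff: "f \<in> smooth_functions M \<longleftrightarrow> smooth_on M UNIV f"
  by (simp add: smooth_functions_def)

lemma smooth_functions_imp_smooth_on: "f \<in> smooth_functions M \<Longrightarrow> smooth_on M W f"
  using smooth_on_subset smooth_functions_iff by blast

lemma smooth_functions_const [intro, simp]: "(\<lambda>p. c) \<in> smooth_functions M"
  by (simp add: smooth_functions_iff smooth_on_const)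

lemma smooth_functions_0 [intro, simp]: "0 \<in> smooth_functions M"
  by (simp add: func_zero)

lemma smooth_functions_add [intro, simp]:
  "f \<in> smooth_functions M \<Longrightarrow> g \<in> smooth_functions M \<Longrightarrow> f + g \<in> smooth_functions M"
  by (simp add: smooth_functions_iff smooth_on_add func_plus)

lemma smooth_functions_mult [intro, simp]:
  "f \<in> smooth_functions M \<Longrightarrow> g \<in> smooth_functions M \<Longrightarrow> f * g \<in> smooth_functions M"
  by (simp add: smooth_functions_iff smooth_on_mult func_times)

lemma smooth_functions_scaleR [intro, simp]:
  "f \<in> smooth_functions M \<Longrightarrow> c *\<^sub>R f \<in> smooth_functions M"
  by (simp add: smooth_functions_iff smooth_on_mult smooth_on_const scaleR_fun_def)

lemma smooth_functions_uminus [intro, simp]: "f \<in> smooth_functions M \<Longrightarrow> - f \<in> smooth_functions M"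
  using smooth_functions_scaleR[of f M "-1"] by simp

lemma smooth_functions_diff [intro, simp]:
  "f \<in> smooth_functions M \<Longrightarrow> g \<in> smooth_functions M \<Longrightarrow> f - g \<in> smooth_functions M"
  using smooth_functions_add[of f M "- g"] by simp

lemma smooth_functions_sum [intro, simp]:
  "(\<And>i. i \<in> I \<Longrightarrow> f i \<in> smooth_functions M) \<Longrightarrow> (sum f I) \<in> smooth_functions M"
  by (induction I rule: infinite_finite_induct) auto

section \<open>Bump functions and extension by zero\<close>

lemma open_contains_coordinate_box:
  fixes T :: "(nat \<Rightarrow> real) set"
  assumes "open T" "x \<in> T"
  obtains \<epsilon> where "\<epsilon> > 0" "\<And>y. (\<And>i. i < n \<Longrightarrow> \<bar>y i - x i\<bar> \<le> \<epsilon>) \<Longrightarrow> (\<And>i. i \<ge> n \<Longrightarrow> y i = x i) \<Longrightarrow> y \<in> T"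
proof -
  have "openin (product_topology (\<lambda>i. euclidean) UNIV) T"
    using assms(1) by (simp add: euclidean_product_topology)
  from product_topology_open_contains_basis[OF this assms(2)]
  obtain X where X: "x \<in> (\<Pi>\<^sub>E i\<in>UNIV. X i)" "\<And>i. open (X i)" "(\<Pi>\<^sub>E i\<in>UNIV. X i) \<subseteq> T"
    by auto
  have "\<exists>e>0. cball (x i) e \<subseteq> X i" for i
    using X(1,2) by (meson PiE_mem UNIV_I open_contains_cball)
  then obtain e where e: "\<And>i. e i > 0" "\<And>i. cball (x i) (e i) \<subseteq> X i"
    by metis
  \<comment> \<open>The coordinates from \<open>n\<close> on are held fixed, so finitely many radii
    count. Inserting 1 keeps the set nonempty for \<open>n = 0\<close>.\<close>
  define \<epsilon> where "\<epsilon> = Min (insert 1 (e ` {..<n}))"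
  have "\<epsilon> > 0" using e(1) by (auto simp: \<epsilon>_def)
  moreover have "y \<in> T"
    if y: "\<And>i. i < n \<Longrightarrow> \<bar>y i - x i\<bar> \<le> \<epsilon>" "\<And>i. i \<ge> n \<Longrightarrow> y i = x i" for y
  proof -
    have "y i \<in> X i" for i
    proof (cases "i < n")
      case True
      then have "\<epsilon> \<le> e i" unfolding \<epsilon>_def by (intro Min_le) auto
      then have "y i \<in> cball (x i) (e i)"
        using y(1)[OF True] by (auto simp: dist_real_def)
      then show ?thesis using e(2) by blast
    next
      case False
      then show ?thesis using X(1) y(2)[of i] by auto
    qed
    then show ?thesis using X(3) by auto
  qed
  ultimately show ?thesis using that by blast
qed

text \<open>In a chart, the product over the coordinates of \<open>flat 0\<close> applied to the
  squared radius minus the squared distance lives on a small cube. The cube is compact, hence its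
  preimage \<open>K\<close> is closed in the Hausdorff space, and extension by 0 is smooth on the
  two open sets \<open>U\<close> and \<open>- K\<close>, which cover the manifold.\<close>

lemma bump_function:
  fixes M :: "'m::{t2_space, second_countable_topology} manifold"
  assumes M: "smooth_manifold M" and W: "open W" "p \<in> W"
  obtains \<eta> K where "\<eta> \<in> smooth_functions M" "closed K" "K \<subseteq> W" "\<eta> p = 1" "\<And>q. q \<notin> K \<Longrightarrow> \<eta> q = 0"
proof -
  obtain U \<phi> where c: "(U, \<phi>) \<in> charts M" "p \<in> U"
    using M by (rule chart_at)
  note ch = chart_homeomorphism[OF M c(1)]
  let ?n = "mdim M"
  obtain T where T: "open T" "\<phi> ` (U \<inter> W) = T \<inter> {x. \<forall>i\<ge>?n. x i = 0}"
    using ch(6)[OF W(1)] unfolding openin_Euclidean_space_iff by blast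
  have zero: "\<phi> q i = 0" if "q \<in> U" "i \<ge> ?n" for q i
    using ch(3) that by auto
  have "\<phi> p \<in> T" using T(2) c(2) W(2) by blast
  then obtain \<epsilon> where \<epsilon>: "\<epsilon> > 0"
    "\<And>y. (\<And>i. i < ?n \<Longrightarrow> \<bar>y i - \<phi> p i\<bar> \<le> \<epsilon>) \<Longrightarrow> (\<And>i. i \<ge> ?n \<Longrightarrow> y i = \<phi> p i) \<Longrightarrow> y \<in> T"
    using open_contains_coordinate_box[OF T(1), of "\<phi> p" ?n] by metis
  \<comment> \<open>From index \<open>mdim M\<close> on the intervals have radius 0. This makes the
    cube a product of compact sets inside the coordinate subspace.\<close>
  define B where "B = (\<Pi>\<^sub>E i\<in>UNIV. cball (\<phi> p i) (if i < ?n then \<epsilon> else 0))"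
  have "compactin (product_topology (\<lambda>i. euclidean) UNIV) B"
    unfolding B_def compactin_PiE by auto
  then have "compact B" by (simp add: euclidean_product_topology)
  have B: "y \<in> B \<longleftrightarrow> (\<forall>i<?n. \<bar>y i - \<phi> p i\<bar> \<le> \<epsilon>) \<and> (\<forall>i\<ge>?n. y i = 0)" for y
  proof -
    have "y \<in> B \<longleftrightarrow> (\<forall>i. \<bar>y i - \<phi> p i\<bar> \<le> (if i < ?n then \<epsilon> else 0))"
      by (simp add: B_def PiE_iff dist_real_def abs_minus_commute)
    also have "\<dots> \<longleftrightarrow> (\<forall>i<?n. \<bar>y i - \<phi> p i\<bar> \<le> \<epsilon>) \<and> (\<forall>i\<ge>?n. y i = \<phi> p i)"
      by (smt (verit, best) leD leI)
    finally show ?thesis using zero[OF c(2)] by auto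
  qed
  have B_sub: "B \<subseteq> \<phi> ` (U \<inter> W)"
    unfolding T(2) using \<epsilon>(2) zero[OF c(2)] B by auto
  define K where "K = inv_into U \<phi> ` B"
  have "compact K"
    unfolding K_def
    by (rule compact_continuous_image[OF _ \<open>compact B\<close>])
      (use B_sub in \<open>auto intro!: continuous_on_subset[OF ch(5)]\<close>)
  then have "closed K" by (rule compact_imp_closed)
  have K: "q \<in> K \<longleftrightarrow> q \<in> U \<and> (\<forall>i<?n. \<bar>\<phi> q i - \<phi> p i\<bar> \<le> \<epsilon>)" for q
  proof
    assume "q \<in> K"
    then obtain y where y: "y \<in> B" "q = inv_into U \<phi> y" by (auto simp: K_def)
    then have "y \<in> \<phi> ` U" using B_sub by blast
    then show "q \<in> U \<and> (\<forall>i<?n. \<bar>\<phi> q i - \<phi> p i\<bar> \<le> \<epsilon>)"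
      using y B by (auto simp: f_inv_into_f inv_into_into)
  next
    assume q: "q \<in> U \<and> (\<forall>i<?n. \<bar>\<phi> q i - \<phi> p i\<bar> \<le> \<epsilon>)"
    then have "\<phi> q \<in> B" using B zero by auto
    then show "q \<in> K" unfolding K_def using q ch(2) by (metis image_eqI inv_into_f_f)
  qed
  have "K \<subseteq> W"
    using B_sub inv_into_chart_mem[OF M c(1)] unfolding K_def by blast
  define b where "b = (\<lambda>q. \<Prod>i<?n. flat 0 (\<epsilon> * \<epsilon> + (- 1) * ((\<phi> q i + - \<phi> p i) * (\<phi> q i + - \<phi> p i))))"
  have "b p > 0" unfolding b_def using \<epsilon>(1) by (intro prod_pos) (auto simp: flat_pos_iff)
  define \<eta> where "\<eta> = (\<lambda>q. if q \<in> U then inverse (b p) * b q else 0)"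
  have \<eta>0: "\<eta> q = 0" if "q \<notin> K" for q
  proof (cases "q \<in> U")
    case True
    then obtain i where i: "i < ?n" "\<bar>\<phi> q i - \<phi> p i\<bar> > \<epsilon>"
      using \<open>q \<notin> K\<close> K by force
    then have "(\<phi> q i + - \<phi> p i) * (\<phi> q i + - \<phi> p i) \<ge> \<epsilon> * \<epsilon>"
      using \<epsilon>(1) abs_le_square_iff[of \<epsilon> "\<phi> q i - \<phi> p i"] by (auto simp: power2_eq_square)
    then have "b q = 0" unfolding b_def using i(1)
      by (intro prod_zero) (auto simp: flat_eq_0_iff intro!: bexI[of _ i])
    then show ?thesis by (simp add: \<eta>_def)
  qed (simp add: \<eta>_def)
  have "smooth_on M U b"
    unfolding b_def
    by (intro smooth_on_prod smooth_on_flat smooth_on_add smooth_on_mult smooth_on_const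
        smooth_on_coordinate[OF M c(1)]) auto
  then have "smooth_on M U (\<lambda>q. inverse (b p) * b q)"
    by (intro smooth_on_mult smooth_on_const)
  then have "smooth_on M U \<eta>"
    by (rule smooth_on_cong[OF M ch(1), rotated]) (simp add: \<eta>_def)
  moreover have "smooth_on M (- K) \<eta>"
    by (rule smooth_on_cong[OF M _ _ smooth_on_const[of _ _ 0]]) (use \<open>closed K\<close> \<eta>0 in auto)
  ultimately have "smooth_on M UNIV \<eta>"
    using K \<open>closed K\<close> ch(1)
    by (intro smooth_on_local[OF M open_UNIV]) (metis ComplI open_Compl subset_UNIV)
  then show ?thesis
    using that[of \<eta> K] \<open>closed K\<close> \<open>K \<subseteq> W\<close> \<eta>0 \<open>b p > 0\<close> c(2) by (simp add: smooth_functions_iff \<eta>_def)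
qed

text \<open>Here \<open>f\<close> need only be smooth where \<open>W\<close> meets \<open>V\<close>;
  off the closed set \<open>K\<close> the product vanishes. Coefficients known on the domain of one
  frame thus become smooth on the domain of any other.\<close>

lemma smooth_on_mult_supported:
  assumes "smooth_manifold M" "\<eta> \<in> smooth_functions M" "closed K" "K \<subseteq> W" "open W" "open V"
    "\<And>q. q \<notin> K \<Longrightarrow> \<eta> q = 0" "smooth_on M (V \<inter> W) f"
  shows "smooth_on M V (\<lambda>p. \<eta> p * f p)"
proof (rule smooth_on_local[OF assms(1,6)])
  fix p assume "p \<in> V"
  have "smooth_on M (V \<inter> W) (\<lambda>p. \<eta> p * f p)"
    by (rule smooth_on_mult[OF smooth_functions_imp_smooth_on[OF assms(2)] assms(8)])
  moreover have "smooth_on M (V - K) (\<lambda>p. \<eta> p * f p)"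
    by (rule smooth_on_cong[OF assms(1) _ _ smooth_on_const[of _ _ 0]])
      (use assms in \<open>auto intro: open_Diff\<close>)
  ultimately show "\<exists>V'. p \<in> V' \<and> V' \<subseteq> V \<and> open V' \<and> smooth_on M V' (\<lambda>p. \<eta> p * f p)"
    using assms(3-6) \<open>p \<in> V\<close>
    by (cases "p \<in> K"; intro exI[of _ "if p \<in> K then V \<inter> W else V - K"])
      (auto intro: open_Diff)
qed

lemma smooth_functions_continuous:
  assumes "smooth_manifold M" "f \<in> smooth_functions M"
  shows "continuous_on UNIV f"
proof -
  have "isCont f p" for p
  proof -
    obtain U \<phi> where c: "(U, \<phi>) \<in> charts M" "p \<in> U"
      using assms(1) by (rule chart_at)
    note ch = chart_homeomorphism[OF assms(1) c(1)]
    have "C_k 0 (mdim M) (\<phi> ` (U \<inter> UNIV)) (\<lambda>x. f (inv_into U \<phi> x))"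
      by (rule smooth_onD[OF _ c(1)]) (use assms(2) in \<open>simp add: smooth_functions_iff\<close>)
    then have "continuous_on U (\<lambda>q. f (inv_into U \<phi> (\<phi> q)))"
      by (intro continuous_on_compose2[OF _ ch(4), of "\<phi> ` U"]) auto
    moreover have "continuous_on U f \<longleftrightarrow> continuous_on U (\<lambda>q. f (inv_into U \<phi> (\<phi> q)))"
      by (rule continuous_on_cong) (use ch(2) in auto)
    ultimately show ?thesis
      using ch(1) c(2) continuous_on_eq_continuous_at by blast
  qed
  then show ?thesis by (simp add: continuous_on_eq_continuous_at)
qed

section \<open>Sections of vector bundles\<close>

lemma smul_apply [simp]: "(f \<odot> s) p = f p *\<^sub>R s p"
  by (simp add: smul_def)

lemma app_apply: "app F s p = F p (s p)"
  by (simp add: app_def)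

lemma scaleR_fun_apply [simp]: "(c *\<^sub>R f) x = c *\<^sub>R f x"
  by (simp add: scaleR_fun_def)

lemma sum_fun_apply: "(\<Sum>i\<in>I. f i) x = (\<Sum>i\<in>I. f i x)"
  by (induction I rule: infinite_finite_induct) auto

lemma scaleR_eq_smul: "c *\<^sub>R s = (\<lambda>p. c) \<odot> s"
  by (simp add: fun_eq_iff)

lemma linear_between_sum:
  assumes "linear_between V W F" "subspace V" "\<And>i. i \<in> I \<Longrightarrow> v i \<in> V"
  shows "F (\<Sum>i\<in>I. c i *\<^sub>R v i) = (\<Sum>i\<in>I. c i *\<^sub>R F (v i))"
  using assms(3)
proof (induction I rule: infinite_finite_induct)
  case (insert i I)
  have "F (c i *\<^sub>R v i + (\<Sum>i\<in>I. c i *\<^sub>R v i)) = F (c i *\<^sub>R v i) + F (\<Sum>i\<in>I. c i *\<^sub>R v i)"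
    using assms(1,2) insert.prems
    by (simp add: linear_between_def subspace_scale subspace_sum)
  then show ?case
    using insert assms(1) by (simp add: linear_between_def)
qed (use assms(1) subspace_0[OF assms(2)] in \<open>force simp: linear_between_def\<close>)+

section \<open>Functionals on sections and the dual bundle\<close>

definition smooth_linear :: "'m manifold \<Rightarrow> ('m, 'v::real_vector) vbundle \<Rightarrow>
    (('m \<Rightarrow> 'v) \<Rightarrow> 'm \<Rightarrow> real) \<Rightarrow> bool" where
  "smooth_linear M E \<Phi> \<longleftrightarrow>
     (\<forall>s\<in>sections E. \<Phi> s \<in> smooth_functions M) \<and>
     (\<forall>s\<in>sections E. \<forall>t\<in>sections E. \<Phi> (s + t) = \<Phi> s + \<Phi> t) \<and>
     (\<forall>f\<in>smooth_functions M. \<forall>s\<in>sections E. \<Phi> (f \<odot> s) = f * \<Phi> s)"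

lemma smooth_linearD:
  assumes "smooth_linear M E \<Phi>"
  shows "s \<in> sections E \<Longrightarrow> \<Phi> s \<in> smooth_functions M"
    and "s \<in> sections E \<Longrightarrow> t \<in> sections E \<Longrightarrow> \<Phi> (s + t) = \<Phi> s + \<Phi> t"
    and "f \<in> smooth_functions M \<Longrightarrow> s \<in> sections E \<Longrightarrow> \<Phi> (f \<odot> s) = f * \<Phi> s"
  using assms by (auto simp: smooth_linear_def)

lemma dual_fibre_iff:
  "\<mu> \<in> fibre (dual_bundle M E) p \<longleftrightarrow>
     linear_between (fibre E p) UNIV \<mu> \<and> (\<forall>v. v \<notin> fibre E p \<longrightarrow> \<mu> v = 0)"
  by (simp add: dual_bundle_def Let_def)

lemma dual_sections_iff:
  "\<mu> \<in> sections (dual_bundle M E) \<longleftrightarrow>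
     (\<forall>p. \<mu> p \<in> fibre (dual_bundle M E) p) \<and> (\<forall>s\<in>sections E. app \<mu> s \<in> smooth_functions M)"
  by (simp add: dual_bundle_def Let_def)

lemma dual_fibre_subspace: "subspace (fibre (dual_bundle M E) p)"
  by (auto simp: subspace_def dual_fibre_iff linear_between_def algebra_simps)

lemma dual_sections_add:
  assumes "\<mu> \<in> sections (dual_bundle M E)" "\<nu> \<in> sections (dual_bundle M E)"
  shows "\<mu> + \<nu> \<in> sections (dual_bundle M E)"
proof -
  have "app (\<mu> + \<nu>) s = app \<mu> s + app \<nu> s" for s
    by (simp add: fun_eq_iff app_apply)
  then show ?thesis
    using assms by (auto simp: dual_sections_iff intro: subspace_add[OF dual_fibre_subspace])
qed

lemma dual_sections_smul:
  assumes "f \<in> smooth_functions M" "\<mu> \<in> sections (dual_bundle M E)"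
  shows "f \<odot> \<mu> \<in> sections (dual_bundle M E)"
proof -
  have "app (f \<odot> \<mu>) s = f * app \<mu> s" for s
    by (simp add: fun_eq_iff app_apply)
  then show ?thesis
    using assms by (auto simp: dual_sections_iff intro: subspace_scale[OF dual_fibre_subspace])
qed

lemma pairing_add:
  assumes "\<mu> \<in> sections (dual_bundle M E)" "\<And>p. s p \<in> fibre E p" "\<And>p. t p \<in> fibre E p"
  shows "app \<mu> (s + t) = app \<mu> s + app \<mu> t"
  using assms by (simp add: fun_eq_iff app_apply dual_sections_iff dual_fibre_iff linear_between_def)

lemma pairing_smul:
  assumes "\<mu> \<in> sections (dual_bundle M E)" "\<And>p. s p \<in> fibre E p"
  shows "app \<mu> (f \<odot> s) = f * app \<mu> s"
  using assms by (simp add: fun_eq_iff app_apply dual_sections_iff dual_fibre_iff linear_between_def)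

text \<open>The coordinate functionals are those of \<open>representation\<close> with respect to
  the basis of the fibre. Injectivity of the frame allows sums over basis vectors to be rewritten as
  sums over indices.\<close>

lemma local_frame_coordinates:
  assumes "local_frame k E U e"
  obtains \<epsilon> where "\<And>q i. q \<in> U \<Longrightarrow> i < k \<Longrightarrow> linear_between (fibre E q) UNIV (\<epsilon> i q)"
    "\<And>q v. q \<in> U \<Longrightarrow> v \<in> fibre E q \<Longrightarrow> v = (\<Sum>i<k. \<epsilon> i q v *\<^sub>R e i q)"
    "\<And>q c i. q \<in> U \<Longrightarrow> i < k \<Longrightarrow> \<epsilon> i q (\<Sum>j<k. c j *\<^sub>R e j q) = (c i :: real)"
proof -
  define B where "B q = (\<lambda>i. e i q) ` {..<k}" for q
  define \<epsilon> where "\<epsilon> i q v = representation (B q) v (e i q)" for i q v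
  have f: "inj_on (\<lambda>i. e i q) {..<k}" "independent (B q)" "span (B q) = fibre E q" if "q \<in> U" for q
    using assms that by (auto simp: local_frame_def B_def)
  have lin: "linear_between (fibre E q) UNIV (\<epsilon> i q)" if "q \<in> U" "i < k" for q i
    using f[OF that(1)] by (auto simp: linear_between_def \<epsilon>_def representation_add representation_scale)
  moreover have "v = (\<Sum>i<k. \<epsilon> i q v *\<^sub>R e i q)" if "q \<in> U" "v \<in> fibre E q" for q v
  proof -
    have "(\<Sum>b\<in>B q. representation (B q) v b *\<^sub>R b) = v"
      by (rule sum_representation_eq) (use f[OF that(1)] that(2) in \<open>auto simp: B_def\<close>)
    then show ?thesis
      unfolding B_def \<epsilon>_def by (subst (asm) sum.reindex) (use f[OF that(1)] in auto)
  qed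
  moreover have "\<epsilon> i q (\<Sum>j<k. c j *\<^sub>R e j q) = c i" if q: "q \<in> U" "i < k" for q c i
  proof -
    have "\<epsilon> i q (e j q) = (if j = i then 1 else 0)" if "j < k" for j
    proof -
      have "e j q \<in> B q" using that by (simp add: B_def)
      then show ?thesis
        using representation_basis[OF f(2)[OF q(1)]] inj_on_eq_iff[OF f(1)[OF q(1)], of j i] q that
        by (auto simp: \<epsilon>_def)
    qed
    then have "(\<Sum>j<k. c j *\<^sub>R \<epsilon> i q (e j q)) = (\<Sum>j<k. if j = i then c j else 0)"
      by (intro sum.cong) auto
    moreover have "\<epsilon> i q (\<Sum>j<k. c j *\<^sub>R e j q) = (\<Sum>j<k. c j *\<^sub>R \<epsilon> i q (e j q))"
    proof (rule linear_between_sum[OF lin[OF q]])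
      show "subspace (fibre E q)" using f(3)[OF q(1)] subspace_span by metis
      show "e j q \<in> fibre E q" if "j \<in> {..<k}" for j
        using f(3)[OF q(1)] that span_base[of "e j q" "B q"] by (simp add: B_def)
    qed
    ultimately show ?thesis using q(2) by simp
  qed
  ultimately show ?thesis using that by blast
qed

section \<open>Global sections from local frames\<close>

locale smooth_bundle =
  fixes M :: "'m::{t2_space, second_countable_topology} manifold"
    and E :: "('m, 'v::real_vector) vbundle"
  assumes manifold: "smooth_manifold M" and vbundle: "vector_bundle M E"
begin

text \<open>The body of \<open>vector_bundle\<close> with its two existential witnesses turned into
  parameters, so that a proof can fix one atlas.\<close>

definition frame_atlas :: "nat \<Rightarrow> ('m set \<times> (nat \<Rightarrow> 'm \<Rightarrow> 'v)) set \<Rightarrow> bool" where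
  "frame_atlas k F \<longleftrightarrow>
     (\<Union>(U, e)\<in>F. U) = UNIV \<and>
     (\<forall>(U, e)\<in>F. local_frame k E U e) \<and>
     (\<forall>(U, e)\<in>F. \<forall>(V, e')\<in>F. \<exists>g. \<forall>j<k.
        (\<forall>i<k. smooth_on M (U \<inter> V) (g i j)) \<and>
        (\<forall>p\<in>U \<inter> V. e' j p = (\<Sum>i<k. g i j p *\<^sub>R e i p))) \<and>
     sections E = {s. (\<forall>p. s p \<in> fibre E p) \<and>
        (\<forall>(U, e)\<in>F. \<exists>c. (\<forall>i<k. smooth_on M U (c i)) \<and>
           (\<forall>p\<in>U. s p = (\<Sum>i<k. c i p *\<^sub>R e i p)))}"

lemma frame_atlas_exists: obtains k F where "frame_atlas k F"
proof -
  have "\<exists>k F. frame_atlas k F"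
    using vbundle unfolding vector_bundle_def frame_atlas_def .
  then show ?thesis using that by blast
qed

lemma frame_atlasD:
  assumes "frame_atlas k F"
  shows "\<exists>U e. (U, e) \<in> F \<and> p \<in> U"
    and "(U, e) \<in> F \<Longrightarrow> local_frame k E U e"
    and "(U, e) \<in> F \<Longrightarrow> (V, e') \<in> F \<Longrightarrow> j < k \<Longrightarrow> \<exists>g. \<forall>i<k. smooth_on M (U \<inter> V) (g i) \<and>
        (\<forall>p\<in>U \<inter> V. e' j p = (\<Sum>i<k. g i p *\<^sub>R e i p))"
    and "s \<in> sections E \<longleftrightarrow> (\<forall>p. s p \<in> fibre E p) \<and>
        (\<forall>U e. (U, e) \<in> F \<longrightarrow> (\<exists>c. (\<forall>i<k. smooth_on M U (c i)) \<and>
           (\<forall>p\<in>U. s p = (\<Sum>i<k. c i p *\<^sub>R e i p))))"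
proof -
  note * = assms[unfolded frame_atlas_def]
  show "\<exists>U e. (U, e) \<in> F \<and> p \<in> U"
  proof -
    have "p \<in> (\<Union>(U, e)\<in>F. U)" using conjunct1[OF *] by simp
    then show ?thesis by auto
  qed
  show "local_frame k E U e" if "(U, e) \<in> F"
    using bspec[OF conjunct1[OF conjunct2[OF *]] that] by simp
  show "\<exists>g. \<forall>i<k. smooth_on M (U \<inter> V) (g i) \<and> (\<forall>p\<in>U \<inter> V. e' j p = (\<Sum>i<k. g i p *\<^sub>R e i p))"
    if F: "(U, e) \<in> F" "(V, e') \<in> F" and "j < k"
  proof -
    from bspec[OF conjunct1[OF conjunct2[OF conjunct2[OF *]]] F(1)] have "\<forall>(V, e')\<in>F. \<exists>g. \<forall>j<k. (\<forall>i<k. smooth_on M (U \<inter> V) (g i j)) \<and>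
        (\<forall>p\<in>U \<inter> V. e' j p = (\<Sum>i<k. g i j p *\<^sub>R e i p))"
      by simp
    from bspec[OF this F(2)] obtain g where "\<forall>j<k. (\<forall>i<k. smooth_on M (U \<inter> V) (g i j)) \<and>
        (\<forall>p\<in>U \<inter> V. e' j p = (\<Sum>i<k. g i j p *\<^sub>R e i p))"
      by auto
    then show ?thesis using \<open>j < k\<close> by (intro exI[of _ "\<lambda>i. g i j"]) auto
  qed
  have "s \<in> sections E \<longleftrightarrow> (\<forall>p. s p \<in> fibre E p) \<and>
        (\<forall>(U, e)\<in>F. \<exists>c. (\<forall>i<k. smooth_on M U (c i)) \<and>
           (\<forall>p\<in>U. s p = (\<Sum>i<k. c i p *\<^sub>R e i p)))"
    by (subst conjunct2[OF conjunct2[OF conjunct2[OF *]]], subst mem_Collect_eq) (rule refl)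
  moreover have "(\<forall>(U, e)\<in>F. P U e) \<longleftrightarrow> (\<forall>U e. (U, e) \<in> F \<longrightarrow> P U e)" for P
    by auto
  ultimately show "s \<in> sections E \<longleftrightarrow> (\<forall>p. s p \<in> fibre E p) \<and>
        (\<forall>U e. (U, e) \<in> F \<longrightarrow> (\<exists>c. (\<forall>i<k. smooth_on M U (c i)) \<and>
           (\<forall>p\<in>U. s p = (\<Sum>i<k. c i p *\<^sub>R e i p))))"
    by presburger
qed

lemma fibre_subspace: "subspace (fibre E p)"
proof -
  obtain k F where "frame_atlas k F"
    by (rule frame_atlas_exists)
  note F = frame_atlasD[OF this]
  obtain U e where "(U, e) \<in> F" "p \<in> U" using F(1) by blast
  then have "fibre E p = span ((\<lambda>i. e i p) ` {..<k})"
    using F(2) by (simp add: local_frame_def)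
  then show ?thesis by simp
qed

lemma sections_in_fibre:
  assumes "s \<in> sections E"
  shows "s p \<in> fibre E p"
proof -
  obtain k F where "frame_atlas k F"
    by (rule frame_atlas_exists)
  from frame_atlasD(4)[OF this] assms show ?thesis by blast
qed

lemma sections_add:
  assumes "s \<in> sections E" "t \<in> sections E"
  shows "s + t \<in> sections E"
proof -
  obtain k F where "frame_atlas k F"
    by (rule frame_atlas_exists)
  note F = frame_atlasD[OF this]
  show ?thesis
    unfolding F(4)
  proof (intro conjI allI impI)
    show "(s + t) p \<in> fibre E p" for p
      using assms sections_in_fibre subspace_add[OF fibre_subspace] by simp
    fix U e assume U: "(U, e) \<in> F"
    obtain c where c: "\<forall>i<k. smooth_on M U (c i)" "\<forall>p\<in>U. s p = (\<Sum>i<k. c i p *\<^sub>R e i p)"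
      using assms(1) U unfolding F(4) by blast
    obtain d where d: "\<forall>i<k. smooth_on M U (d i)" "\<forall>p\<in>U. t p = (\<Sum>i<k. d i p *\<^sub>R e i p)"
      using assms(2) U unfolding F(4) by blast
    show "\<exists>c. (\<forall>i<k. smooth_on M U (c i)) \<and> (\<forall>p\<in>U. (s + t) p = (\<Sum>i<k. c i p *\<^sub>R e i p))"
      using c d by (intro exI[of _ "\<lambda>i p. c i p + d i p"])
        (auto simp: scaleR_add_left sum.distrib intro: smooth_on_add)
  qed
qed

lemma sections_smul:
  assumes "f \<in> smooth_functions M" "s \<in> sections E"
  shows "f \<odot> s \<in> sections E"
proof -
  obtain k F where "frame_atlas k F"
    by (rule frame_atlas_exists)
  note F = frame_atlasD[OF this]
  show ?thesis
    unfolding F(4)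
  proof (intro conjI allI impI)
    show "(f \<odot> s) p \<in> fibre E p" for p
      using assms sections_in_fibre subspace_scale[OF fibre_subspace] by simp
    fix U e assume U: "(U, e) \<in> F"
    obtain c where c: "\<forall>i<k. smooth_on M U (c i)" "\<forall>p\<in>U. s p = (\<Sum>i<k. c i p *\<^sub>R e i p)"
      using assms(2) U unfolding F(4) by blast
    show "\<exists>c. (\<forall>i<k. smooth_on M U (c i)) \<and> (\<forall>p\<in>U. (f \<odot> s) p = (\<Sum>i<k. c i p *\<^sub>R e i p))"
      using c smooth_functions_imp_smooth_on[OF assms(1)] by (intro exI[of _ "\<lambda>i p. f p * c i p"])
        (auto simp: scaleR_sum_right intro: smooth_on_mult)
  qed
qed

lemma sections_scaleR: "s \<in> sections E \<Longrightarrow> c *\<^sub>R s \<in> sections E"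
  unfolding scaleR_eq_smul by (rule sections_smul) auto

text \<open>A partition-of-unity substitute: frame and coframe near \<open>p\<close> are cut off by a bump function,
  so that they become global sections.\<close>

definition cutoff_frame :: "'m \<Rightarrow> nat \<Rightarrow> (nat \<Rightarrow> 'm \<Rightarrow> 'v) \<Rightarrow> (nat \<Rightarrow> 'm \<Rightarrow> 'v \<Rightarrow> real) \<Rightarrow>
    ('m \<Rightarrow> real) \<Rightarrow> bool" where
  "cutoff_frame p n e \<epsilon> \<eta> \<longleftrightarrow> \<eta> \<in> smooth_functions M \<and> \<eta> p = 1 \<and>
    (\<forall>i<n. e i \<in> sections E) \<and> (\<forall>i<n. \<epsilon> i \<in> sections (dual_bundle M E)) \<and>
    (\<forall>q. \<forall>v\<in>fibre E q. \<eta> q *\<^sub>R v = (\<Sum>i<n. \<epsilon> i q v *\<^sub>R e i q))"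

lemma cutoff_frameD:
  assumes "cutoff_frame p n e \<epsilon> \<eta>"
  shows "\<eta> \<in> smooth_functions M" "\<eta> p = 1"
    and "i < n \<Longrightarrow> e i \<in> sections E" and "i < n \<Longrightarrow> \<epsilon> i \<in> sections (dual_bundle M E)"
    and "v \<in> fibre E q \<Longrightarrow> \<eta> q *\<^sub>R v = (\<Sum>i<n. \<epsilon> i q v *\<^sub>R e i q)"
  using assms unfolding cutoff_frame_def by simp_all

text \<open>A frame and its coordinate functionals near \<open>p\<close> are each multiplied by a
  bump function \<open>b\<close> and extended by 0. Their expansion of a vector therefore carries
  the factor \<open>b * b\<close>, and it holds at every point because both sides vanish outside
  \<open>U\<close>.\<close>

lemma cutoff_frame_exists:
  obtains n e \<epsilon> \<eta> where "cutoff_frame p n e \<epsilon> \<eta>"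
proof -
  obtain k F where "frame_atlas k F"
    by (rule frame_atlas_exists)
  note F = frame_atlasD[OF this]
  obtain U e where U: "(U, e) \<in> F" "p \<in> U" using F(1) by blast
  have open_F: "open V" if "(V, e') \<in> F" for V e'
    using F(2)[OF that] by (simp add: local_frame_def)
  obtain \<epsilon> where \<epsilon>: "\<And>q i. q \<in> U \<Longrightarrow> i < k \<Longrightarrow> linear_between (fibre E q) UNIV (\<epsilon> i q)"
    "\<And>q v. q \<in> U \<Longrightarrow> v \<in> fibre E q \<Longrightarrow> v = (\<Sum>i<k. \<epsilon> i q v *\<^sub>R e i q)"
    "\<And>q c i. q \<in> U \<Longrightarrow> i < k \<Longrightarrow> \<epsilon> i q (\<Sum>j<k. c j *\<^sub>R e j q) = (c i :: real)"
    by (rule local_frame_coordinates[OF F(2)[OF U(1)]]) (rule that)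
  obtain b K where b: "b \<in> smooth_functions M" "closed K" "K \<subseteq> U" "b p = 1" "\<And>q. q \<notin> K \<Longrightarrow> b q = 0"
    using bump_function[OF manifold open_F[OF U(1)] U(2)] by blast
  have b0: "b q = 0" if "q \<notin> U" for q using b(3,5) that by blast
  define e' where "e' i = b \<odot> e i" for i
  define \<epsilon>' where "\<epsilon>' i q v = (if v \<in> fibre E q then b q * \<epsilon> i q v else 0)" for i q v
  have "e' j \<in> sections E" if j: "j < k" for j
    unfolding F(4)
  proof (intro conjI allI impI)
    show "e' j q \<in> fibre E q" for q
    proof (cases "q \<in> U")
      case True
      then have "e j q \<in> fibre E q"
        using F(2)[OF U(1)] j by (auto simp: local_frame_def intro: span_base)
      then show ?thesis by (simp add: e'_def subspace_scale[OF fibre_subspace])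
    next
      case False
      then show ?thesis using b0 subspace_0[OF fibre_subspace] by (simp add: e'_def)
    qed
    fix V f assume V: "(V, f) \<in> F"
    obtain g where g: "\<forall>i<k. smooth_on M (V \<inter> U) (g i) \<and>
        (\<forall>p\<in>V \<inter> U. e j p = (\<Sum>i<k. g i p *\<^sub>R f i p))"
      using F(3)[OF V U(1) j] by blast
    have "smooth_on M V (\<lambda>q. b q * g i q)" if "i < k" for i
      by (rule smooth_on_mult_supported[OF manifold b(1-3) open_F[OF U(1)] open_F[OF V] b(5)])
        (use g that in auto)
    moreover have "e' j q = (\<Sum>i<k. (b q * g i q) *\<^sub>R f i q)" if "q \<in> V" for q
    proof (cases "q \<in> U")
      case True
      then have "e j q = (\<Sum>i<k. g i q *\<^sub>R f i q)" using g j that by auto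
      then show ?thesis by (simp add: e'_def scaleR_sum_right)
    next
      case False
      then show ?thesis using b0 by (simp add: e'_def)
    qed
    ultimately show "\<exists>c. (\<forall>i<k. smooth_on M V (c i)) \<and> (\<forall>p\<in>V. e' j p = (\<Sum>i<k. c i p *\<^sub>R f i p))"
      by (intro exI[of _ "\<lambda>i q. b q * g i q"]) auto
  qed
  moreover have "\<epsilon>' i \<in> sections (dual_bundle M E)" if i: "i < k" for i
    unfolding dual_sections_iff
  proof (intro conjI allI ballI)
    show "\<epsilon>' i q \<in> fibre (dual_bundle M E) q" for q
    proof (cases "q \<in> U")
      case True
      then show ?thesis
        using \<epsilon>(1)[OF True i] fibre_subspace[of q]
        by (simp add: dual_fibre_iff linear_between_def \<epsilon>'_def algebra_simps subspace_add subspace_scale)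
    next
      case False
      then show ?thesis using b0
        by (auto simp: dual_fibre_iff linear_between_def \<epsilon>'_def)
    qed
    fix s assume s: "s \<in> sections E"
    then obtain c where c: "\<forall>i<k. smooth_on M U (c i)" "\<forall>p\<in>U. s p = (\<Sum>i<k. c i p *\<^sub>R e i p)"
      using U(1) unfolding F(4) by blast
    have "app (\<epsilon>' i) s q = b q * c i q" for q
    proof (cases "q \<in> U")
      case True
      then have "\<epsilon> i q (s q) = c i q" using c(2) \<epsilon>(3)[OF True i, of "\<lambda>i. c i q"] by simp
      then show ?thesis by (simp add: app_apply \<epsilon>'_def sections_in_fibre[OF s])
    next
      case False
      then show ?thesis using b0 by (simp add: app_apply \<epsilon>'_def)
    qed
    then have "app (\<epsilon>' i) s = (\<lambda>q. b q * c i q)" by blast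
    also have "\<dots> \<in> smooth_functions M"
      unfolding smooth_functions_iff
      by (rule smooth_on_mult_supported[OF manifold b(1-3) open_F[OF U(1)] open_UNIV b(5)])
        (use c(1) i in auto)
    finally show "app (\<epsilon>' i) s \<in> smooth_functions M" .
  qed
  moreover have "(b * b) q *\<^sub>R v = (\<Sum>i<k. \<epsilon>' i q v *\<^sub>R e' i q)" if v: "v \<in> fibre E q" for q v
  proof (cases "q \<in> U")
    case True
    have "(b * b) q *\<^sub>R v = (b q * b q) *\<^sub>R (\<Sum>i<k. \<epsilon> i q v *\<^sub>R e i q)"
      using \<epsilon>(2)[OF True v] by simp
    also have "\<dots> = (\<Sum>i<k. \<epsilon>' i q v *\<^sub>R e' i q)"
      using v by (simp add: \<epsilon>'_def e'_def scaleR_sum_right mult_ac)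
    finally show ?thesis .
  next
    case False
    then show ?thesis using b0 by (simp add: \<epsilon>'_def e'_def)
  qed
  ultimately show ?thesis
    using that[of k e' "\<epsilon>'" "b * b"] b(1,4) unfolding cutoff_frame_def by auto
qed

text \<open>Wherever \<open>\<eta>\<close> does not vanish, the coefficients of \<open>s\<close> in
  a frame are those of \<open>\<eta> \<odot> s\<close> divided by \<open>\<eta>\<close>. This shows
  smoothness of sections that are assembled point by point.\<close>

lemma sections_local:
  assumes "\<And>p. \<exists>\<eta>\<in>smooth_functions M. \<eta> p \<noteq> 0 \<and> \<eta> \<odot> s \<in> sections E"
  shows "s \<in> sections E"
proof -
  obtain k F where "frame_atlas k F"
    by (rule frame_atlas_exists)
  note F = frame_atlasD[OF this]
  have fib: "s p \<in> fibre E p" for p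
  proof -
    obtain \<eta> where "\<eta> p \<noteq> 0" "\<eta> \<odot> s \<in> sections E" using assms by blast
    then have "inverse (\<eta> p) *\<^sub>R (\<eta> \<odot> s) p \<in> fibre E p"
      using sections_in_fibre subspace_scale[OF fibre_subspace] by blast
    then show ?thesis using \<open>\<eta> p \<noteq> 0\<close> by simp
  qed
  show ?thesis
    unfolding F(4)
  proof (intro conjI allI impI fib)
    fix U e assume U: "(U, e) \<in> F"
    then have "open U" using F(2) by (simp add: local_frame_def)
    obtain \<epsilon> where \<epsilon>0: "\<And>q i. q \<in> U \<Longrightarrow> i < k \<Longrightarrow> linear_between (fibre E q) UNIV (\<epsilon> i q)"
      and \<epsilon>: "\<And>q v. q \<in> U \<Longrightarrow> v \<in> fibre E q \<Longrightarrow> v = (\<Sum>i<k. \<epsilon> i q v *\<^sub>R e i q)"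
      "\<And>q c i. q \<in> U \<Longrightarrow> i < k \<Longrightarrow> \<epsilon> i q (\<Sum>j<k. c j *\<^sub>R e j q) = (c i :: real)"
      by (rule local_frame_coordinates[OF F(2)[OF U]]) (rule that)
    have "smooth_on M U (\<lambda>q. \<epsilon> i q (s q))" if i: "i < k" for i
    proof (rule smooth_on_local[OF manifold \<open>open U\<close>])
      fix p assume "p \<in> U"
      obtain \<eta> where \<eta>: "\<eta> \<in> smooth_functions M" "\<eta> p \<noteq> 0" "\<eta> \<odot> s \<in> sections E"
        using assms by blast
      then obtain c where c: "\<forall>i<k. smooth_on M U (c i)" "\<forall>p\<in>U. (\<eta> \<odot> s) p = (\<Sum>i<k. c i p *\<^sub>R e i p)"
        using U unfolding F(4) by blast
      define V where "V = U \<inter> {q. \<eta> q \<noteq> 0}"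
      have "open {q. \<eta> q \<noteq> 0}"
        by (intro open_Collect_neq smooth_functions_continuous[OF manifold \<eta>(1)] continuous_on_const)
      then have "open V" using \<open>open U\<close> by (simp add: V_def open_Int)
      have "smooth_on M V (\<lambda>q. inverse (\<eta> q) * c i q)"
        using c(1) i \<eta>(1) by (intro smooth_on_mult smooth_on_inverse[OF manifold])
          (auto simp: V_def intro: smooth_on_subset smooth_functions_imp_smooth_on)
      moreover have "inverse (\<eta> q) * c i q = \<epsilon> i q (s q)" if "q \<in> V" for q
      proof -
        have q: "q \<in> U" "\<eta> q \<noteq> 0" using that by (auto simp: V_def)
        have "s q = inverse (\<eta> q) *\<^sub>R (\<eta> \<odot> s) q" using q by simp
        also have "\<dots> = (\<Sum>j<k. (inverse (\<eta> q) * c j q) *\<^sub>R e j q)"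
          using c(2) q(1) by (simp only: scaleR_sum_right scaleR_scaleR)
        finally show ?thesis using \<epsilon>(2)[OF q(1) i, of "\<lambda>j. inverse (\<eta> q) * c j q"] by simp
      qed
      ultimately have "smooth_on M V (\<lambda>q. \<epsilon> i q (s q))"
        using smooth_on_cong[OF manifold \<open>open V\<close>, of "\<lambda>q. inverse (\<eta> q) * c i q" "\<lambda>q. \<epsilon> i q (s q)"]
        by simp
      then show "\<exists>V. p \<in> V \<and> V \<subseteq> U \<and> open V \<and> smooth_on M V (\<lambda>q. \<epsilon> i q (s q))"
        using \<open>open V\<close> \<open>p \<in> U\<close> \<eta>(2) by (intro exI[of _ V]) (auto simp: V_def)
    qed
    then show "\<exists>c. (\<forall>i<k. smooth_on M U (c i)) \<and> (\<forall>p\<in>U. s p = (\<Sum>i<k. c i p *\<^sub>R e i p))"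
      using \<epsilon>(1)[OF _ fib] by (intro exI[of _ "\<lambda>i q. \<epsilon> i q (s q)"]) blast
  qed
qed

lemma sections_0: "0 \<in> sections E"
proof -
  obtain k F where "frame_atlas k F"
    by (rule frame_atlas_exists)
  note F = frame_atlasD[OF this]
  show ?thesis
    unfolding F(4)
    by (intro conjI allI impI exI[of _ "\<lambda>i p. 0"])
      (auto simp: subspace_0[OF fibre_subspace] smooth_on_const)
qed

lemma sections_sum: "(\<And>i. i \<in> I \<Longrightarrow> s i \<in> sections E) \<Longrightarrow> sum s I \<in> sections E"
  by (induction I rule: infinite_finite_induct) (auto intro: sections_0 sections_add)

lemma sections_uminus: "s \<in> sections E \<Longrightarrow> - s \<in> sections E"
  using sections_scaleR[of s "-1"] by simp

lemma sections_diff: "s \<in> sections E \<Longrightarrow> t \<in> sections E \<Longrightarrow> s - t \<in> sections E"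
  using sections_add[of s "- t"] sections_uminus by simp

text \<open>The cut-off frame is combined with constant coefficients, namely the coordinates of
  \<open>v\<close> at \<open>p\<close>.\<close>

lemma section_through:
  assumes "v \<in> fibre E p"
  obtains s where "s \<in> sections E" "s p = v"
proof -
  obtain n e \<epsilon> \<eta> where "cutoff_frame p n e \<epsilon> \<eta>"
    by (rule cutoff_frame_exists)
  note * = cutoff_frameD[OF this]
  let ?s = "\<Sum>i<n. \<epsilon> i p v *\<^sub>R e i"
  have "?s \<in> sections E"
    by (intro sections_sum sections_scaleR) (use * in auto)
  moreover have "?s p = v"
    using *(5)[OF assms] *(2) by (simp add: sum_fun_apply)
  ultimately show ?thesis by (rule that)
qed

section \<open>Representation of functionals by sections\<close>

lemma smooth_linear_0: "smooth_linear M E \<Phi> \<Longrightarrow> \<Phi> 0 = 0"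
  using sections_0 unfolding smooth_linear_def by (metis add_0 add_cancel_right_left)

lemma smooth_linear_combination:
  assumes "smooth_linear M E \<Phi>" "\<And>i. i \<in> I \<Longrightarrow> f i \<in> smooth_functions M" "\<And>i. i \<in> I \<Longrightarrow> s i \<in> sections E"
  shows "\<Phi> (\<Sum>i\<in>I. f i \<odot> s i) = (\<Sum>i\<in>I. f i * \<Phi> (s i))"
  using assms(2,3)
proof (induction I rule: infinite_finite_induct)
  case (insert i I)
  have "\<Phi> (\<Sum>i\<in>insert i I. f i \<odot> s i) = \<Phi> (f i \<odot> s i + (\<Sum>i\<in>I. f i \<odot> s i))"
    by (simp only: sum.insert[OF insert.hyps])
  also have "\<dots> = \<Phi> (f i \<odot> s i) + \<Phi> (\<Sum>i\<in>I. f i \<odot> s i)"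
    using insert.prems by (intro smooth_linearD(2)[OF assms(1)] sections_smul sections_sum) auto
  also have "\<Phi> (f i \<odot> s i) = f i * \<Phi> (s i)"
    using insert.prems by (intro smooth_linearD(3)[OF assms(1)]) auto
  also have "\<Phi> (\<Sum>i\<in>I. f i \<odot> s i) = (\<Sum>i\<in>I. f i * \<Phi> (s i))"
    by (intro insert.IH; rule insert.prems; rule insertI2)
  finally show ?case by (simp only: sum.insert[OF insert.hyps])
qed (use smooth_linear_0[OF assms(1)] in simp_all)

lemma smooth_linear_expansion:
  assumes "smooth_linear M E \<Phi>" "s \<in> sections E" "cutoff_frame p n e \<epsilon> \<eta>"
  shows "\<eta> * \<Phi> s = (\<Sum>i<n. app (\<epsilon> i) s * \<Phi> (e i))"
proof -
  have "\<eta> \<odot> s = (\<Sum>i<n. app (\<epsilon> i) s \<odot> e i)"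
    using cutoff_frameD(5)[OF assms(3) sections_in_fibre[OF assms(2)]]
    by (simp add: fun_eq_iff sum_fun_apply app_apply)
  then have "\<eta> * \<Phi> s = \<Phi> (\<Sum>i<n. app (\<epsilon> i) s \<odot> e i)"
    using smooth_linearD(3)[OF assms(1) cutoff_frameD(1)[OF assms(3)] assms(2)] by simp
  also have "\<dots> = (\<Sum>i<n. app (\<epsilon> i) s * \<Phi> (e i))"
    using assms(2) cutoff_frameD(3,4)[OF assms(3)]
    by (intro smooth_linear_combination[OF assms(1)]) (auto simp: dual_sections_iff)
  finally show ?thesis .
qed

text \<open>In the expansion along a cut-off frame the section enters only through the values of the
  coframe on it, and the cut-off equals 1 at \<open>p\<close>.\<close>

lemma smooth_linear_tensorial:
  assumes "smooth_linear M E \<Phi>" "s \<in> sections E" "t \<in> sections E" "s p = t p"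
  shows "\<Phi> s p = \<Phi> t p"
proof -
  obtain n e \<epsilon> \<eta> where cf: "cutoff_frame p n e \<epsilon> \<eta>"
    by (rule cutoff_frame_exists)
  note * = cutoff_frameD[OF cf]
  have "(\<eta> * \<Phi> s) p = (\<eta> * \<Phi> t) p"
    using smooth_linear_expansion[OF assms(1,2) cf] smooth_linear_expansion[OF assms(1,3) cf]
    by (simp add: sum_fun_apply app_apply assms(4))
  then show ?thesis using *(2) by simp
qed

lemma dual_sections_eqI:
  assumes "\<mu> \<in> sections (dual_bundle M E)" "\<nu> \<in> sections (dual_bundle M E)"
    "\<And>s. s \<in> sections E \<Longrightarrow> app \<mu> s = app \<nu> s"
  shows "\<mu> = \<nu>"
proof (intro ext)
  fix p v
  show "\<mu> p v = \<nu> p v"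
  proof (cases "v \<in> fibre E p")
    case True
    then obtain s where "s \<in> sections E" "s p = v" by (rule section_through)
    then show ?thesis using assms(3)[of s] by (metis app_apply)
  next
    case False
    then show ?thesis using assms(1,2) by (simp add: dual_sections_iff dual_fibre_iff)
  qed
qed

text \<open>By tensoriality, evaluating \<open>\<Phi>\<close> on any section through
  \<open>v\<close> gives a well-defined covector at each point. This justifies the
  \<open>THE\<close> in \<open>dual_section\<close>, hence the existence of the Lie derivative on
  the dual, of the dual derivation, and of \<open>theta\<close>.\<close>

lemma dual_section_representation:
  assumes \<Phi>: "smooth_linear M E \<Phi>"
  shows "dual_section M E \<Phi> \<in> sections (dual_bundle M E)"
    and "s \<in> sections E \<Longrightarrow> app (dual_section M E \<Phi>) s = \<Phi> s"
proof -
  define S where "S p v = (SOME s. s \<in> sections E \<and> s p = v)" for p v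
  have S: "S p v \<in> sections E" "S p v p = v" if "v \<in> fibre E p" for p v
    using section_through[OF that] someI_ex[of "\<lambda>s. s \<in> sections E \<and> s p = v"]
    unfolding S_def by blast+
  define \<mu> where "\<mu> p v = (if v \<in> fibre E p then \<Phi> (S p v) p else 0)" for p v
  have \<mu>: "\<mu> p (s p) = \<Phi> s p" if "s \<in> sections E" for s p
    using smooth_linear_tensorial[OF \<Phi> S(1) that S(2)] sections_in_fibre[OF that] by (simp add: \<mu>_def)
  have "linear_between (fibre E p) UNIV (\<mu> p)" for p
    unfolding linear_between_def
  proof (intro conjI ballI allI)
    fix u assume u: "u \<in> fibre E p"
    show "\<mu> p (c *\<^sub>R u) = c *\<^sub>R \<mu> p u" for c
      using \<mu>[OF S(1)[OF u], of p] \<mu>[OF sections_scaleR[OF S(1)[OF u]], of p c]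
        smooth_linearD(3)[OF \<Phi> smooth_functions_const S(1)[OF u], of c] S(2)[OF u]
      by (simp add: scaleR_eq_smul[of c "S p u"])
    fix v assume v: "v \<in> fibre E p"
    show "\<mu> p (u + v) = \<mu> p u + \<mu> p v"
      using \<mu>[OF S(1)[OF u], of p] \<mu>[OF S(1)[OF v], of p] \<mu>[OF sections_add[OF S(1)[OF u] S(1)[OF v]], of p]
        smooth_linearD(2)[OF \<Phi> S(1)[OF u] S(1)[OF v]] S(2)[OF u] S(2)[OF v]
      by simp
  qed simp
  moreover have app: "app \<mu> s = \<Phi> s" if "s \<in> sections E" for s
    using \<mu>[OF that] by (simp add: fun_eq_iff app_apply)
  ultimately have \<mu>_sec: "\<mu> \<in> sections (dual_bundle M E)"
    using \<Phi> by (simp add: dual_sections_iff dual_fibre_iff smooth_linear_def) (simp add: \<mu>_def)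
  have "dual_section M E \<Phi> = \<mu>"
    unfolding dual_section_def
    by (rule the_equality) (use \<mu>_sec app dual_sections_eqI in auto)
  then show "dual_section M E \<Phi> \<in> sections (dual_bundle M E)"
    and "s \<in> sections E \<Longrightarrow> app (dual_section M E \<Phi>) s = \<Phi> s"
    using \<mu>_sec app by auto
qed

lemma sections_eqI:
  assumes "\<And>p. a p \<in> fibre E p" "\<And>p. b p \<in> fibre E p"
    "\<And>\<mu>. \<mu> \<in> sections (dual_bundle M E) \<Longrightarrow> app \<mu> a = app \<mu> b"
  shows "a = b"
proof
  fix p
  obtain n e \<epsilon> \<eta> where "cutoff_frame p n e \<epsilon> \<eta>"
    by (rule cutoff_frame_exists)
  note * = cutoff_frameD[OF this]
  have "\<epsilon> i p (a p) = \<epsilon> i p (b p)" if "i < n" for i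
    using assms(3)[OF *(4)[OF that]] by (metis app_apply)
  then show "a p = b p"
    using *(5)[OF assms(1), of p] *(5)[OF assms(2), of p] *(2) by simp
qed

text \<open>The bundle is its own bidual. Near \<open>p\<close> the candidate has the coefficients
  \<open>\<Psi> (\<epsilon> i)\<close> in the cut-off frame and represents \<open>\<eta>\<close>
  times \<open>\<Psi>\<close>. The values of these candidates at their centres form a section by
  \<open>sections_local\<close>.\<close>

lemma sections_reflexive:
  assumes \<Psi>: "smooth_linear M (dual_bundle M E) \<Psi>"
  obtains a where "a \<in> sections E" "\<And>\<mu>. \<mu> \<in> sections (dual_bundle M E) \<Longrightarrow> app \<mu> a = \<Psi> \<mu>"
proof -
  have local: "\<exists>\<eta> b. \<eta> \<in> smooth_functions M \<and> \<eta> p = 1 \<and> b \<in> sections E \<and>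
      (\<forall>\<mu>\<in>sections (dual_bundle M E). app \<mu> b = \<eta> * \<Psi> \<mu>)" for p
  proof -
    obtain n e \<epsilon> \<eta> where "cutoff_frame p n e \<epsilon> \<eta>"
    by (rule cutoff_frame_exists)
  note * = cutoff_frameD[OF this]
    define b where "b = (\<Sum>i<n. \<Psi> (\<epsilon> i) \<odot> e i)"
    have "b \<in> sections E"
      unfolding b_def using * \<Psi> by (intro sections_sum sections_smul) (auto simp: smooth_linear_def)
    moreover have "app \<mu> b = \<eta> * \<Psi> \<mu>" if \<mu>: "\<mu> \<in> sections (dual_bundle M E)" for \<mu>
    proof -
      \<comment> \<open>\<open>smooth_linear_combination\<close> applies to a vector bundle, and the
        dual is not known to be one at this point. The induction therefore uses only closure under
        sums and multiples; the zero section is obtained as \<open>0 \<odot> \<mu>\<close>.\<close>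
      have sum_in: "(\<Sum>i\<in>I. f i \<odot> \<epsilon> i) \<in> sections (dual_bundle M E) \<and>
          \<Psi> (\<Sum>i\<in>I. f i \<odot> \<epsilon> i) = (\<Sum>i\<in>I. f i * \<Psi> (\<epsilon> i))"
        if "finite I" "I \<subseteq> {..<n}" "\<And>i. i \<in> I \<Longrightarrow> f i \<in> smooth_functions M" for I f
        using that
      proof (induction I rule: finite_induct)
        case empty
        have z: "0 \<odot> \<mu> = 0" by (simp add: fun_eq_iff)
        have "0 \<odot> \<mu> \<in> sections (dual_bundle M E)" "\<Psi> (0 \<odot> \<mu>) = 0 * \<Psi> \<mu>"
          using \<mu> \<Psi> by (auto intro: dual_sections_smul simp: smooth_linear_def)
        then show ?case by (simp only: z sum.empty mult_zero_left simp_thms)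
      next
        case (insert i I)
        have f: "f j \<in> smooth_functions M" if "j \<in> insert i I" for j
          using insert.prems(2) that by blast
        have i: "f i \<odot> \<epsilon> i \<in> sections (dual_bundle M E)" "\<Psi> (f i \<odot> \<epsilon> i) = f i * \<Psi> (\<epsilon> i)"
          using f[of i] *(4)[of i] insert.prems(1) dual_sections_smul smooth_linearD(3)[OF \<Psi>] by auto
        have I: "(\<Sum>i\<in>I. f i \<odot> \<epsilon> i) \<in> sections (dual_bundle M E)"
          "\<Psi> (\<Sum>i\<in>I. f i \<odot> \<epsilon> i) = (\<Sum>i\<in>I. f i * \<Psi> (\<epsilon> i))"
          using insert.IH[OF _ f] insert.prems(1) by blast+
        show ?case
          unfolding sum.insert[OF insert.hyps] smooth_linearD(2)[OF \<Psi> i(1) I(1)] i(2) I(2)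
          using dual_sections_add[OF i(1) I(1)] by blast
      qed
      have lin: "linear_between (fibre E q) UNIV (\<mu> q)" for q
        using \<mu> by (simp add: dual_sections_iff dual_fibre_iff)
      \<comment> \<open>The expansion of vectors along the frame, transposed to an expansion of
        covectors along the coframe.\<close>
      have "\<eta> \<odot> \<mu> = (\<Sum>i<n. app \<mu> (e i) \<odot> \<epsilon> i)"
      proof (intro ext)
        fix q v
        show "(\<eta> \<odot> \<mu>) q v = (\<Sum>i<n. app \<mu> (e i) \<odot> \<epsilon> i) q v"
        proof (cases "v \<in> fibre E q")
          case True
          have "(\<eta> \<odot> \<mu>) q v = \<mu> q (\<Sum>i<n. \<epsilon> i q v *\<^sub>R e i q)"
            using lin[of q] True unfolding *(5)[OF True, symmetric] by (simp add: linear_between_def)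
          also have "\<dots> = (\<Sum>i<n. \<epsilon> i q v *\<^sub>R \<mu> q (e i q))"
            by (rule linear_between_sum[OF lin fibre_subspace]) (use *(3) sections_in_fibre in auto)
          finally show ?thesis by (simp add: sum_fun_apply app_apply mult.commute)
        next
          case False
          then show ?thesis
            using \<mu> *(4) by (simp add: sum_fun_apply dual_sections_iff dual_fibre_iff)
        qed
      qed
      then have "\<eta> * \<Psi> \<mu> = (\<Sum>i<n. app \<mu> (e i) * \<Psi> (\<epsilon> i))"
        using sum_in[of "{..<n}" "\<lambda>i. app \<mu> (e i)"] smooth_linearD(3)[OF \<Psi> *(1) \<mu>] \<mu> *(3)
        by (simp only: finite_lessThan order_refl lessThan_iff dual_sections_iff simp_thms)
      moreover have "app \<mu> b q = (\<Sum>i<n. \<Psi> (\<epsilon> i) q *\<^sub>R \<mu> q (e i q))" for q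
        unfolding b_def app_apply sum_fun_apply smul_apply
        by (rule linear_between_sum[OF lin fibre_subspace]) (use *(3) sections_in_fibre in auto)
      ultimately show ?thesis
        by (simp add: fun_eq_iff sum_fun_apply app_apply mult.commute)
    qed
    ultimately show ?thesis using *(1,2) by blast
  qed
  then obtain \<eta> b where \<eta>b: "\<And>p. \<eta> p \<in> smooth_functions M" "\<And>p. \<eta> p p = 1" "\<And>p. b p \<in> sections E"
    "\<And>p \<mu>. \<mu> \<in> sections (dual_bundle M E) \<Longrightarrow> app \<mu> (b p) = \<eta> p * \<Psi> \<mu>"
    by metis
  \<comment> \<open>Each local representative is evaluated only at its own centre, where its cut-off
    is 1. Thus no compatibility between representatives has to be checked beforehand.\<close>
  define a where "a p = b p p" for p
  have a_fib: "a p \<in> fibre E p" for p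
    using sections_in_fibre[OF \<eta>b(3)] by (simp add: a_def)
  have a: "app \<mu> a = \<Psi> \<mu>" if "\<mu> \<in> sections (dual_bundle M E)" for \<mu>
  proof
    fix p
    show "app \<mu> a p = \<Psi> \<mu> p"
      using fun_cong[OF \<eta>b(4)[OF that, of p], of p] \<eta>b(2) by (simp add: app_apply a_def)
  qed
  have "a \<in> sections E"
  proof (rule sections_local)
    fix p
    have "\<eta> p \<odot> a = b p"
    proof (rule sections_eqI)
      show "(\<eta> p \<odot> a) q \<in> fibre E q" for q
        using a_fib by (simp add: subspace_scale[OF fibre_subspace])
      show "b p q \<in> fibre E q" for q using sections_in_fibre[OF \<eta>b(3)] .
      show "app \<mu> (\<eta> p \<odot> a) = app \<mu> (b p)" if "\<mu> \<in> sections (dual_bundle M E)" for \<mu>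
        using pairing_smul[OF that a_fib] a[OF that] \<eta>b(4)[OF that] by simp
    qed
    then show "\<exists>\<eta>\<in>smooth_functions M. \<eta> p \<noteq> 0 \<and> \<eta> \<odot> a \<in> sections E"
      using \<eta>b(1-3) by (intro bexI[of _ "\<eta> p"]) auto
  qed
  then show ?thesis using that a by blast
qed

end

section \<open>Vector fields and one-forms\<close>

lemma tangent_fibre_iff:
  "v \<in> fibre (tangent_bundle M) p \<longleftrightarrow> linear_between (smooth_functions M) UNIV v \<and>
     (\<forall>f\<in>smooth_functions M. \<forall>g\<in>smooth_functions M. v (f * g) = f p * v g + g p * v f) \<and>
     (\<forall>f. f \<notin> smooth_functions M \<longrightarrow> v f = 0)"
  by (simp add: tangent_bundle_def Let_def)

lemma vector_fields_iff:
  "X \<in> vector_fields M \<longleftrightarrow> (\<forall>p. X p \<in> fibre (tangent_bundle M) p) \<and>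
     (\<forall>f\<in>smooth_functions M. lie_fun X f \<in> smooth_functions M)"
  by (simp add: tangent_bundle_def Let_def)

lemma tangent_subspace: "subspace (fibre (tangent_bundle M) p)"
  by (auto simp: subspace_def tangent_fibre_iff linear_between_def algebra_simps)

lemma tangent_at:
  assumes "v \<in> fibre (tangent_bundle M) p" "f \<in> smooth_functions M" "g \<in> smooth_functions M"
  shows "v (f + g) = v f + v g" "v (c *\<^sub>R f) = c * v f" "v (f * g) = f p * v g + g p * v f"
  using assms by (auto simp: tangent_fibre_iff linear_between_def)

lemma tangent_at_0:
  assumes "v \<in> fibre (tangent_bundle M) p"
  shows "v 0 = 0"
  using tangent_at(2)[OF assms smooth_functions_0 smooth_functions_0, of 0] by simp

lemma tangent_nonsmooth: "v \<in> fibre (tangent_bundle M) p \<Longrightarrow> f \<notin> smooth_functions M \<Longrightarrow> v f = 0"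
  by (simp add: tangent_fibre_iff)

lemma vector_field_at: "X \<in> vector_fields M \<Longrightarrow> X p \<in> fibre (tangent_bundle M) p"
  by (simp add: vector_fields_iff)

lemma lie_fun_smooth [simp]:
  "X \<in> vector_fields M \<Longrightarrow> f \<in> smooth_functions M \<Longrightarrow> lie_fun X f \<in> smooth_functions M"
  by (simp add: vector_fields_iff)

lemma lie_fun_add:
  assumes "X \<in> vector_fields M" "f \<in> smooth_functions M" "g \<in> smooth_functions M"
  shows "lie_fun X (f + g) = lie_fun X f + lie_fun X g"
  using tangent_at(1)[OF vector_field_at[OF assms(1)] assms(2,3)] by (simp add: fun_eq_iff lie_fun_def)

lemma lie_fun_mult:
  assumes "X \<in> vector_fields M" "f \<in> smooth_functions M" "g \<in> smooth_functions M"
  shows "lie_fun X (f * g) = f * lie_fun X g + g * lie_fun X f"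
  using tangent_at(3)[OF vector_field_at[OF assms(1)] assms(2,3)] by (simp add: fun_eq_iff lie_fun_def)

lemma lie_fun_scaleR:
  assumes "X \<in> vector_fields M" "f \<in> smooth_functions M"
  shows "lie_fun X (c *\<^sub>R f) = c *\<^sub>R lie_fun X f"
  using tangent_at(2)[OF vector_field_at[OF assms(1)] assms(2,2)] by (simp add: fun_eq_iff lie_fun_def)

lemma lie_fun_uminus:
  assumes "X \<in> vector_fields M" "f \<in> smooth_functions M"
  shows "lie_fun X (- f) = - lie_fun X f"
  using lie_fun_scaleR[OF assms, of "-1"] by simp

lemma lie_fun_diff:
  assumes "X \<in> vector_fields M" "f \<in> smooth_functions M" "g \<in> smooth_functions M"
  shows "lie_fun X (f - g) = lie_fun X f - lie_fun X g"
  using lie_fun_add[of X M f "- g"] lie_fun_uminus[of X M g] assms by simp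

lemma lie_fun_0: "X \<in> vector_fields M \<Longrightarrow> lie_fun X 0 = 0"
  using tangent_at_0[OF vector_field_at[of X M]] by (simp add: fun_eq_iff lie_fun_def)

lemma lie_fun_field_add: "lie_fun (X + Y) f = lie_fun X f + lie_fun Y f"
  and lie_fun_field_diff: "lie_fun (X - Y) f = lie_fun X f - lie_fun Y f"
  and lie_fun_field_uminus: "lie_fun (- X) f = - lie_fun X f"
  and lie_fun_field_smul: "lie_fun (g \<odot> X) f = g * lie_fun X f"
  and lie_fun_field_0: "lie_fun 0 f = 0"
  by (simp_all add: fun_eq_iff lie_fun_def)

lemma lie_fun_bracket:
  "lie_fun (vf_bracket X Y) f = lie_fun X (lie_fun Y f) - lie_fun Y (lie_fun X f)"
  by (simp add: fun_eq_iff lie_fun_def vf_bracket_def)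

lemma lie_fun_nonsmooth: "X \<in> vector_fields M \<Longrightarrow> f \<notin> smooth_functions M \<Longrightarrow> lie_fun X f = 0"
  using tangent_nonsmooth[OF vector_field_at[of X M]] by (simp add: fun_eq_iff lie_fun_def)

lemma vector_fields_uminus: "X \<in> vector_fields M \<Longrightarrow> - X \<in> vector_fields M"
  unfolding vector_fields_iff lie_fun_field_uminus by (auto intro: subspace_neg[OF tangent_subspace])

lemma vector_fields_diff:
  "X \<in> vector_fields M \<Longrightarrow> Y \<in> vector_fields M \<Longrightarrow> X - Y \<in> vector_fields M"
  unfolding vector_fields_iff lie_fun_field_diff by (auto intro: subspace_diff[OF tangent_subspace])

lemma vector_fields_bracket:
  assumes X: "X \<in> vector_fields M" and Y: "Y \<in> vector_fields M"
  shows "vf_bracket X Y \<in> vector_fields M"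
proof -
  have at: "vf_bracket X Y p f = lie_fun X (lie_fun Y f) p - lie_fun Y (lie_fun X f) p" for p f
    by (simp add: vf_bracket_def lie_fun_def)
  have "vf_bracket X Y p \<in> fibre (tangent_bundle M) p" for p
    unfolding tangent_fibre_iff
  proof (intro conjI ballI allI impI)
    show "linear_between (smooth_functions M) UNIV (vf_bracket X Y p)"
      unfolding linear_between_def at using X Y
      by (auto simp: lie_fun_add lie_fun_scaleR algebra_simps)
    show "vf_bracket X Y p (f * g) = f p * vf_bracket X Y p g + g p * vf_bracket X Y p f"
      if "f \<in> smooth_functions M" "g \<in> smooth_functions M" for f g
      unfolding at using X Y that by (simp add: lie_fun_add lie_fun_mult algebra_simps)
    show "vf_bracket X Y p f = 0" if "f \<notin> smooth_functions M" for f
      unfolding at using lie_fun_nonsmooth[OF X that] lie_fun_nonsmooth[OF Y that] lie_fun_0[OF X] lie_fun_0[OF Y]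
      by simp
  qed
  then show ?thesis
    using X Y by (simp add: vector_fields_iff[of "vf_bracket X Y"] lie_fun_bracket)
qed

text \<open>Smooth functions suffice because tangent vectors are 0 on all other functions by
  convention.\<close>

lemma vector_fields_eqI:
  assumes "X \<in> vector_fields M" "Y \<in> vector_fields M"
    "\<And>f. f \<in> smooth_functions M \<Longrightarrow> lie_fun X f = lie_fun Y f"
  shows "X = Y"
proof (intro ext)
  fix p f
  show "X p f = Y p f"
  proof (cases "f \<in> smooth_functions M")
    case True
    from fun_cong[OF assms(3)[OF this], of p] show ?thesis by (simp add: lie_fun_def)
  next
    case False
    then show ?thesis using tangent_nonsmooth[OF vector_field_at] assms(1,2) by metis
  qed
qed

lemma vf_bracket_uminus_left:
  "X \<in> vector_fields M \<Longrightarrow> Y \<in> vector_fields M \<Longrightarrow> vf_bracket (- X) Y = - vf_bracket X Y"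
  by (rule vector_fields_eqI[where M = M])
    (auto simp: vector_fields_bracket vector_fields_uminus lie_fun_bracket lie_fun_field_uminus lie_fun_uminus)

section \<open>Differentials and covectors\<close>

lemma differential_at: "v \<in> fibre (tangent_bundle M) p \<Longrightarrow> differential M f p v = v f"
  by (simp add: differential_def)

lemma differential_in_fibre:
  "f \<in> smooth_functions M \<Longrightarrow> differential M f p \<in> fibre (cotangent_bundle M) p"
  by (auto simp: dual_fibre_iff differential_def linear_between_def
      subspace_add[OF tangent_subspace] subspace_scale[OF tangent_subspace])

lemma pairing_differential: "X \<in> vector_fields M \<Longrightarrow> app (differential M f) X = lie_fun X f"
  by (simp add: fun_eq_iff app_apply lie_fun_def differential_at vector_field_at)

lemma differential_one_form: "f \<in> smooth_functions M \<Longrightarrow> differential M f \<in> one_forms M"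
  by (auto simp: dual_sections_iff differential_in_fibre pairing_differential)

lemma tangent_eqI:
  assumes "v \<in> fibre (tangent_bundle M) p" "w \<in> fibre (tangent_bundle M) p"
    "\<And>\<beta>. \<beta> \<in> fibre (cotangent_bundle M) p \<Longrightarrow> \<beta> v = \<beta> w"
  shows "v = w"
proof
  fix f
  show "v f = w f"
  proof (cases "f \<in> smooth_functions M")
    case True
    from assms(3)[OF differential_in_fibre[OF this]] show ?thesis
      by (simp add: differential_at[OF assms(1)] differential_at[OF assms(2)])
  next
    case False
    then show ?thesis using tangent_nonsmooth assms(1,2) by metis
  qed
qed

text \<open>By induction on the set. If every function annihilated by \<open>B\<close> were
  annihilated by the new vector \<open>v\<close>, then \<open>v\<close> would be a combination of
  \<open>B\<close>. Otherwise a function seen by \<open>v\<close> and not by \<open>B\<close>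
  adjusts the value at \<open>v\<close> alone.\<close>

lemma independent_tangent_dual_functions:
  assumes "finite B" "independent B" "B \<subseteq> fibre (tangent_bundle M) p"
  shows "\<exists>f\<in>smooth_functions M. \<forall>v\<in>B. v f = t v"
  using assms
proof (induction B arbitrary: t rule: finite_induct)
  case empty
  then show ?case by blast
next
  case (insert v B)
  have B: "independent B" "v \<notin> span B" "B \<subseteq> fibre (tangent_bundle M) p"
    using insert.prems insert.hyps by (auto simp: independent_insert)
  note T = tangent_at[OF subsetD[OF insert.prems(2)]]
  have "\<exists>g\<in>smooth_functions M. (\<forall>w\<in>B. w g = 0) \<and> v g \<noteq> 0"
  proof (rule ccontr)
    assume no: "\<not> (\<exists>g\<in>smooth_functions M. (\<forall>w\<in>B. w g = 0) \<and> v g \<noteq> 0)"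
    \<comment> \<open>The induction hypothesis, applied to indicator values, provides functions dual
      to the vectors of \<open>B\<close>.\<close>
    have "\<exists>f. f \<in> smooth_functions M \<and> (\<forall>u\<in>B. u f = (if u = w then 1 else 0))" for w
      using insert.IH[OF B(1,3), of "\<lambda>u. if u = w then 1 else 0"] by blast
    then obtain F where F: "\<And>w. F w \<in> smooth_functions M" "\<And>w u. u \<in> B \<Longrightarrow> u (F w) = (if u = w then 1 else 0)"
      by metis
    have lin_sum: "u (\<Sum>w\<in>C. c w *\<^sub>R F w) = (\<Sum>w\<in>C. c w * u (F w))"
      if u: "u \<in> fibre (tangent_bundle M) p" and "finite C" for u c C
      using \<open>finite C\<close>
    proof (induction C rule: finite_induct)
      case empty
      show ?case unfolding sum.empty by (rule tangent_at_0[OF u])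
    next
      case (insert w C)
      show ?case
        unfolding sum.insert[OF insert.hyps]
        using F(1) by (subst tangent_at(1)[OF u]) (auto simp: tangent_at(2)[OF u F(1) F(1)] insert.IH)
    qed
    have "v f = (\<Sum>w\<in>B. v (F w) *\<^sub>R w) f" for f
    proof (cases "f \<in> smooth_functions M")
      case True
      \<comment> \<open>Subtracting the dual functions leaves a function annihilated by
        \<open>B\<close>, hence by \<open>v\<close>; what remains expresses \<open>v f\<close>
        through the values of \<open>B\<close> on \<open>f\<close>.\<close>
      define g where "g = f - (\<Sum>w\<in>B. w f *\<^sub>R F w)"
      have S: "(\<Sum>w\<in>B. w f *\<^sub>R F w) \<in> smooth_functions M"
        using F(1) by (intro smooth_functions_sum) auto
      have g: "g \<in> smooth_functions M" using True S by (simp add: g_def)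
      have f: "f = g + (\<Sum>w\<in>B. w f *\<^sub>R F w)" by (simp add: g_def)
      have split: "u f = u g + (\<Sum>w\<in>B. w f * u (F w))" if u: "u \<in> fibre (tangent_bundle M) p" for u
      proof -
        have "u f = u (g + (\<Sum>w\<in>B. w f *\<^sub>R F w))" using f by simp
        also have "\<dots> = u g + u (\<Sum>w\<in>B. w f *\<^sub>R F w)" by (rule tangent_at(1)[OF u g S])
        finally show ?thesis by (simp only: lin_sum[OF u insert.hyps(1)])
      qed
      have "u g = 0" if "u \<in> B" for u
      proof -
        have "(\<Sum>w\<in>B. w f * u (F w)) = (\<Sum>w\<in>B. if w = u then u f else 0)"
          by (rule sum.cong) (auto simp: F(2)[OF that])
        then show ?thesis using split[of u] that B(3) insert.hyps(1) by (auto simp: sum.delta)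
      qed
      then have "v g = 0" using no g by blast
      then show ?thesis using split[of v] insert.prems(2) by (simp add: sum_fun_apply mult.commute)
    next
      case False
      then show ?thesis
        using insert.prems(2) tangent_nonsmooth[of _ M p f]
        by (simp add: sum_fun_apply subset_iff) (metis (no_types, lifting) mult_zero_right sum.neutral)
    qed
    then have "v = (\<Sum>w\<in>B. v (F w) *\<^sub>R w)" by blast
    moreover have "(\<Sum>w\<in>B. v (F w) *\<^sub>R w) \<in> span B"
      by (intro span_sum span_scale span_base)
    ultimately show False using B(2) by metis
  qed
  then obtain g where g: "g \<in> smooth_functions M" "\<forall>w\<in>B. w g = 0" "v g \<noteq> 0" by blast
  obtain f where f: "f \<in> smooth_functions M" "\<forall>w\<in>B. w f = t w"
    using insert.IH[OF B(1,3)] by blast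
  define h where "h = f + ((t v - v f) / v g) *\<^sub>R g"
  have "u h = u f + ((t v - v f) / v g) * u g" if "u \<in> insert v B" for u
    unfolding h_def using T(1,2)[OF that] f(1) g(1) by simp
  moreover have "u f + ((t v - v f) / v g) * u g = t u" if "u \<in> insert v B" for u
    using that f(2) g(2,3) by auto
  ultimately have "\<forall>u\<in>insert v B. u h = t u" by simp
  moreover have "h \<in> smooth_functions M" using f(1) g(1) by (simp add: h_def)
  ultimately show ?case by blast
qed

text \<open>Only finitely many tangent vectors matter at a time, so that this replaces the finite
  dimension of \<open>T\<^sub>pM\<close> throughout.\<close>

lemma covector_as_differential:
  assumes "finite B" "B \<subseteq> fibre (tangent_bundle M) p" "\<alpha> \<in> fibre (cotangent_bundle M) p"
  obtains f where "f \<in> smooth_functions M" "\<And>v. v \<in> span B \<Longrightarrow> v f = \<alpha> v"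
proof -
  obtain C where C: "C \<subseteq> B" "independent C" "B \<subseteq> span C"
    using maximal_independent_subset[of B] by blast
  obtain f where f: "f \<in> smooth_functions M" "\<forall>v\<in>C. v f = \<alpha> v"
    using independent_tangent_dual_functions[of C M p \<alpha>] C assms finite_subset by blast
  have "span C \<subseteq> {v \<in> fibre (tangent_bundle M) p. v f = \<alpha> v}"
  proof (rule span_minimal)
    show "C \<subseteq> {v \<in> fibre (tangent_bundle M) p. v f = \<alpha> v}"
      using f(2) C(1) assms(2) by blast
    have "linear_between (fibre (tangent_bundle M) p) UNIV \<alpha>"
      using assms(3) by (simp add: dual_fibre_iff)
    moreover from this have "\<alpha> (0 *\<^sub>R 0) = 0 *\<^sub>R \<alpha> 0"
      using subspace_0[OF tangent_subspace[of M p]] by (simp only: linear_between_def)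
    then have "\<alpha> 0 = 0" by simp
    ultimately show "subspace {v \<in> fibre (tangent_bundle M) p. v f = \<alpha> v}"
      by (auto simp: subspace_def linear_between_def subspace_0[OF tangent_subspace]
          subspace_add[OF tangent_subspace] subspace_scale[OF tangent_subspace])
  qed
  then have "v f = \<alpha> v" if "v \<in> span C" for v
    using that by blast
  moreover have "span B \<subseteq> span C" using C(3) span_minimal subspace_span by blast
  ultimately show ?thesis using that f(1) by blast
qed

section \<open>Bundle maps and Lie algebroids\<close>

lemma bundle_map_sections: "bundle_map E E' F \<Longrightarrow> s \<in> sections E \<Longrightarrow> app F s \<in> sections E'"
  by (simp add: bundle_map_def)

lemma bundle_map_fibre: "bundle_map E E' F \<Longrightarrow> v \<in> fibre E p \<Longrightarrow> F p v \<in> fibre E' p"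
  by (simp add: bundle_map_def linear_between_def)

lemma bundle_map_linear:
  assumes "bundle_map E E' F" "u \<in> fibre E p" "v \<in> fibre E p"
  shows "F p (u + v) = F p u + F p v" "F p (c *\<^sub>R u) = c *\<^sub>R F p u"
  using assms by (auto simp: bundle_map_def linear_between_def)

lemma app_add:
  assumes "bundle_map E E' F" "\<And>p. s p \<in> fibre E p" "\<And>p. t p \<in> fibre E p"
  shows "app F (s + t) = app F s + app F t"
  using bundle_map_linear(1)[OF assms(1) assms(2,3)] by (simp add: fun_eq_iff app_apply)

lemma app_smul:
  assumes "bundle_map E E' F" "\<And>p. s p \<in> fibre E p"
  shows "app F (f \<odot> s) = f \<odot> app F s"
  using bundle_map_linear(2)[OF assms(1) assms(2,2)] by (simp add: fun_eq_iff app_apply)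

lemma app_scaleR:
  assumes "bundle_map E E' F" "\<And>p. s p \<in> fibre E p"
  shows "app F (c *\<^sub>R s) = c *\<^sub>R app F s"
  unfolding scaleR_eq_smul by (rule app_smul[OF assms])

lemma app_comp: "app (\<lambda>p v. F p (G p v)) s = app F (app G s)"
  by (simp add: fun_eq_iff app_apply)

lemma bundle_map_compose:
  assumes "bundle_map E E' F" "bundle_map E' E'' G"
  shows "bundle_map E E'' (\<lambda>p v. G p (F p v))"
  using assms by (auto simp: bundle_map_def linear_between_def app_comp)

lemma transpose_map_apply: "v \<in> fibre E p \<Longrightarrow> transpose_map E F p \<beta> v = \<beta> (F p v)"
  by (simp add: transpose_map_def)

section \<open>Transposes and pullbacks of covectors\<close>

context smooth_bundle
begin

lemma transpose_map_fibre:
  assumes "bundle_map E E' F" "\<beta> \<in> fibre (dual_bundle M' E') p"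
  shows "transpose_map E F p \<beta> \<in> fibre (dual_bundle M E) p"
  using assms subspace_add[OF fibre_subspace] subspace_scale[OF fibre_subspace]
  by (auto simp: dual_fibre_iff transpose_map_def linear_between_def bundle_map_def)

lemma pairing_transpose:
  "s \<in> sections E \<Longrightarrow> app (app (transpose_map E F) \<beta>) s = app \<beta> (app F s)"
  by (simp add: fun_eq_iff app_apply transpose_map_apply sections_in_fibre)

lemma transpose_map_sections:
  assumes "bundle_map E E' F" "\<beta> \<in> sections (dual_bundle M E')"
  shows "app (transpose_map E F) \<beta> \<in> sections (dual_bundle M E)"
  unfolding dual_sections_iff[of _ M E]
proof (intro conjI allI ballI)
  have \<beta>: "\<beta> p \<in> fibre (dual_bundle M E') p" for p
    using assms(2) by (simp add: dual_sections_iff)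
  show "app (transpose_map E F) \<beta> p \<in> fibre (dual_bundle M E) p" for p
    unfolding app_apply by (rule transpose_map_fibre[OF assms(1) \<beta>])
  show "app (app (transpose_map E F) \<beta>) s \<in> smooth_functions M" if "s \<in> sections E" for s
    using assms(2) bundle_map_sections[OF assms(1) that] by (simp add: pairing_transpose that dual_sections_iff)
qed

lemma fibre_finite_span: obtains B where "finite B" "B \<subseteq> fibre E p" "fibre E p = span B"
proof -
  obtain n e \<epsilon> \<eta> where "cutoff_frame p n e \<epsilon> \<eta>"
    by (rule cutoff_frame_exists)
  note * = cutoff_frameD[OF this]
  let ?B = "(\<lambda>i. e i p) ` {..<n}"
  have B: "?B \<subseteq> fibre E p" using *(3) sections_in_fibre by blast
  moreover have "v \<in> span ?B" if "v \<in> fibre E p" for v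
  proof -
    have "v = (\<Sum>i<n. \<epsilon> i p v *\<^sub>R e i p)" using *(5)[OF that] *(2) by simp
    also have "\<dots> \<in> span ?B" by (intro span_sum span_scale span_base) auto
    finally show ?thesis .
  qed
  ultimately show ?thesis
    using that[of ?B] span_minimal[OF B fibre_subspace] by blast
qed

text \<open>All frames of an atlas have the same length, so rank 0 at one point is rank 0
  everywhere. This settles the degenerate case in \<open>anchor_bracket\<close>.\<close>

lemma fibre_trivial:
  assumes "fibre E p = {0}"
  shows "fibre E q = {0}"
proof -
  obtain k F where "frame_atlas k F"
    by (rule frame_atlas_exists)
  note F = frame_atlasD[OF this]
  obtain U e where U: "(U, e) \<in> F" "p \<in> U" using F(1) by blast
  have "\<not> k > 0"
  proof
    assume "k > 0"
    then have "e 0 p \<in> (\<lambda>i. e i p) ` {..<k}" by blast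
    moreover from this have "e 0 p \<in> fibre E p" "independent ((\<lambda>i. e i p) ` {..<k})"
      using F(2)[OF U(1)] U(2) by (auto simp: local_frame_def intro: span_base)
    ultimately show False using assms dependent_zero[of "(\<lambda>i. e i p) ` {..<k}"] by auto
  qed
  moreover obtain V e' where "(V, e') \<in> F" "q \<in> V" using F(1) by blast
  ultimately show ?thesis using F(2)[of V e'] by (simp add: local_frame_def)
qed

text \<open>The image of a fibre under \<open>\<rho>\<close> is spanned by finitely many vectors, so
  \<open>covector_as_differential\<close> applies to them together with \<open>w\<close>. The
  additional vector \<open>w\<close> lets the same function compute the pairing needed for
  skew-symmetry in \<open>P_skew\<close>.\<close>

lemma pullback_as_differential:
  assumes \<rho>: "bundle_map E (tangent_bundle M) \<rho>"
    and \<alpha>: "\<alpha> \<in> fibre (cotangent_bundle M) p" and w: "w \<in> fibre (tangent_bundle M) p"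
  obtains f where "f \<in> smooth_functions M" "w f = \<alpha> w"
    "transpose_map E \<rho> p (differential M f p) = transpose_map E \<rho> p \<alpha>"
proof -
  obtain B where B: "finite B" "B \<subseteq> fibre E p" "fibre E p = span B"
    by (rule fibre_finite_span)
  have "insert w (\<rho> p ` B) \<subseteq> fibre (tangent_bundle M) p"
    using w B(2) bundle_map_fibre[OF \<rho>] by blast
  from covector_as_differential[OF _ this \<alpha>] B(1) obtain f where f: "f \<in> smooth_functions M"
    "\<And>v. v \<in> span (insert w (\<rho> p ` B)) \<Longrightarrow> v f = \<alpha> v"
    by auto
  have "\<rho> p v f = \<alpha> (\<rho> p v)" if "v \<in> fibre E p" for v
  proof -
    have "fibre E p \<subseteq> {v \<in> fibre E p. \<rho> p v \<in> span (insert w (\<rho> p ` B))}"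
    proof (subst B(3), rule span_minimal)
      show "B \<subseteq> {v \<in> fibre E p. \<rho> p v \<in> span (insert w (\<rho> p ` B))}"
        using B(2) by (auto intro: span_base)
      have "\<rho> p 0 = 0"
        using bundle_map_linear(2)[OF \<rho> subspace_0[OF fibre_subspace] subspace_0[OF fibre_subspace], where c = 0]
        by simp
      then show "subspace {v \<in> fibre E p. \<rho> p v \<in> span (insert w (\<rho> p ` B))}"
        using bundle_map_linear[OF \<rho>] fibre_subspace[of p]
        by (auto simp: subspace_def span_add span_scale span_0)
    qed
    then show ?thesis using f(2) that by blast
  qed
  then have "transpose_map E \<rho> p (differential M f p) = transpose_map E \<rho> p \<alpha>"
    using bundle_map_fibre[OF \<rho>] by (auto simp: transpose_map_def differential_at)
  moreover have "w f = \<alpha> w" by (intro f(2) span_base) simp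
  ultimately show ?thesis using that f(1) by blast
qed

end

section \<open>Lie algebroids\<close>

locale lie_algebroid_on =
  fixes M :: "'m::{t2_space, second_countable_topology} manifold"
    and A :: "('m, 'v::real_vector) vbundle"
    and br :: "('m \<Rightarrow> 'v) \<Rightarrow> ('m \<Rightarrow> 'v) \<Rightarrow> 'm \<Rightarrow> 'v"
    and \<rho> :: "'m \<Rightarrow> 'v \<Rightarrow> 'm tangent"
  assumes manifold: "smooth_manifold M" and algebroid: "lie_algebroid M A br \<rho>"

sublocale lie_algebroid_on \<subseteq> smooth_bundle M A
  by unfold_locales (use manifold algebroid in \<open>simp_all add: lie_algebroid_def\<close>)

context lie_algebroid_on
begin

lemma anchor: "bundle_map A (tangent_bundle M) \<rho>"
  using algebroid by (simp add: lie_algebroid_def)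

lemma anchor_field [simp]: "a \<in> sections A \<Longrightarrow> app \<rho> a \<in> vector_fields M"
  by (rule bundle_map_sections[OF anchor])

lemma
  assumes "a \<in> sections A" "b \<in> sections A"
  shows bracket_section [simp]: "br a b \<in> sections A"
    and bracket_skew: "br a b = - br b a"
    and bracket_scaleR_right: "br a (x *\<^sub>R b) = x *\<^sub>R br a b"
    and bracket_add_right: "c \<in> sections A \<Longrightarrow> br a (b + c) = br a b + br a c"
    and bracket_jacobi: "c \<in> sections A \<Longrightarrow> br a (br b c) + br b (br c a) + br c (br a b) = 0"
    and bracket_smul_right: "f \<in> smooth_functions M \<Longrightarrow>
          br a (f \<odot> b) = f \<odot> br a b + lie_fun (app \<rho> a) f \<odot> b"
  using algebroid assms unfolding lie_algebroid_def by blast+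

lemma bracket_uminus_right:
  "a \<in> sections A \<Longrightarrow> b \<in> sections A \<Longrightarrow> br a (- b) = - br a b"
  using bracket_scaleR_right[of a b "-1"] by simp

lemma bracket_diff_right:
  "a \<in> sections A \<Longrightarrow> b \<in> sections A \<Longrightarrow> c \<in> sections A \<Longrightarrow> br a (b - c) = br a b - br a c"
  using bracket_add_right[of a b "- c"] bracket_uminus_right sections_uminus by simp

lemma bracket_jacobi_left:
  assumes "a \<in> sections A" "b \<in> sections A" "c \<in> sections A"
  shows "br (br a b) c = br a (br b c) - br b (br a c)"
proof -
  have "br c (br a b) = - br (br a b) c" "br b (br c a) = - br b (br a c)"
    using assms bracket_skew[of c "br a b"] bracket_skew[of c a] bracket_uminus_right[of b "br a c"] by simp_all
  then show ?thesis
    using bracket_jacobi[OF assms] by (simp add: algebra_simps)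
qed

text \<open>Follows from the Jacobi identity and the Leibniz rule: two expansions of the bracket of
  \<open>br a b\<close> with \<open>f \<odot> c\<close> differ by the defect of the anchor on
  \<open>f\<close>, multiplied by \<open>c\<close>.\<close>

lemma anchor_bracket:
  assumes a: "a \<in> sections A" and b: "b \<in> sections A"
  shows "app \<rho> (br a b) = vf_bracket (app \<rho> a) (app \<rho> b)"
proof (rule vector_fields_eqI[where M = M])
  show "app \<rho> (br a b) \<in> vector_fields M" "vf_bracket (app \<rho> a) (app \<rho> b) \<in> vector_fields M"
    using a b by (auto intro: vector_fields_bracket)
  fix f assume f: "f \<in> smooth_functions M"
  define g where "g = lie_fun (app \<rho> (br a b)) f - lie_fun (vf_bracket (app \<rho> a) (app \<rho> b)) f"
  have annihilates: "g \<odot> c = 0" if c: "c \<in> sections A" for c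
  proof -
    let ?X = "app \<rho> a" and ?Y = "app \<rho> b"
    note fc = sections_smul[OF f c]
    have Xf: "lie_fun ?X f \<in> smooth_functions M" "lie_fun ?Y f \<in> smooth_functions M"
      using a b f by simp_all
    have "f \<odot> br (br a b) c + lie_fun (app \<rho> (br a b)) f \<odot> c = br (br a b) (f \<odot> c)"
      using a b c f by (simp add: bracket_smul_right)
    also have "\<dots> = br a (br b (f \<odot> c)) - br b (br a (f \<odot> c))"
      using bracket_jacobi_left[OF a b fc] .
    also have "\<dots> = f \<odot> br a (br b c) + lie_fun ?X f \<odot> br b c
        + (lie_fun ?Y f \<odot> br a c + lie_fun ?X (lie_fun ?Y f) \<odot> c)
        - (f \<odot> br b (br a c) + lie_fun ?Y f \<odot> br a c
        + (lie_fun ?X f \<odot> br b c + lie_fun ?Y (lie_fun ?X f) \<odot> c))"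
      using a b c f Xf
      by (simp add: bracket_smul_right bracket_add_right sections_smul)
    finally show ?thesis
      unfolding g_def lie_fun_bracket bracket_jacobi_left[OF a b c]
      by (simp add: fun_eq_iff algebra_simps)
  qed
  \<comment> \<open>If the defect is nonzero at \<open>p\<close>, all sections vanish there. Then
    the rank is 0 everywhere, the sections involved are 0, and so is the defect.\<close>
  have "g p = 0" for p
  proof (rule ccontr)
    assume "g p \<noteq> 0"
    have "c p = 0" if "c \<in> sections A" for c
      using fun_cong[OF annihilates[OF that], of p] \<open>g p \<noteq> 0\<close> by simp
    then have "fibre A p \<subseteq> {0}"
      by (metis section_through singletonI subsetI)
    then have "fibre A q = {0}" for q
      using fibre_trivial[of p q] subspace_0[OF fibre_subspace] by blast
    then have "s = 0" if "s \<in> sections A" for s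
      using sections_in_fibre[OF that] by (simp add: fun_eq_iff)
    then have z: "br a b = 0" "a = 0" "b = 0" using a b by simp_all
    have "app \<rho> 0 = 0"
      using app_scaleR[OF anchor, of 0 0] subspace_0[OF fibre_subspace] by (simp add: fun_eq_iff)
    then have "app \<rho> (br a b) = 0" "app \<rho> a = 0" "app \<rho> b = 0"
      by (simp only: z(1), simp only: z(2), simp only: z(3))
    then have "g = 0"
      using lie_fun_bracket[of 0 0 f] by (simp add: g_def lie_fun_field_0)
    then show False using \<open>g p \<noteq> 0\<close> by simp
  qed
  then show "lie_fun (app \<rho> (br a b)) f = lie_fun (vf_bracket (app \<rho> a) (app \<rho> b)) f"
    by (simp add: g_def fun_eq_iff)
qed

section \<open>Lie derivative and differential with values in the dual\<close>

lemma pairing_smooth [simp]: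
  "\<mu> \<in> sections (dual_bundle M A) \<Longrightarrow> a \<in> sections A \<Longrightarrow> pairing \<mu> a \<in> smooth_functions M"
  by (simp add: dual_sections_iff)

lemma
  assumes "\<mu> \<in> sections (dual_bundle M A)" "a \<in> sections A"
  shows pairing_section_smul: "pairing \<mu> (f \<odot> a) = f * pairing \<mu> a"
    and pairing_section_add: "b \<in> sections A \<Longrightarrow> pairing \<mu> (a + b) = pairing \<mu> a + pairing \<mu> b"
    and pairing_section_uminus: "pairing \<mu> (- a) = - pairing \<mu> a"
    and pairing_section_diff: "b \<in> sections A \<Longrightarrow> pairing \<mu> (a - b) = pairing \<mu> a - pairing \<mu> b"
proof -
  show smul: "pairing \<mu> (f \<odot> a) = f * pairing \<mu> a" for f
    by (rule pairing_smul[OF assms(1)]) (rule sections_in_fibre[OF assms(2)])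
  have u: "pairing \<mu> (- a) = - pairing \<mu> a" if "a \<in> sections A" for a
  proof -
    have "pairing \<mu> ((\<lambda>p. -1) \<odot> a) = (\<lambda>p. -1) * pairing \<mu> a"
      by (rule pairing_smul[OF assms(1)]) (rule sections_in_fibre[OF that])
    moreover have "(\<lambda>p. -1) \<odot> a = - a" "(\<lambda>p. -1) * pairing \<mu> a = - pairing \<mu> a"
      by (simp_all add: fun_eq_iff)
    ultimately show ?thesis by simp
  qed
  show "pairing \<mu> (- a) = - pairing \<mu> a" by (rule u[OF assms(2)])
  have add: "pairing \<mu> (a + b) = pairing \<mu> a + pairing \<mu> b" if "b \<in> sections A" for b
    by (rule pairing_add[OF assms(1)]) (auto intro: sections_in_fibre assms(2) that)
  then show "b \<in> sections A \<Longrightarrow> pairing \<mu> (a + b) = pairing \<mu> a + pairing \<mu> b" .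
  show "pairing \<mu> (a - b) = pairing \<mu> a - pairing \<mu> b" if "b \<in> sections A"
    using add[OF sections_uminus[OF that]] u[OF that] by simp
qed

text \<open>The derivative of \<open>f\<close> along \<open>app \<rho> a\<close> arises once from
  the product rule and once from the Leibniz rule of the bracket, with opposite signs.\<close>

lemma smooth_linear_lie_dual:
  assumes "a \<in> sections A" "\<mu> \<in> sections (dual_bundle M A)"
  shows "smooth_linear M A (\<lambda>b. lie_fun (app \<rho> a) (pairing \<mu> b) - pairing \<mu> (br a b))"
  unfolding smooth_linear_def
proof (intro conjI ballI)
  fix s assume s: "s \<in> sections A"
  show "lie_fun (app \<rho> a) (pairing \<mu> s) - pairing \<mu> (br a s) \<in> smooth_functions M"
    using assms s by simp
  show "lie_fun (app \<rho> a) (pairing \<mu> (s + t)) - pairing \<mu> (br a (s + t)) =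
      lie_fun (app \<rho> a) (pairing \<mu> s) - pairing \<mu> (br a s) +
      (lie_fun (app \<rho> a) (pairing \<mu> t) - pairing \<mu> (br a t))" if "t \<in> sections A" for t
    using assms s that
    by (simp add: pairing_section_add bracket_add_right lie_fun_add[where M = M])
  show "lie_fun (app \<rho> a) (pairing \<mu> (f \<odot> s)) - pairing \<mu> (br a (f \<odot> s)) =
      f * (lie_fun (app \<rho> a) (pairing \<mu> s) - pairing \<mu> (br a s))" if "f \<in> smooth_functions M" for f
    using assms s that
    by (simp add: pairing_section_add pairing_section_smul bracket_smul_right sections_smul
        lie_fun_mult[where M = M] algebra_simps)
qed

lemma lie_dual_section [simp]:
  assumes "a \<in> sections A" "\<mu> \<in> sections (dual_bundle M A)"
  shows "lie_dual M A br \<rho> a \<mu> \<in> sections (dual_bundle M A)"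
  unfolding lie_dual_def by (rule dual_section_representation(1)[OF smooth_linear_lie_dual[OF assms]])

lemma pairing_lie_dual:
  assumes "a \<in> sections A" "\<mu> \<in> sections (dual_bundle M A)" "b \<in> sections A"
  shows "pairing (lie_dual M A br \<rho> a \<mu>) b = lie_fun (app \<rho> a) (pairing \<mu> b) - pairing \<mu> (br a b)"
  unfolding lie_dual_def by (rule dual_section_representation(2)[OF smooth_linear_lie_dual[OF assms(1,2)] assms(3)])

lemma pullback_section [simp]:
  "\<alpha> \<in> one_forms M \<Longrightarrow> app (transpose_map A \<rho>) \<alpha> \<in> sections (dual_bundle M A)"
  by (rule transpose_map_sections[OF anchor])

text \<open>The defining functional has an explicit representative, the pullback of df along the
  anchor, so only uniqueness has to be checked.\<close>

lemma algd_fun_eq: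
  assumes "f \<in> smooth_functions M"
  shows "algd_fun M A \<rho> f = app (transpose_map A \<rho>) (differential M f)"
proof -
  let ?\<mu> = "app (transpose_map A \<rho>) (differential M f)"
  have \<mu>: "?\<mu> \<in> sections (dual_bundle M A)" "app ?\<mu> b = algd_0 \<rho> f b" if "b \<in> sections A" for b
    using that assms by (simp_all add: differential_one_form pairing_transpose pairing_differential algd_0_def)
  have "?\<mu> \<in> sections (dual_bundle M A)" using assms by (simp add: differential_one_form)
  then show ?thesis
    unfolding algd_fun_def dual_section_def
    by (intro the_equality conjI ballI dual_sections_eqI) (auto simp: \<mu>(2))
qed

lemma algd_fun_section [simp]: "f \<in> smooth_functions M \<Longrightarrow> algd_fun M A \<rho> f \<in> sections (dual_bundle M A)"
  by (simp add: algd_fun_eq differential_one_form)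

lemma pairing_algd_fun:
  "f \<in> smooth_functions M \<Longrightarrow> b \<in> sections A \<Longrightarrow> pairing (algd_fun M A \<rho> f) b = lie_fun (app \<rho> b) f"
  by (simp add: algd_fun_eq pairing_transpose pairing_differential)

end

section \<open>Lie-Nijenhuis bialgebroids\<close>

lemma pairing_diff: "app (\<mu> - \<nu>) a = app \<mu> a - app \<nu> a"
  and pairing_plus: "app (\<mu> + \<nu>) a = app \<mu> a + app \<nu> a"
  for \<mu> \<nu> :: "'m \<Rightarrow> 'v \<Rightarrow> real"
  by (simp_all add: fun_eq_iff app_apply)

text \<open>The instance \<open>dual\<close> supplies the section calculus for the dual bundle,
  whose bundle structure is part of the Lie algebroid \<open>brs\<close>.\<close>

locale lie_nijenhuis =
  lie_algebroid_on M A br \<rho> + dual: lie_algebroid_on M "dual_bundle M A" brs \<rho>s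
  for M :: "'m::{t2_space, second_countable_topology} manifold"
    and A :: "('m, 'v::real_vector) vbundle"
    and br :: "('m \<Rightarrow> 'v) \<Rightarrow> ('m \<Rightarrow> 'v) \<Rightarrow> 'm \<Rightarrow> 'v"
    and \<rho> :: "'m \<Rightarrow> 'v \<Rightarrow> 'm tangent"
    and brs :: "('m \<Rightarrow> 'v \<Rightarrow> real) \<Rightarrow> ('m \<Rightarrow> 'v \<Rightarrow> real) \<Rightarrow> 'm \<Rightarrow> 'v \<Rightarrow> real"
    and \<rho>s :: "'m \<Rightarrow> ('v \<Rightarrow> real) \<Rightarrow> 'm tangent" +
  fixes D :: "'m vfield \<Rightarrow> ('m \<Rightarrow> 'v) \<Rightarrow> 'm \<Rightarrow> 'v"
    and l :: "'m \<Rightarrow> 'v \<Rightarrow> 'v"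
    and r :: "'m \<Rightarrow> 'm tangent \<Rightarrow> 'm tangent"
  assumes bialgebroid: "lie_bialgebroid M A br \<rho> brs \<rho>s"
    and im: "im_tensor M A br \<rho> D l r"
    and im_dual: "im_tensor M (dual_bundle M A) brs \<rho>s (gder_dual M A D l r) (transpose_map A l) r"
    and self_commuting: "gder_self_commuting M A D l r"
begin

abbreviation Gd :: "('m \<Rightarrow> 'v \<Rightarrow> real) set" where
  "Gd \<equiv> sections (dual_bundle M A)"

abbreviation dst :: "('m \<Rightarrow> 'v) \<Rightarrow> ('m \<Rightarrow> 'v \<Rightarrow> real) \<Rightarrow> ('m \<Rightarrow> 'v \<Rightarrow> real) \<Rightarrow> 'm \<Rightarrow> real" where
  "dst a \<equiv> algd_1 brs \<rho>s (\<lambda>\<xi>. pairing \<xi> a)"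

abbreviation Ld :: "('m \<Rightarrow> 'v) \<Rightarrow> ('m \<Rightarrow> 'v \<Rightarrow> real) \<Rightarrow> 'm \<Rightarrow> 'v \<Rightarrow> real" where
  "Ld \<equiv> lie_dual M A br \<rho>"

abbreviation dA :: "('m \<Rightarrow> real) \<Rightarrow> 'm \<Rightarrow> 'v \<Rightarrow> real" where
  "dA \<equiv> algd_fun M A \<rho>"

text \<open>The Hamiltonian vector field of \<open>f\<close>: as \<open>dA f\<close> is the pullback
  of df along \<open>\<rho>\<close>, its anchor is the contraction of \<pi> with df.\<close>

abbreviation ham :: "('m \<Rightarrow> real) \<Rightarrow> 'm vfield" where
  "ham f \<equiv> app \<rho>s (dA f)"

abbreviation lt :: "('m \<Rightarrow> 'v \<Rightarrow> real) \<Rightarrow> 'm \<Rightarrow> 'v \<Rightarrow> real" where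
  "lt \<equiv> app (transpose_map A l)"

section \<open>The derivation and its dual\<close>

lemma gder: "gder1 M A D l r"
  using im by (simp add: im_tensor_def)

lemma l_map: "bundle_map A A l" and r_map: "bundle_map (tangent_bundle M) (tangent_bundle M) r"
  using gder by (simp_all add: gder1_def)

lemma l_section [simp]: "a \<in> sections A \<Longrightarrow> app l a \<in> sections A"
  by (rule bundle_map_sections[OF l_map])

lemma r_field [simp]: "X \<in> vector_fields M \<Longrightarrow> app r X \<in> vector_fields M"
  by (rule bundle_map_sections[OF r_map])

lemma lt_section [simp]: "\<mu> \<in> Gd \<Longrightarrow> lt \<mu> \<in> Gd"
  by (rule transpose_map_sections[OF l_map])

lemma pairing_lt: "a \<in> sections A \<Longrightarrow> pairing (lt \<mu>) a = pairing \<mu> (app l a)"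
  by (rule pairing_transpose)

lemma l_add: "a \<in> sections A \<Longrightarrow> b \<in> sections A \<Longrightarrow> app l (a + b) = app l a + app l b"
  by (rule app_add[OF l_map]) (auto intro: sections_in_fibre)

lemma l_smul: "a \<in> sections A \<Longrightarrow> app l (f \<odot> a) = f \<odot> app l a"
  by (rule app_smul[OF l_map]) (auto intro: sections_in_fibre)

lemma l_scaleR: "a \<in> sections A \<Longrightarrow> app l (c *\<^sub>R a) = c *\<^sub>R app l a"
  by (rule app_scaleR[OF l_map]) (auto intro: sections_in_fibre)

lemma l_uminus: "a \<in> sections A \<Longrightarrow> app l (- a) = - app l a"
  using l_scaleR[of a "-1"] by simp

lemma l_diff: "a \<in> sections A \<Longrightarrow> b \<in> sections A \<Longrightarrow> app l (a - b) = app l a - app l b"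
  using l_add[of a "- b"] l_uminus sections_uminus by simp

lemma
  assumes X: "X \<in> vector_fields M" and u: "u \<in> sections A"
  shows D_section [simp]: "D X u \<in> sections A"
    and D_add_field: "Y \<in> vector_fields M \<Longrightarrow> D (X + Y) u = D X u + D Y u"
    and D_smul_field: "f \<in> smooth_functions M \<Longrightarrow> D (f \<odot> X) u = f \<odot> D X u"
    and D_add: "v \<in> sections A \<Longrightarrow> D X (u + v) = D X u + D X v"
    and D_smul: "f \<in> smooth_functions M \<Longrightarrow>
          D X (f \<odot> u) = f \<odot> D X u + lie_fun X f \<odot> app l u - lie_fun (app r X) f \<odot> u"
  using gder X u unfolding gder1_def by blast+

lemma D_uminus_field:
  assumes "X \<in> vector_fields M" "u \<in> sections A"
  shows "D (- X) u = - D X u"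
proof -
  have "D ((\<lambda>p. - 1) \<odot> X) u = (\<lambda>p. - 1) \<odot> D X u"
    by (rule D_smul_field[OF assms]) simp
  moreover have "(\<lambda>p. - 1) \<odot> X = - X" "(\<lambda>p. - 1) \<odot> D X u = - D X u"
    by (simp_all add: fun_eq_iff)
  ultimately show ?thesis by simp
qed

lemma D_diff_field:
  "X \<in> vector_fields M \<Longrightarrow> Y \<in> vector_fields M \<Longrightarrow> u \<in> sections A \<Longrightarrow> D (X - Y) u = D X u - D Y u"
  using D_add_field[of X u "- Y"] D_uminus_field[of Y u] vector_fields_uminus[of Y M] by simp

lemma IM1:
  "a \<in> sections A \<Longrightarrow> b \<in> sections A \<Longrightarrow> X \<in> vector_fields M \<Longrightarrow>
    D X (br a b) = br a (D X b) - br b (D X a)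
          + D (vf_bracket (app \<rho> b) X) a - D (vf_bracket (app \<rho> a) X) b"
  and IM2: "a \<in> sections A \<Longrightarrow> b \<in> sections A \<Longrightarrow>
    app l (br a b) = br a (app l b) - D (app \<rho> b) a"
  and IM3: "a \<in> sections A \<Longrightarrow> X \<in> vector_fields M \<Longrightarrow>
    app r (vf_bracket (app \<rho> a) X) = vf_bracket (app \<rho> a) (app r X) - app \<rho> (D X a)"
  and IM4_fibre: "v \<in> fibre A p \<Longrightarrow> r p (\<rho> p v) = \<rho> p (l p v)"
  using im unfolding im_tensor_def by blast+

lemma IM2_dual: "\<mu> \<in> Gd \<Longrightarrow> \<nu> \<in> Gd \<Longrightarrow>
    lt (brs \<mu> \<nu>) = brs \<mu> (lt \<nu>) - gder_dual M A D l r (app \<rho>s \<nu>) \<mu>"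
  and IM3_dual: "\<mu> \<in> Gd \<Longrightarrow> X \<in> vector_fields M \<Longrightarrow>
    app r (vf_bracket (app \<rho>s \<mu>) X) = vf_bracket (app \<rho>s \<mu>) (app r X) - app \<rho>s (gder_dual M A D l r X \<mu>)"
  and IM4_dual_fibre: "\<xi> \<in> fibre (dual_bundle M A) p \<Longrightarrow> r p (\<rho>s p \<xi>) = \<rho>s p (transpose_map A l p \<xi>)"
  using im_dual unfolding im_tensor_def by blast+

lemma IM4: "a \<in> sections A \<Longrightarrow> app r (app \<rho> a) = app \<rho> (app l a)"
  using IM4_fibre[OF sections_in_fibre] by (simp add: fun_eq_iff app_apply)

lemma IM4_dual: "\<mu> \<in> Gd \<Longrightarrow> app r (app \<rho>s \<mu>) = app \<rho>s (lt \<mu>)"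
  using IM4_dual_fibre[OF dual.sections_in_fibre] by (simp add: fun_eq_iff app_apply)

lemma D_commutes_l: "X \<in> vector_fields M \<Longrightarrow> u \<in> sections A \<Longrightarrow> D X (app l u) = app l (D X u)"
  and D_curvature: "X \<in> vector_fields M \<Longrightarrow> Y \<in> vector_fields M \<Longrightarrow> u \<in> sections A \<Longrightarrow>
    D X (D Y u) - D Y (D X u)
        - D (vf_bracket (app r Y) X + vf_bracket Y (app r X) - app r (vf_bracket Y X)) u
        + app l (D (vf_bracket Y X) u) = 0"
  using self_commuting unfolding gder_self_commuting_def by blast+

text \<open>When \<open>u\<close> is multiplied by \<open>f\<close>, the two derivative terms in the
  Leibniz rule of \<open>D\<close> cancel those produced by differentiating the two
  pairings.\<close>

lemma smooth_linear_gder_dual: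
  assumes X: "X \<in> vector_fields M" and \<mu>: "\<mu> \<in> Gd"
  shows "smooth_linear M A
    (\<lambda>u. lie_fun X (pairing \<mu> (app l u)) - lie_fun (app r X) (pairing \<mu> u) - pairing \<mu> (D X u))"
  unfolding smooth_linear_def
proof (intro conjI ballI)
  let ?\<Phi> = "\<lambda>u. lie_fun X (pairing \<mu> (app l u)) - lie_fun (app r X) (pairing \<mu> u) - pairing \<mu> (D X u)"
  fix s assume s: "s \<in> sections A"
  show "?\<Phi> s \<in> smooth_functions M"
    using assms s by simp
  show "?\<Phi> (s + t) = ?\<Phi> s + ?\<Phi> t" if t: "t \<in> sections A" for t
    using assms s t by (simp add: l_add D_add pairing_section_add lie_fun_add[where M = M])
  show "?\<Phi> (f \<odot> s) = f * ?\<Phi> s" if f: "f \<in> smooth_functions M" for f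
  proof -
    have "pairing \<mu> (D X (f \<odot> s)) = f * pairing \<mu> (D X s) + lie_fun X f * pairing \<mu> (app l s)
        - lie_fun (app r X) f * pairing \<mu> s"
      using assms s f unfolding D_smul[OF X s f]
      by (simp add: pairing_section_add pairing_section_diff pairing_section_smul sections_smul sections_add)
    then show ?thesis
      using assms s f
      by (simp add: l_smul pairing_section_smul lie_fun_mult[where M = M] algebra_simps)
  qed
qed

lemma gder_dual_section [simp]:
  "X \<in> vector_fields M \<Longrightarrow> \<mu> \<in> Gd \<Longrightarrow> gder_dual M A D l r X \<mu> \<in> Gd"
  unfolding gder_dual_def by (rule dual_section_representation(1)[OF smooth_linear_gder_dual])

lemma pairing_gder_dual:
  assumes "X \<in> vector_fields M" "\<mu> \<in> Gd" "u \<in> sections A"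
  shows "pairing (gder_dual M A D l r X \<mu>) u =
    lie_fun X (pairing \<mu> (app l u)) - lie_fun (app r X) (pairing \<mu> u) - pairing \<mu> (D X u)"
  unfolding gder_dual_def
  by (rule dual_section_representation(2)[OF smooth_linear_gder_dual[OF assms(1,2)] assms(3)])

section \<open>The differential of the dual algebroid on sections of \<open>A\<close>\<close>

lemma dst_eq:
  "dst a \<mu> \<nu> = lie_fun (app \<rho>s \<mu>) (pairing \<nu> a) - lie_fun (app \<rho>s \<nu>) (pairing \<mu> a) - pairing (brs \<mu> \<nu>) a"
  by (simp add: algd_1_def)

lemma dst_skew: "\<mu> \<in> Gd \<Longrightarrow> \<nu> \<in> Gd \<Longrightarrow> dst a \<mu> \<nu> = - dst a \<nu> \<mu>"
  unfolding dst_eq by (subst dual.bracket_skew[of \<mu> \<nu>]) (simp_all add: fun_eq_iff app_apply)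

lemma dst_smooth [simp]:
  assumes "a \<in> sections A" "\<mu> \<in> Gd" "\<nu> \<in> Gd"
  shows "dst a \<mu> \<nu> \<in> smooth_functions M"
  unfolding dst_eq using assms by simp

text \<open>The derivative of \<open>f\<close> along the anchor of \<open>\<mu>\<close> is cancelled
  by the Leibniz term of \<open>brs\<close>. Linearity in the other argument comes from
  \<open>dst_skew\<close>.\<close>

lemma dst_smooth_linear:
  assumes "a \<in> sections A" "\<mu> \<in> Gd"
  shows "smooth_linear M (dual_bundle M A) (dst a \<mu>)"
  unfolding smooth_linear_def
proof (intro conjI ballI)
  fix \<nu> assume \<nu>: "\<nu> \<in> Gd"
  show "dst a \<mu> \<nu> \<in> smooth_functions M" using assms \<nu> by simp
  show "dst a \<mu> (\<nu> + \<xi>) = dst a \<mu> \<nu> + dst a \<mu> \<xi>" if \<xi>: "\<xi> \<in> Gd" for \<xi>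
  proof -
    have "app \<rho>s (\<nu> + \<xi>) = app \<rho>s \<nu> + app \<rho>s \<xi>"
      by (rule app_add[OF dual.anchor]) (auto intro: dual.sections_in_fibre \<nu> \<xi>)
    then show ?thesis
      using assms \<nu> \<xi> unfolding dst_eq
      by (simp add: dual.bracket_add_right pairing_plus lie_fun_field_add lie_fun_add[where M = M])
  qed
  show "dst a \<mu> (f \<odot> \<nu>) = f * dst a \<mu> \<nu>" if f: "f \<in> smooth_functions M" for f
  proof -
    have 1: "app \<rho>s (f \<odot> \<nu>) = f \<odot> app \<rho>s \<nu>"
      by (rule app_smul[OF dual.anchor]) (auto intro: dual.sections_in_fibre \<nu>)
    have 2: "pairing (g \<odot> \<xi>) a = g * pairing \<xi> a" for g \<xi>
      by (simp add: fun_eq_iff app_apply)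
    show ?thesis
      using assms \<nu> f unfolding dst_eq 1
      by (simp add: dual.bracket_smul_right pairing_plus 2 lie_fun_field_smul lie_fun_mult[where M = M]
          algebra_simps)
  qed
qed

lemma dst_diff_right:
  assumes "a \<in> sections A" "\<mu> \<in> Gd" "\<nu> \<in> Gd" "\<xi> \<in> Gd"
  shows "dst a \<mu> (\<nu> - \<xi>) = dst a \<mu> \<nu> - dst a \<mu> \<xi>"
  using smooth_linearD(2)[OF dst_smooth_linear[OF assms(1,2)] dual.sections_diff[OF assms(3,4)] assms(4)]
  by simp

lemma dst_diff_left:
  assumes "a \<in> sections A" "\<mu> \<in> Gd" "\<nu> \<in> Gd" "\<xi> \<in> Gd"
  shows "dst a (\<nu> - \<xi>) \<mu> = dst a \<nu> \<mu> - dst a \<xi> \<mu>"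
  using dst_diff_right[OF assms] dst_skew[of "\<nu> - \<xi>" \<mu> a] dst_skew[of \<nu> \<mu> a] dst_skew[of \<xi> \<mu> a]
    dual.sections_diff assms by simp

lemma
  assumes "a \<in> sections A" "b \<in> sections A" "\<mu> \<in> Gd" "\<nu> \<in> Gd"
  shows dst_add: "dst (a + b) \<mu> \<nu> = dst a \<mu> \<nu> + dst b \<mu> \<nu>"
    and dst_diff: "dst (a - b) \<mu> \<nu> = dst a \<mu> \<nu> - dst b \<mu> \<nu>"
  using assms unfolding dst_eq
  by (simp_all add: pairing_section_add pairing_section_diff lie_fun_add[where M = M] lie_fun_diff[where M = M])

text \<open>Moving \<open>l\<close> onto the bracket, (IM2) for the dual produces the dual
  derivation along the anchor of \<open>\<nu>\<close>. Of its two Lie derivative terms, one cancels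
  the derivative of the pairing of \<open>\<mu>\<close> with \<open>app l a\<close>, and the other,
  by (IM4), is the term for \<open>lt \<nu>\<close>.\<close>

lemma dst_l:
  assumes a: "a \<in> sections A" and \<mu>: "\<mu> \<in> Gd" and \<nu>: "\<nu> \<in> Gd"
  shows "dst (app l a) \<mu> \<nu> = dst a \<mu> (lt \<nu>) - pairing \<mu> (D (app \<rho>s \<nu>) a)"
proof -
  have "pairing (brs \<mu> \<nu>) (app l a) = pairing (lt (brs \<mu> \<nu>)) a"
    using pairing_lt[OF a] by simp
  also have "\<dots> = pairing (brs \<mu> (lt \<nu>)) a - (lie_fun (app \<rho>s \<nu>) (pairing \<mu> (app l a))
      - lie_fun (app \<rho>s (lt \<nu>)) (pairing \<mu> a) - pairing \<mu> (D (app \<rho>s \<nu>) a))"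
    using assms by (simp add: IM2_dual pairing_diff pairing_gder_dual IM4_dual)
  finally show ?thesis
    unfolding dst_eq using pairing_lt[OF a, of \<nu>] by (simp add: algebra_simps)
qed

section \<open>Consequences of the bialgebroid conditions\<close>

lemma bialgebroid_section:
  assumes "a \<in> sections A" "b \<in> sections A" "\<mu> \<in> Gd" "\<nu> \<in> Gd"
  shows "dst (br a b) \<mu> \<nu> =
    - (lie_fun (app \<rho> b) (dst a \<mu> \<nu>) - dst a (Ld b \<mu>) \<nu> - dst a \<mu> (Ld b \<nu>))
    + (lie_fun (app \<rho> a) (dst b \<mu> \<nu>) - dst b (Ld a \<mu>) \<nu> - dst b \<mu> (Ld a \<nu>))"
  using bialgebroid assms unfolding lie_bialgebroid_def schouten_1_2_def by blast

lemma bialgebroid_function: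
  assumes "a \<in> sections A" "f \<in> smooth_functions M" "\<mu> \<in> Gd"
  shows "lie_fun (app \<rho>s \<mu>) (lie_fun (app \<rho> a) f) = dst a \<mu> (dA f)
    + (lie_fun (app \<rho> a) (lie_fun (app \<rho>s \<mu>) f) - lie_fun (app \<rho>s (Ld a \<mu>)) f)"
  using bialgebroid assms unfolding lie_bialgebroid_def schouten_2_0_def schouten_1_1_def algd_0_def
  by blast

lemma ham_skew:
  assumes "f \<in> smooth_functions M" "g \<in> smooth_functions M"
  shows "lie_fun (ham f) g = - lie_fun (ham g) f"
proof -
  have "0 = lie_fun (ham g) f + lie_fun (ham f) g"
    using bialgebroid assms unfolding lie_bialgebroid_def schouten_1_0_def algd_0_def by blast
  then show ?thesis by (simp add: eq_neg_iff_add_eq_0 add.commute)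
qed

text \<open>The section \<open>d\<^sub>*f\<close> of \<open>A\<close>.\<close>

lemma dual_differential:
  assumes f: "f \<in> smooth_functions M"
  obtains a where "a \<in> sections A" "\<And>\<xi>. \<xi> \<in> Gd \<Longrightarrow> pairing \<xi> a = lie_fun (app \<rho>s \<xi>) f"
    "app \<rho> a = - ham f"
proof -
  have "smooth_linear M (dual_bundle M A) (\<lambda>\<xi>. lie_fun (app \<rho>s \<xi>) f)"
    unfolding smooth_linear_def
  proof (intro conjI ballI)
    fix \<nu> assume \<nu>: "\<nu> \<in> Gd"
    show "lie_fun (app \<rho>s \<nu>) f \<in> smooth_functions M" using f \<nu> by simp
    show "lie_fun (app \<rho>s (\<nu> + \<xi>)) f = lie_fun (app \<rho>s \<nu>) f + lie_fun (app \<rho>s \<xi>) f"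
      if "\<xi> \<in> Gd" for \<xi>
      by (subst app_add[OF dual.anchor])
        (auto intro: dual.sections_in_fibre \<nu> that simp: lie_fun_field_add)
    show "lie_fun (app \<rho>s (g \<odot> \<nu>)) f = g * lie_fun (app \<rho>s \<nu>) f" for g
      by (subst app_smul[OF dual.anchor]) (auto intro: dual.sections_in_fibre \<nu> simp: lie_fun_field_smul)
  qed
  then obtain a where a: "a \<in> sections A" "\<And>\<xi>. \<xi> \<in> Gd \<Longrightarrow> pairing \<xi> a = lie_fun (app \<rho>s \<xi>) f"
    by (rule sections_reflexive) blast
  have "app \<rho> a = - ham f"
  proof (rule vector_fields_eqI[where M = M])
    show "app \<rho> a \<in> vector_fields M" "- ham f \<in> vector_fields M"
      using a(1) f by (simp_all add: vector_fields_uminus)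
    fix g assume g: "g \<in> smooth_functions M"
    \<comment> \<open>The number obtained by pairing \<open>dA g\<close> with \<open>a\<close> is
      read once through the anchor of \<open>a\<close> and once through the definition of
      \<open>a\<close>. Skew-symmetry of the Hamiltonian fields then yields the sign.\<close>
    have "lie_fun (app \<rho> a) g = lie_fun (ham g) f"
      using pairing_algd_fun[OF g a(1)] a(2)[of "dA g"] g by simp
    then show "lie_fun (app \<rho> a) g = lie_fun (- ham f) g"
      using ham_skew[OF f g] by (simp add: lie_fun_field_uminus)
  qed
  then show ?thesis using that a by blast
qed

text \<open>The section \<open>i\<^sub>\<nu> d\<^sub>*b\<close> of \<open>A\<close>; its anchor is what the compatibility of \<open>d\<^sub>*\<close> with functions
  computes.\<close>

lemma dual_differential_contraction:
  assumes b: "b \<in> sections A" and \<nu>: "\<nu> \<in> Gd"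
  obtains c where "c \<in> sections A" "\<And>\<xi>. \<xi> \<in> Gd \<Longrightarrow> pairing \<xi> c = dst b \<nu> \<xi>"
    "app \<rho> c = app \<rho>s (Ld b \<nu>) - vf_bracket (app \<rho> b) (app \<rho>s \<nu>)"
proof -
  obtain c where c: "c \<in> sections A" "\<And>\<xi>. \<xi> \<in> Gd \<Longrightarrow> pairing \<xi> c = dst b \<nu> \<xi>"
    using dst_smooth_linear[OF b \<nu>] by (rule sections_reflexive) blast
  have "app \<rho> c = app \<rho>s (Ld b \<nu>) - vf_bracket (app \<rho> b) (app \<rho>s \<nu>)"
  proof (rule vector_fields_eqI[where M = M])
    show "app \<rho> c \<in> vector_fields M"
      "app \<rho>s (Ld b \<nu>) - vf_bracket (app \<rho> b) (app \<rho>s \<nu>) \<in> vector_fields M"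
      using b c(1) \<nu> by (simp_all add: vector_fields_bracket vector_fields_diff)
    fix f assume f: "f \<in> smooth_functions M"
    have "lie_fun (app \<rho> c) f = dst b \<nu> (dA f)"
      using pairing_algd_fun[OF f c(1)] c(2)[of "dA f"] f by simp
    then show "lie_fun (app \<rho> c) f =
        lie_fun (app \<rho>s (Ld b \<nu>) - vf_bracket (app \<rho> b) (app \<rho>s \<nu>)) f"
      using bialgebroid_function[OF b f \<nu>]
      by (simp add: lie_fun_field_diff lie_fun_bracket algebra_simps)
  qed
  then show ?thesis using that c by blast
qed

text \<open>The pullback along \<open>\<rho>\<close> of the 1-form \<open>X \<mapsto> \<langle>\<mu>, D\<^sub>X a\<rangle>\<close>.\<close>

definition theta :: "('m \<Rightarrow> 'v) \<Rightarrow> ('m \<Rightarrow> 'v \<Rightarrow> real) \<Rightarrow> 'm \<Rightarrow> 'v \<Rightarrow> real" where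
  "theta a \<mu> = dual_section M A (\<lambda>c. pairing \<mu> (D (app \<rho> c) a))"

lemma smooth_linear_theta:
  assumes "a \<in> sections A" "\<mu> \<in> Gd"
  shows "smooth_linear M A (\<lambda>c. pairing \<mu> (D (app \<rho> c) a))"
  unfolding smooth_linear_def
proof (intro conjI ballI)
  fix s assume s: "s \<in> sections A"
  show "pairing \<mu> (D (app \<rho> s) a) \<in> smooth_functions M" using assms s by simp
  show "pairing \<mu> (D (app \<rho> (s + t)) a) = pairing \<mu> (D (app \<rho> s) a) + pairing \<mu> (D (app \<rho> t) a)"
    if t: "t \<in> sections A" for t
  proof -
    have "app \<rho> (s + t) = app \<rho> s + app \<rho> t"
      by (rule app_add[OF anchor]) (auto intro: sections_in_fibre s t)
    then show ?thesis using assms s t by (simp add: D_add_field pairing_section_add)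
  qed
  show "pairing \<mu> (D (app \<rho> (f \<odot> s)) a) = f * pairing \<mu> (D (app \<rho> s) a)"
    if f: "f \<in> smooth_functions M" for f
  proof -
    have "app \<rho> (f \<odot> s) = f \<odot> app \<rho> s"
      by (rule app_smul[OF anchor]) (auto intro: sections_in_fibre s)
    then show ?thesis using assms s f by (simp add: D_smul_field pairing_section_smul)
  qed
qed

lemma theta_section [simp]: "a \<in> sections A \<Longrightarrow> \<mu> \<in> Gd \<Longrightarrow> theta a \<mu> \<in> Gd"
  unfolding theta_def by (rule dual_section_representation(1)[OF smooth_linear_theta])

lemma pairing_theta:
  "a \<in> sections A \<Longrightarrow> \<mu> \<in> Gd \<Longrightarrow> c \<in> sections A \<Longrightarrow>
    pairing (theta a \<mu>) c = pairing \<mu> (D (app \<rho> c) a)"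
  unfolding theta_def by (rule dual_section_representation(2)[OF smooth_linear_theta])

text \<open>Transposed form of (IM2): the commutator of the Lie derivative with \<open>lt\<close> is
  \<open>theta\<close>.\<close>

lemma Ld_lt:
  assumes a: "a \<in> sections A" and \<nu>: "\<nu> \<in> Gd"
  shows "Ld a (lt \<nu>) = lt (Ld a \<nu>) + theta a \<nu>"
proof (rule dual_sections_eqI)
  show "Ld a (lt \<nu>) \<in> Gd" "lt (Ld a \<nu>) + theta a \<nu> \<in> Gd"
    using a \<nu> by (simp_all add: dual_sections_add)
  fix c assume c: "c \<in> sections A"
  show "pairing (Ld a (lt \<nu>)) c = pairing (lt (Ld a \<nu>) + theta a \<nu>) c"
    using a \<nu> c IM2[OF a c]
    by (simp add: pairing_plus pairing_lt pairing_lie_dual pairing_theta pairing_section_diff)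
qed

text \<open>The contraction of the differential of \<open>b\<close> with \<open>\<nu>\<close> is a
  section \<open>c\<close>. Pairing \<open>theta a \<mu>\<close> with it evaluates \<open>D\<close>
  on the anchor of \<open>c\<close>, which is known; skew-symmetry moves \<open>\<nu>\<close> into
  the first argument.\<close>

lemma dst_theta:
  assumes a: "a \<in> sections A" and b: "b \<in> sections A" and \<mu>: "\<mu> \<in> Gd" and \<nu>: "\<nu> \<in> Gd"
  shows "dst b (theta a \<mu>) \<nu> =
    pairing \<mu> (D (vf_bracket (app \<rho> b) (app \<rho>s \<nu>)) a) - pairing \<mu> (D (app \<rho>s (Ld b \<nu>)) a)"
proof -
  obtain c where c: "c \<in> sections A" "\<And>\<xi>. \<xi> \<in> Gd \<Longrightarrow> pairing \<xi> c = dst b \<nu> \<xi>"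
    "app \<rho> c = app \<rho>s (Ld b \<nu>) - vf_bracket (app \<rho> b) (app \<rho>s \<nu>)"
    using dual_differential_contraction[OF b \<nu>] by blast
  have "dst b (theta a \<mu>) \<nu> = - pairing (theta a \<mu>) c"
    using dst_skew[of "theta a \<mu>" \<nu> b] c(2)[of "theta a \<mu>"] a \<mu> \<nu> by simp
  also have "\<dots> = - pairing \<mu> (D (app \<rho>s (Ld b \<nu>) - vf_bracket (app \<rho> b) (app \<rho>s \<nu>)) a)"
    using pairing_theta[OF a \<mu> c(1)] c(3) by simp
  also have "\<dots> = pairing \<mu> (D (vf_bracket (app \<rho> b) (app \<rho>s \<nu>)) a) - pairing \<mu> (D (app \<rho>s (Ld b \<nu>)) a)"
    using a b \<mu> \<nu> by (simp add: D_diff_field pairing_section_diff vector_fields_bracket)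
  finally show ?thesis .
qed

subsection \<open>The deformed Lie algebroid\<close>

abbreviation brl :: "('m \<Rightarrow> 'v) \<Rightarrow> ('m \<Rightarrow> 'v) \<Rightarrow> 'm \<Rightarrow> 'v" where
  "brl \<equiv> deformed_bracket br l"

abbreviation \<rho>l :: "'m \<Rightarrow> 'v \<Rightarrow> 'm tangent" where
  "\<rho>l \<equiv> \<lambda>p v. \<rho> p (l p v)"

lemma brl_section [simp]: "a \<in> sections A \<Longrightarrow> b \<in> sections A \<Longrightarrow> brl a b \<in> sections A"
  by (simp add: deformed_bracket_def sections_add sections_diff)

lemma brl_eq:
  "a \<in> sections A \<Longrightarrow> b \<in> sections A \<Longrightarrow> brl a b = br (app l a) b + D (app \<rho> b) a"
  by (simp add: deformed_bracket_def IM2)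

text \<open>Vanishing of the torsion of \<open>l\<close>: after \<open>D\<close> is commuted past
  \<open>l\<close>, the remaining expression is (IM2) for \<open>app l a\<close> and
  \<open>b\<close>.\<close>

lemma l_brl:
  assumes "a \<in> sections A" "b \<in> sections A"
  shows "app l (brl a b) = br (app l a) (app l b)"
  using assms by (simp add: brl_eq l_add IM2 D_commutes_l)

lemma br_l_l:
  assumes "a \<in> sections A" "b \<in> sections A"
  shows "br (app l a) (app l b) = app l (br (app l a) b) + app l (br a (app l b)) - app l (app l (br a b))"
  using l_brl[OF assms] assms by (simp add: deformed_bracket_def l_add l_diff sections_add)

text \<open>All occurrences of \<open>l\<close> around an inner bracket are moved outwards by the
  torsion identity \<open>br_l_l\<close>. The terms are then sorted by how often \<open>l\<close>
  stands outside, which is the form needed for the cyclic sum.\<close>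

lemma brl_brl:
  assumes a: "a \<in> sections A" and b: "b \<in> sections A" and c: "c \<in> sections A"
  shows "brl a (brl b c) = br (app l a) (br (app l b) c) + br (app l a) (br b (app l c))
      + br a (br (app l b) (app l c))
      - app l (br (app l a) (br b c) + br a (br (app l b) c) + br a (br b (app l c)))
      + app l (app l (br a (br b c)))"
proof -
  have 1: "br (app l a) (brl b c) = br (app l a) (br (app l b) c) + br (app l a) (br b (app l c))
      - br (app l a) (app l (br b c))"
    using assms by (simp add: deformed_bracket_def bracket_add_right bracket_diff_right sections_add)
  have 2: "br a (brl b c) = br a (br (app l b) c) + br a (br b (app l c)) - br a (app l (br b c))"
    using assms by (simp add: deformed_bracket_def bracket_add_right bracket_diff_right sections_add)
  have 3: "br (app l a) (app l (br b c)) = app l (br (app l a) (br b c)) + app l (br a (app l (br b c)))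
      - app l (app l (br a (br b c)))"
    using br_l_l[of a "br b c"] assms by simp
  have "brl a (brl b c) = br (app l a) (brl b c) + br a (br (app l b) (app l c)) - app l (br a (brl b c))"
    using assms by (simp add: deformed_bracket_def[of br l a] l_brl)
  also have "\<dots> = br (app l a) (br (app l b) c) + br (app l a) (br b (app l c))
      + br a (br (app l b) (app l c))
      - app l (br (app l a) (br b c) + br a (br (app l b) c) + br a (br b (app l c)))
      + app l (app l (br a (br b c)))"
    unfolding 1 2 3 using assms by (simp add: l_add l_diff sections_add algebra_simps)
  finally show ?thesis .
qed

text \<open>The cyclic sum regroups into Jacobi sums of the original bracket with \<open>l\<close>
  on two, one or none of the arguments, the last two kinds under one or two outer applications of
  \<open>l\<close>.\<close>

lemma brl_jacobi:
  assumes a: "a \<in> sections A" and b: "b \<in> sections A" and c: "c \<in> sections A"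
  shows "brl a (brl b c) + brl b (brl c a) + brl c (brl a b) = 0"
proof -
  define J where "J x y z = br x (br y z) + br y (br z x) + br z (br x y)" for x y z
  have J0: "J x y z = 0" if "x \<in> sections A" "y \<in> sections A" "z \<in> sections A" for x y z
    unfolding J_def using bracket_jacobi that by blast
  have "brl a (brl b c) + brl b (brl c a) + brl c (brl a b) =
      J (app l a) (app l b) c + J (app l b) (app l c) a + J (app l c) (app l a) b
      - (app l (J (app l a) b c) + app l (J (app l b) c a) + app l (J (app l c) a b))
      + app l (app l (J a b c))"
    unfolding brl_brl[OF a b c] brl_brl[OF b c a] brl_brl[OF c a b] J_def
    using assms by (simp add: l_add sections_add algebra_simps)
  moreover have "app l 0 = 0"
    using l_scaleR[OF sections_0, of 0] by simp
  ultimately show ?thesis using assms by (simp add: J0)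
qed

lemma deformed_algebroid: "lie_algebroid M A brl \<rho>l"
  unfolding lie_algebroid_def
proof (intro conjI ballI allI)
  show "vector_bundle M A" by (rule vbundle)
  show "bundle_map A (tangent_bundle M) \<rho>l" by (rule bundle_map_compose[OF l_map anchor])
  fix a b assume a: "a \<in> sections A" and b: "b \<in> sections A"
  show "brl a b \<in> sections A" using a b by simp
  show "brl a (b + c) = brl a b + brl a c" if "c \<in> sections A" for c
    using a b that by (simp add: deformed_bracket_def bracket_add_right l_add algebra_simps)
  show "brl a (x *\<^sub>R b) = x *\<^sub>R brl a b" for x
    using a b by (simp add: deformed_bracket_def bracket_scaleR_right l_scaleR algebra_simps)
  show "brl a b = - brl b a"
    using a b bracket_skew[of "app l a" b] bracket_skew[of a "app l b"] bracket_skew[of a b]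
    by (simp add: deformed_bracket_def l_uminus)
  show "brl a (brl b c) + brl b (brl c a) + brl c (brl a b) = 0" if "c \<in> sections A" for c
    by (rule brl_jacobi[OF a b that])
  show "brl a (f \<odot> b) = f \<odot> brl a b + lie_fun (app \<rho>l a) f \<odot> b" if f: "f \<in> smooth_functions M" for f
  proof -
    have "lie_fun (app \<rho> a) f \<in> smooth_functions M" using a f by simp
    then show ?thesis
      using a b f
      by (simp add: deformed_bracket_def bracket_smul_right l_smul l_add sections_smul app_comp)
        (simp add: fun_eq_iff algebra_simps)
  qed
qed

text \<open>Makes the pairing rules for Lie derivatives and differentials available for the deformed
  structure.\<close>

sublocale deformed: lie_algebroid_on M A brl \<rho>l
  by unfold_locales (rule manifold, rule deformed_algebroid)

section \<open>The bialgebroid conditions for the deformed bracket\<close>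

lemma lie_dual_deformed:
  assumes a: "a \<in> sections A" and \<mu>: "\<mu> \<in> Gd"
  shows "lie_dual M A brl \<rho>l a \<mu> = Ld (app l a) \<mu> - theta a \<mu>"
proof (rule dual_sections_eqI)
  show "lie_dual M A brl \<rho>l a \<mu> \<in> Gd" "Ld (app l a) \<mu> - theta a \<mu> \<in> Gd"
    using a \<mu> by (simp_all add: dual.sections_diff)
  fix c assume c: "c \<in> sections A"
  show "pairing (lie_dual M A brl \<rho>l a \<mu>) c = pairing (Ld (app l a) \<mu> - theta a \<mu>) c"
    using a \<mu> c
    by (simp add: deformed.pairing_lie_dual pairing_diff pairing_lie_dual pairing_theta brl_eq
        pairing_section_add app_comp)
qed

lemma algd_fun_deformed:
  assumes f: "f \<in> smooth_functions M"
  shows "algd_fun M A \<rho>l f = lt (dA f)"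
proof (rule dual_sections_eqI)
  show "algd_fun M A \<rho>l f \<in> Gd" "lt (dA f) \<in> Gd" using f by simp_all
  fix c assume c: "c \<in> sections A"
  show "pairing (algd_fun M A \<rho>l f) c = pairing (lt (dA f)) c"
    using f c by (simp add: deformed.pairing_algd_fun pairing_lt pairing_algd_fun app_comp)
qed

text \<open>Trades \<open>l\<close> on the section for \<open>lt\<close> on the second covector.
  Apart from the corrections by \<open>D\<close>, the commutator \<open>Ld_lt\<close> contributes
  the term with \<open>theta\<close>. The right side is shaped for the undeformed condition at
  \<open>\<mu>\<close> and \<open>lt \<nu>\<close>.\<close>

lemma schouten_l:
  assumes a: "a \<in> sections A" and b: "b \<in> sections A" and \<mu>: "\<mu> \<in> Gd" and \<nu>: "\<nu> \<in> Gd"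
  shows "lie_fun (app \<rho> a) (dst (app l b) \<mu> \<nu>) - dst (app l b) (Ld a \<mu>) \<nu> - dst (app l b) \<mu> (Ld a \<nu>) =
    lie_fun (app \<rho> a) (dst b \<mu> (lt \<nu>)) - dst b (Ld a \<mu>) (lt \<nu>) - dst b \<mu> (Ld a (lt \<nu>))
    + dst b \<mu> (theta a \<nu>) - pairing \<mu> (br a (D (app \<rho>s \<nu>) b)) + pairing \<mu> (D (app \<rho>s (Ld a \<nu>)) b)"
proof -
  have "dst b \<mu> (Ld a (lt \<nu>)) = dst b \<mu> (lt (Ld a \<nu>)) + dst b \<mu> (theta a \<nu>)"
    unfolding Ld_lt[OF a \<nu>] using a b \<mu> \<nu> by (intro smooth_linearD(2)[OF dst_smooth_linear]) simp_all
  moreover have "lie_fun (app \<rho> a) (dst (app l b) \<mu> \<nu>) =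
      lie_fun (app \<rho> a) (dst b \<mu> (lt \<nu>)) - lie_fun (app \<rho> a) (pairing \<mu> (D (app \<rho>s \<nu>) b))"
    unfolding dst_l[OF b \<mu> \<nu>] using a b \<mu> \<nu> by (intro lie_fun_diff[where M = M]) simp_all
  ultimately show ?thesis
    using a b \<mu> \<nu> by (simp add: dst_l pairing_lie_dual algebra_simps)
qed

text \<open>Add the original condition for the pairs with \<open>l\<close> on one of the two
  sections, evaluated at \<open>\<mu>\<close> and \<open>\<nu>\<close>, and subtract the condition
  for \<open>a\<close>, \<open>b\<close> at \<open>\<mu>\<close> and \<open>lt \<nu>\<close>. What
  is left over consists of terms with \<open>D\<close> and \<open>theta\<close>, which cancel by
  (IM1) along the anchor of \<open>\<nu>\<close> and by \<open>dst_theta\<close>.\<close>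

lemma deformed_section:
  assumes a: "a \<in> sections A" and b: "b \<in> sections A" and \<mu>: "\<mu> \<in> Gd" and \<nu>: "\<nu> \<in> Gd"
  shows "dst (brl a b) \<mu> \<nu> =
    - schouten_1_2 M A brl \<rho>l b (dst a) \<mu> \<nu> + schouten_1_2 M A brl \<rho>l a (dst b) \<mu> \<nu>"
proof -
  have S: "schouten_1_2 M A brl \<rho>l a (dst b) \<mu> \<nu> =
      lie_fun (app \<rho> (app l a)) (dst b \<mu> \<nu>) - dst b (Ld (app l a) \<mu>) \<nu> - dst b \<mu> (Ld (app l a) \<nu>)
      + dst b (theta a \<mu>) \<nu> + dst b \<mu> (theta a \<nu>)"
    if "a \<in> sections A" "b \<in> sections A" for a b
    unfolding schouten_1_2_def app_comp lie_dual_deformed[OF that(1) \<mu>] lie_dual_deformed[OF that(1) \<nu>]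
    using that \<mu> \<nu> by (simp add: dst_diff_left dst_diff_right algebra_simps)
  have "dst (brl a b) \<mu> \<nu> = dst (br (app l a) b) \<mu> \<nu> + dst (br a (app l b)) \<mu> \<nu> - dst (app l (br a b)) \<mu> \<nu>"
    unfolding deformed_bracket_def using assms by (simp add: dst_add dst_diff sections_add)
  moreover have "pairing \<mu> (D (app \<rho>s \<nu>) (br a b)) =
      pairing \<mu> (br a (D (app \<rho>s \<nu>) b)) - pairing \<mu> (br b (D (app \<rho>s \<nu>) a))
      + pairing \<mu> (D (vf_bracket (app \<rho> b) (app \<rho>s \<nu>)) a)
      - pairing \<mu> (D (vf_bracket (app \<rho> a) (app \<rho>s \<nu>)) b)"
    using assms by (subst IM1)
      (simp_all add: pairing_section_add pairing_section_diff sections_add sections_diff vector_fields_bracket)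
  moreover note bialgebroid_section[OF l_section[OF a] b \<mu> \<nu>] bialgebroid_section[OF a l_section[OF b] \<mu> \<nu>]
    dst_l[OF bracket_section[OF a b] \<mu> \<nu>] bialgebroid_section[OF a b \<mu> lt_section[OF \<nu>]]
    schouten_l[OF a b \<mu> \<nu>] schouten_l[OF b a \<mu> \<nu>]
    dst_theta[OF a b \<mu> \<nu>] dst_theta[OF b a \<mu> \<nu>]
  \<comment> \<open>At each point these identities are linear relations between real numbers; no
    further differentiation takes place.\<close>
  note eqs = calculation this
  show ?thesis
    unfolding S[OF a b] S[OF b a]
  proof
    fix p
    show "dst (brl a b) \<mu> \<nu> p = (- (lie_fun (app \<rho> (app l b)) (dst a \<mu> \<nu>) - dst a (Ld (app l b) \<mu>) \<nu>
        - dst a \<mu> (Ld (app l b) \<nu>) + dst a (theta b \<mu>) \<nu> + dst a \<mu> (theta b \<nu>))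
      + (lie_fun (app \<rho> (app l a)) (dst b \<mu> \<nu>) - dst b (Ld (app l a) \<mu>) \<nu> - dst b \<mu> (Ld (app l a) \<nu>)
        + dst b (theta a \<mu>) \<nu> + dst b \<mu> (theta a \<nu>))) p"
      using eqs[THEN fun_cong, of p] unfolding plus_fun_apply minus_apply uminus_apply by linarith
  qed
qed

text \<open>Compared with the original condition for \<open>app l a\<close>, the pairing of
  \<open>\<mu>\<close> with \<open>D (ham f) a\<close> appears twice with opposite signs: from
  \<open>dst_l\<close> at \<open>dA f\<close>, and from \<open>theta a \<mu>\<close> paired with the
  section whose anchor is \<open>- ham f\<close>.\<close>

lemma deformed_function:
  assumes a: "a \<in> sections A" and f: "f \<in> smooth_functions M" and \<mu>: "\<mu> \<in> Gd"
  shows "algd_0 \<rho>s (lie_fun (app \<rho>l a) f) \<mu> =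
    schouten_2_0 M A \<rho>l (dst a) f \<mu> + schouten_1_1 M A brl \<rho>l a (algd_0 \<rho>s f) \<mu>"
proof -
  obtain c where c: "c \<in> sections A" "\<And>\<xi>. \<xi> \<in> Gd \<Longrightarrow> pairing \<xi> c = lie_fun (app \<rho>s \<xi>) f"
    "app \<rho> c = - ham f"
    using dual_differential[OF f] by blast
  have theta: "lie_fun (app \<rho>s (theta a \<mu>)) f = - pairing \<mu> (D (ham f) a)"
    using c(2)[of "theta a \<mu>"] pairing_theta[OF a \<mu> c(1)] a f \<mu>
    by (simp add: c(3) D_uminus_field pairing_section_uminus)
  have diff: "app \<rho>s (Ld (app l a) \<mu> - theta a \<mu>) = app \<rho>s (Ld (app l a) \<mu>) - app \<rho>s (theta a \<mu>)"
  proof -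
    have "Ld (app l a) \<mu> - theta a \<mu> \<in> Gd" "theta a \<mu> \<in> Gd"
      using a \<mu> by (simp_all add: dual.sections_diff)
    then have "app \<rho>s (Ld (app l a) \<mu> - theta a \<mu> + theta a \<mu>) =
        app \<rho>s (Ld (app l a) \<mu> - theta a \<mu>) + app \<rho>s (theta a \<mu>)"
      by - (rule app_add[OF dual.anchor]; rule dual.sections_in_fibre; assumption)
    then show ?thesis by simp
  qed
  show ?thesis
    unfolding algd_0_def schouten_2_0_def schouten_1_1_def lie_dual_deformed[OF a \<mu>]
      algd_fun_deformed[OF f] app_comp diff lie_fun_field_diff theta
      bialgebroid_function[OF l_section[OF a] f \<mu>] dst_l[OF a \<mu> algd_fun_section[OF f]]
    by simp
qed

text \<open>Skew-symmetry of the deformed tensor on the base. The pairing of \<open>dA g\<close>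
  with \<open>l\<close> of the dual differential of \<open>f\<close> is computed by (IM4) on
  \<open>A\<close>, and (IM4) on the dual identifies the result.\<close>

lemma r_ham_skew:
  assumes f: "f \<in> smooth_functions M" and g: "g \<in> smooth_functions M"
  shows "lie_fun (app \<rho>s (lt (dA g))) f = - lie_fun (app \<rho>s (lt (dA f))) g"
proof -
  obtain c where c: "c \<in> sections A" "\<And>\<xi>. \<xi> \<in> Gd \<Longrightarrow> pairing \<xi> c = lie_fun (app \<rho>s \<xi>) f"
    "app \<rho> c = - ham f"
    using dual_differential[OF f] by blast
  have r_neg: "app r (- ham f) = - app r (ham f)"
  proof -
    have "app r ((-1) *\<^sub>R ham f) = (-1) *\<^sub>R app r (ham f)"
      by (rule app_scaleR[OF r_map], rule vector_field_at) (simp add: f)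
    then show ?thesis by simp
  qed
  have "lie_fun (app \<rho>s (lt (dA g))) f = pairing (dA g) (app l c)"
    using c(2)[of "lt (dA g)"] pairing_lt[OF c(1)] g by simp
  also have "\<dots> = lie_fun (app r (app \<rho> c)) g"
    using c(1) g by (simp add: pairing_algd_fun IM4)
  also have "\<dots> = - lie_fun (app \<rho>s (lt (dA f))) g"
    using f by (simp add: c(3) r_neg lie_fun_field_uminus IM4_dual)
  finally show ?thesis .
qed

lemma deformed_bialgebroid: "lie_bialgebroid M A brl \<rho>l brs \<rho>s"
  unfolding lie_bialgebroid_def
proof (intro conjI ballI)
  show "lie_algebroid M A brl \<rho>l" by (rule deformed_algebroid)
  show "lie_algebroid M (dual_bundle M A) brs \<rho>s" by (rule dual.algebroid)
  show "dst (brl a b) \<mu> \<nu> =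
      - schouten_1_2 M A brl \<rho>l b (dst a) \<mu> \<nu> + schouten_1_2 M A brl \<rho>l a (dst b) \<mu> \<nu>"
    if "a \<in> sections A" "b \<in> sections A" "\<mu> \<in> Gd" "\<nu> \<in> Gd" for a b \<mu> \<nu>
    by (rule deformed_section[OF that])
  show "algd_0 \<rho>s (lie_fun (app \<rho>l a) f) \<mu> =
      schouten_2_0 M A \<rho>l (dst a) f \<mu> + schouten_1_1 M A brl \<rho>l a (algd_0 \<rho>s f) \<mu>"
    if "a \<in> sections A" "f \<in> smooth_functions M" "\<mu> \<in> Gd" for a f \<mu>
    by (rule deformed_function[OF that])
  show "0 = schouten_1_0 M A \<rho>l (algd_0 \<rho>s f) g + schouten_1_0 M A \<rho>l (algd_0 \<rho>s g) f"
    if "f \<in> smooth_functions M" "g \<in> smooth_functions M" for f g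
    unfolding schouten_1_0_def algd_0_def algd_fun_deformed[OF that(1)] algd_fun_deformed[OF that(2)]
      r_ham_skew[OF that] by simp
qed

end

section \<open>The IM tensor for the deformed bracket\<close>

context lie_nijenhuis
begin

text \<open>With \<open>brl a b\<close> written as \<open>br (app l a) b\<close> plus
  \<open>D (app \<rho> b) a\<close>, the first summand is treated by (IM1) and the second by the
  curvature identity. Each produces \<open>app l (D ?B a)\<close>, with opposite signs.\<close>

lemma deformed_IM1:
  assumes a: "a \<in> sections A" and b: "b \<in> sections A" and X: "X \<in> vector_fields M"
  shows "D X (brl a b) = brl a (D X b) - brl b (D X a)
    + D (vf_bracket (app \<rho>l b) X) a - D (vf_bracket (app \<rho>l a) X) b"
proof -
  let ?Y = "app \<rho> b"
  let ?B = "vf_bracket ?Y X"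
  have "D X (D ?Y a) = D ?Y (D X a) + D (vf_bracket (app r ?Y) X + vf_bracket ?Y (app r X) - app r ?B) a
      - app l (D ?B a)"
    using D_curvature[OF X anchor_field[OF b] a] by (simp add: algebra_simps)
  \<comment> \<open>By (IM4) the field \<open>app r ?Y\<close> is the anchor of
    \<open>app l b\<close>; by (IM3) the two remaining terms combine to the anchor of
    \<open>D X b\<close>.\<close>
  also have "vf_bracket (app r ?Y) X + vf_bracket ?Y (app r X) - app r ?B =
      vf_bracket (app \<rho> (app l b)) X + app \<rho> (D X b)"
    using IM3[OF b X] IM4[OF b] by simp
  also have "D (vf_bracket (app \<rho> (app l b)) X + app \<rho> (D X b)) a =
      D (vf_bracket (app \<rho> (app l b)) X) a + D (app \<rho> (D X b)) a"
    using a b X by (intro D_add_field) (simp_all add: vector_fields_bracket)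
  finally have 1: "D X (D ?Y a) = D ?Y (D X a) + (D (vf_bracket (app \<rho> (app l b)) X) a
      + D (app \<rho> (D X b)) a) - app l (D ?B a)" .
  have 2: "D X (br (app l a) b) = br (app l a) (D X b) - br b (app l (D X a))
      + app l (D ?B a) - D (vf_bracket (app \<rho> (app l a)) X) b"
    using a b X IM1[OF l_section[OF a] b X] by (simp add: D_commutes_l vector_fields_bracket)
  have 3: "brl b (D X a) = br b (app l (D X a)) - D ?Y (D X a)"
  proof -
    have "brl b (D X a) = - brl (D X a) b"
      using a b X by (intro deformed.bracket_skew) simp_all
    also have "\<dots> = - br (app l (D X a)) b - D ?Y (D X a)"
      using a b X by (simp add: brl_eq)
    also have "- br (app l (D X a)) b = br b (app l (D X a))"
      using a b X bracket_skew[of b "app l (D X a)"] by simp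
    finally show ?thesis .
  qed
  have "D X (brl a b) = D X (br (app l a) b) + D X (D ?Y a)"
    using a b X by (simp add: brl_eq D_add)
  also have "\<dots> = br (app l a) (D X b) + D (app \<rho> (D X b)) a - (br b (app l (D X a)) - D ?Y (D X a))
      + D (vf_bracket (app \<rho> (app l b)) X) a - D (vf_bracket (app \<rho> (app l a)) X) b"
    unfolding 1 2 by (simp add: algebra_simps)
  finally show ?thesis
    unfolding 3 app_comp using a b X by (simp add: brl_eq)
qed

lemma deformed_im_tensor: "im_tensor M A brl \<rho>l D l r"
  unfolding im_tensor_def
proof (intro conjI ballI allI)
  show "gder1 M A D l r" by (rule gder)
  fix a assume a: "a \<in> sections A"
  show "D X (brl a b) = brl a (D X b) - brl b (D X a)
    + D (vf_bracket (app \<rho>l b) X) a - D (vf_bracket (app \<rho>l a) X) b"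
    if "b \<in> sections A" "X \<in> vector_fields M" for b X
    by (rule deformed_IM1[OF a that])
  show "app l (brl a b) = brl a (app l b) - D (app \<rho>l b) a" if b: "b \<in> sections A" for b
    using a b by (simp add: l_brl brl_eq[of a "app l b"] app_comp)
  show "app r (vf_bracket (app \<rho>l a) X) = vf_bracket (app \<rho>l a) (app r X) - app \<rho>l (D X a)"
    if X: "X \<in> vector_fields M" for X
    using IM3[OF l_section[OF a] X] a X by (simp add: app_comp D_commutes_l)
next
  show "r p (\<rho> p (l p v)) = \<rho> p (l p (l p v))" if "v \<in> fibre A p" for p v
    using IM4_fibre[OF bundle_map_fibre[OF l_map that]] .
qed

lemma deformed_lie_nijenhuis: "lie_nijenhuis_bialgebroid M A brl \<rho>l brs \<rho>s D l r"
  unfolding lie_nijenhuis_bialgebroid_def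
  using deformed_bialgebroid deformed_im_tensor im_dual self_commuting by blast

subsection \<open>The Poisson-Nijenhuis structure on the base\<close>

abbreviation \<pi> :: "'m bivector" where
  "\<pi> \<equiv> bialgebroid_bivector A \<rho> \<rho>s"

text \<open>The explicit form of the map that \<open>sharp\<close> describes by \<open>THE\<close>;
  \<open>sharp_eq\<close> identifies the two on covectors.\<close>

abbreviation P :: "'m \<Rightarrow> 'm cotangent \<Rightarrow> 'm tangent" where
  "P \<equiv> \<lambda>p \<alpha>. \<rho>s p (transpose_map A \<rho> p \<alpha>)"

lemma P_fibre: "\<alpha> \<in> fibre (cotangent_bundle M) p \<Longrightarrow> P p \<alpha> \<in> fibre (tangent_bundle M) p"
  by (rule bundle_map_fibre[OF dual.anchor transpose_map_fibre[OF anchor]])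

lemma P_field [simp]: "\<alpha> \<in> one_forms M \<Longrightarrow> app P \<alpha> \<in> vector_fields M"
  unfolding app_comp by simp

lemma P_differential: "f \<in> smooth_functions M \<Longrightarrow> app P (differential M f) = ham f"
  unfolding app_comp by (simp add: algd_fun_eq)

text \<open>Skew-symmetry is known for differentials. Each covector is replaced by a differential
  with the same pullback to the algebroid, so that \<open>P\<close> is unchanged, and with the same
  value on the vector it is paired with.\<close>

lemma P_skew:
  assumes \<alpha>: "\<alpha> \<in> fibre (cotangent_bundle M) p" and \<beta>: "\<beta> \<in> fibre (cotangent_bundle M) p"
  shows "\<beta> (P p \<alpha>) = - \<alpha> (P p \<beta>)"
proof -
  obtain f where f: "f \<in> smooth_functions M" "P p \<beta> f = \<alpha> (P p \<beta>)"
    "transpose_map A \<rho> p (differential M f p) = transpose_map A \<rho> p \<alpha>"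
    using pullback_as_differential[OF anchor \<alpha> P_fibre[OF \<beta>]] by blast
  obtain g where g: "g \<in> smooth_functions M" "P p \<alpha> g = \<beta> (P p \<alpha>)"
    "transpose_map A \<rho> p (differential M g p) = transpose_map A \<rho> p \<beta>"
    using pullback_as_differential[OF anchor \<beta> P_fibre[OF \<alpha>]] by blast
  have "lie_fun (ham f) g p = P p \<alpha> g" "lie_fun (ham g) f p = P p \<beta> f"
    using f(3) g(3)
    by (simp_all add: P_differential[OF f(1), symmetric] P_differential[OF g(1), symmetric]
        lie_fun_def app_apply)
  then show ?thesis
    using fun_cong[OF ham_skew[OF f(1) g(1)], of p] f(2) g(2) by simp
qed

lemma P_skew_forms:
  assumes "\<alpha> \<in> one_forms M" "\<beta> \<in> one_forms M"
  shows "pairing \<beta> (app P \<alpha>) = - pairing \<alpha> (app P \<beta>)"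
proof
  fix p
  have "\<alpha> p \<in> fibre (cotangent_bundle M) p" "\<beta> p \<in> fibre (cotangent_bundle M) p"
    using assms unfolding dual_sections_iff by blast+
  from P_skew[OF this] show "pairing \<beta> (app P \<alpha>) p = (- pairing \<alpha> (app P \<beta>)) p"
    by (simp add: app_apply)
qed

lemma sharp_eq:
  assumes "\<alpha> \<in> fibre (cotangent_bundle M) p"
  shows "sharp M \<pi> p \<alpha> = P p \<alpha>"
  unfolding sharp_def
proof (rule the_equality)
  show "P p \<alpha> \<in> fibre (tangent_bundle M) p \<and>
      (\<forall>\<beta>\<in>fibre (cotangent_bundle M) p. \<beta> (P p \<alpha>) = \<pi> p \<alpha> \<beta>)"
    using P_fibre[OF assms] by (simp add: bialgebroid_bivector_def)
  fix v assume v: "v \<in> fibre (tangent_bundle M) p \<and>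
      (\<forall>\<beta>\<in>fibre (cotangent_bundle M) p. \<beta> v = \<pi> p \<alpha> \<beta>)"
  show "v = P p \<alpha>"
    by (rule tangent_eqI[OF _ P_fibre[OF assms]]) (use v in \<open>auto simp: bialgebroid_bivector_def\<close>)
qed

text \<open>The bialgebroid condition for a section and a function is applied to the dual
  differential of \<open>g\<close>. The term of second order in the differential vanishes, and the
  Lie derivative of \<open>dA h\<close> is minus the differential of the bracket of \<open>g\<close>
  and \<open>h\<close>.\<close>

lemma ham_bracket:
  assumes g: "g \<in> smooth_functions M" and h: "h \<in> smooth_functions M"
  shows "vf_bracket (ham g) (ham h) = ham (lie_fun (ham g) h)"
proof (rule vector_fields_eqI[where M = M])
  have gh: "lie_fun (ham g) h \<in> smooth_functions M" using g h by simp
  show "vf_bracket (ham g) (ham h) \<in> vector_fields M" "ham (lie_fun (ham g) h) \<in> vector_fields M"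
    using g h gh by (simp_all add: vector_fields_bracket)
  fix f assume f: "f \<in> smooth_functions M"
  obtain a where a: "a \<in> sections A" "\<And>\<xi>. \<xi> \<in> Gd \<Longrightarrow> pairing \<xi> a = lie_fun (app \<rho>s \<xi>) g"
    "app \<rho> a = - ham g"
    using dual_differential[OF g] by blast
  \<comment> \<open>The dual differential squares to zero on functions because
    \<open>\<rho>s\<close> preserves brackets.\<close>
  have closed: "dst a (dA h) (dA f) = 0"
    unfolding dst_eq using f h
    by (simp add: a(2) dual.anchor_bracket lie_fun_bracket)
  have "Ld a (dA h) = - dA (lie_fun (ham g) h)"
  proof (rule dual_sections_eqI)
    show "Ld a (dA h) \<in> Gd" "- dA (lie_fun (ham g) h) \<in> Gd"
      using a(1) h gh by (simp_all add: dual.sections_uminus)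
    fix b assume b: "b \<in> sections A"
    have "pairing (Ld a (dA h)) b = lie_fun (app \<rho> b) (lie_fun (app \<rho> a) h)"
      using a(1) h b by (simp add: pairing_lie_dual pairing_algd_fun anchor_bracket lie_fun_bracket)
    also have "\<dots> = - lie_fun (app \<rho> b) (lie_fun (ham g) h)"
      unfolding a(3) lie_fun_field_uminus using b gh by (intro lie_fun_uminus[where M = M]) simp_all
    finally show "pairing (Ld a (dA h)) b = pairing (- dA (lie_fun (ham g) h)) b"
      using pairing_algd_fun[OF gh b] by (simp add: fun_eq_iff app_apply)
  qed
  moreover have "app \<rho>s (- \<xi>) = - app \<rho>s \<xi>" if "\<xi> \<in> Gd" for \<xi>
  proof -
    have "app \<rho>s ((-1) *\<^sub>R \<xi>) = (-1) *\<^sub>R app \<rho>s \<xi>"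
      by (rule app_scaleR[OF dual.anchor], rule dual.sections_in_fibre[OF that])
    then show ?thesis by simp
  qed
  ultimately have "app \<rho>s (Ld a (dA h)) = - ham (lie_fun (ham g) h)"
    using gh by simp
  moreover have "lie_fun (ham h) (- lie_fun (ham g) f) = - lie_fun (ham h) (lie_fun (ham g) f)"
    using f g h by (intro lie_fun_uminus[where M = M]) simp_all
  ultimately show "lie_fun (vf_bracket (ham g) (ham h)) f = lie_fun (ham (lie_fun (ham g) h)) f"
    using bialgebroid_function[OF a(1) f algd_fun_section[OF h]]
    by (simp add: closed a(3) lie_fun_field_uminus lie_fun_bracket algebra_simps)
qed

lemma poisson_bracket_eq:
  assumes "f \<in> smooth_functions M" "g \<in> smooth_functions M"
  shows "poisson_bracket M \<pi> f g = lie_fun (ham f) g"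
proof
  fix p
  have "lie_fun (ham f) g p = P p (differential M f p) g"
    by (simp add: P_differential[OF assms(1), symmetric] lie_fun_def app_apply)
  then show "poisson_bracket M \<pi> f g p = lie_fun (ham f) g p"
    using P_fibre[OF differential_in_fibre[OF assms(1)], of p]
    by (simp add: poisson_bracket_def bialgebroid_bivector_def differential_at)
qed

lemma poisson: "poisson_bivector M \<pi>"
  unfolding poisson_bivector_def
proof (intro conjI ballI)
  show "bivector_field M \<pi>"
    unfolding bivector_field_def
  proof (intro conjI ballI allI)
    fix p \<alpha> assume \<alpha>: "\<alpha> \<in> fibre (cotangent_bundle M) p"
    show "linear_between (fibre (cotangent_bundle M) p) UNIV (\<pi> p \<alpha>)"
      by (simp add: linear_between_def bialgebroid_bivector_def)
    show "\<pi> p \<alpha> \<beta> = - \<pi> p \<beta> \<alpha>" if "\<beta> \<in> fibre (cotangent_bundle M) p" for \<beta>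
      using P_skew[OF \<alpha> that] by (simp add: bialgebroid_bivector_def)
  next
    fix \<alpha> \<beta> assume "\<alpha> \<in> one_forms M" "\<beta> \<in> one_forms M"
    then have "pairing \<beta> (app P \<alpha>) \<in> smooth_functions M"
      using P_field by (simp add: dual_sections_iff)
    then show "(\<lambda>p. \<pi> p (\<alpha> p) (\<beta> p)) \<in> smooth_functions M"
      by (simp add: app_def bialgebroid_bivector_def)
  qed
  fix f g h assume f: "f \<in> smooth_functions M" and g: "g \<in> smooth_functions M" and h: "h \<in> smooth_functions M"
  \<comment> \<open>By skew-symmetry all three cyclic terms become derivatives of \<open>h\<close>;
    the third is minus the commutator of the Hamiltonian fields of \<open>f\<close> and
    \<open>g\<close>.\<close>
  have "lie_fun (ham g) (lie_fun (ham h) f) = - lie_fun (ham g) (lie_fun (ham f) h)"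
    unfolding ham_skew[OF h f] using f g h by (intro lie_fun_uminus[where M = M]) simp_all
  moreover have "lie_fun (ham h) (lie_fun (ham f) g) = - lie_fun (vf_bracket (ham f) (ham g)) h"
    unfolding ham_bracket[OF f g] using f g h by (intro ham_skew) simp_all
  ultimately show "poisson_bracket M \<pi> f (poisson_bracket M \<pi> g h) + poisson_bracket M \<pi> g (poisson_bracket M \<pi> h f)
      + poisson_bracket M \<pi> h (poisson_bracket M \<pi> f g) = 0"
    using f g h by (simp add: poisson_bracket_eq lie_fun_bracket)
qed

section \<open>Compatibility of the Poisson tensor with \<open>r\<close>\<close>

abbreviation rt :: "'m \<Rightarrow> 'm cotangent \<Rightarrow> 'm cotangent" where
  "rt \<equiv> transpose_map (tangent_bundle M) r"

lemma rt_fibre: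
  "\<alpha> \<in> fibre (cotangent_bundle M) p \<Longrightarrow> rt p \<alpha> \<in> fibre (cotangent_bundle M) p"
  using r_map subspace_add[OF tangent_subspace[of M p]] subspace_scale[OF tangent_subspace[of M p]]
  by (auto simp: dual_fibre_iff transpose_map_def linear_between_def bundle_map_def)

lemma pairing_rt: "Z \<in> vector_fields M \<Longrightarrow> pairing (app rt \<alpha>) Z = pairing \<alpha> (app r Z)"
  by (simp add: fun_eq_iff app_apply transpose_map_apply vector_field_at)

lemma rt_form [simp]: "\<alpha> \<in> one_forms M \<Longrightarrow> app rt \<alpha> \<in> one_forms M"
  by (auto simp: dual_sections_iff[of "app rt \<alpha>"] pairing_rt)
    (auto simp: dual_sections_iff app_apply intro: rt_fibre)

text \<open>(IM4) on \<open>A\<close>, transposed, moves \<open>rt\<close> through the pullback as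
  the transpose of \<open>l\<close>; (IM4) on the dual then turns that transpose into
  \<open>r\<close> behind \<open>\<rho>s\<close>.\<close>

lemma P_rt_fibre:
  assumes "\<alpha> \<in> fibre (cotangent_bundle M) p"
  shows "P p (rt p \<alpha>) = r p (P p \<alpha>)"
proof -
  have "transpose_map A \<rho> p (rt p \<alpha>) = transpose_map A l p (transpose_map A \<rho> p \<alpha>)"
  proof
    fix v
    show "transpose_map A \<rho> p (rt p \<alpha>) v = transpose_map A l p (transpose_map A \<rho> p \<alpha>) v"
    proof (cases "v \<in> fibre A p")
      case True
      then show ?thesis
        using bundle_map_fibre[OF anchor True] bundle_map_fibre[OF l_map True] IM4_fibre[OF True]
        by (simp add: transpose_map_apply)
    qed (simp add: transpose_map_def)
  qed
  then show ?thesis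
    using IM4_dual_fibre[OF transpose_map_fibre[OF anchor assms]] by simp
qed

lemma P_rt: "\<alpha> \<in> one_forms M \<Longrightarrow> app P (app rt \<alpha>) = app r (app P \<alpha>)"
  using P_rt_fibre by (simp add: fun_eq_iff app_apply dual_sections_iff)

text \<open>The Lie derivative of \<open>r\<close> along \<open>P \<beta>\<close>, from \<open>(IM3)\<close> for \<open>A\<^sup>*\<close> and \<open>\<mu> = \<rho>\<^sup>*\<beta>\<close>; the pairing
  with \<open>\<alpha>\<close> is moved to \<open>A\<close> through the section \<open>\<rho>\<^sub>*\<^sup>*\<alpha>\<close>, to which \<open>(IM3)\<close> for \<open>A\<close> applies.\<close>

lemma lie_derivative_r:
  assumes \<alpha>: "\<alpha> \<in> one_forms M" and \<beta>: "\<beta> \<in> one_forms M" and Z: "Z \<in> vector_fields M"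
  shows "pairing \<alpha> (vf_bracket (app P \<beta>) (app r Z)) - pairing \<alpha> (app r (vf_bracket (app P \<beta>) Z)) =
    lie_fun Z (pairing \<alpha> (app r (app P \<beta>))) - lie_fun (app r Z) (pairing \<alpha> (app P \<beta>))
    + pairing \<beta> (vf_bracket (app P \<alpha>) (app r Z)) - pairing \<beta> (app r (vf_bracket (app P \<alpha>) Z))"
proof -
  let ?\<mu> = "app (transpose_map A \<rho>) \<beta>"
  have \<mu>: "?\<mu> \<in> Gd" using \<beta> by simp
  have form_smul: "pairing \<gamma> (f \<odot> X) = f * pairing \<gamma> X"
    if "\<gamma> \<in> one_forms M" "X \<in> vector_fields M" for \<gamma> X f
    by (rule pairing_smul[OF that(1) vector_field_at[OF that(2)]])
  have form_add: "pairing \<gamma> (X + Y) = pairing \<gamma> X + pairing \<gamma> Y"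
    if "\<gamma> \<in> one_forms M" "X \<in> vector_fields M" "Y \<in> vector_fields M" for \<gamma> X Y
    by (rule pairing_add[OF that(1) vector_field_at[OF that(2)] vector_field_at[OF that(3)]])
  have form_uminus: "pairing \<gamma> (- X) = - pairing \<gamma> X" if "\<gamma> \<in> one_forms M" "X \<in> vector_fields M" for \<gamma> X
  proof -
    have "(\<lambda>p. - 1) \<odot> X = - X" "(\<lambda>p. - 1) * pairing \<gamma> X = - pairing \<gamma> X"
      by (simp_all add: fun_eq_iff)
    then show ?thesis using form_smul[OF that, of "\<lambda>p. - 1"] by simp
  qed
  have form_diff: "pairing \<gamma> (X - Y) = pairing \<gamma> X - pairing \<gamma> Y"
    if "\<gamma> \<in> one_forms M" "X \<in> vector_fields M" "Y \<in> vector_fields M" for \<gamma> X Y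
    using form_add[OF that(1,2) vector_fields_uminus[OF that(3)]] form_uminus[OF that(1,3)] by simp
  have "smooth_linear M (dual_bundle M A) (\<lambda>\<xi>. pairing \<alpha> (app \<rho>s \<xi>))"
    unfolding smooth_linear_def
  proof (intro conjI ballI)
    fix \<xi> assume \<xi>: "\<xi> \<in> Gd"
    show "pairing \<alpha> (app \<rho>s \<xi>) \<in> smooth_functions M"
      using \<alpha> \<xi> by (simp add: dual_sections_iff)
    show "pairing \<alpha> (app \<rho>s (\<xi> + \<zeta>)) = pairing \<alpha> (app \<rho>s \<xi>) + pairing \<alpha> (app \<rho>s \<zeta>)" if \<zeta>: "\<zeta> \<in> Gd" for \<zeta>
    proof -
      have "app \<rho>s (\<xi> + \<zeta>) = app \<rho>s \<xi> + app \<rho>s \<zeta>"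
        using \<xi> \<zeta> by - (rule app_add[OF dual.anchor]; rule dual.sections_in_fibre; assumption)
      then show ?thesis using form_add[OF \<alpha>] \<xi> \<zeta> by simp
    qed
    show "pairing \<alpha> (app \<rho>s (f \<odot> \<xi>)) = f * pairing \<alpha> (app \<rho>s \<xi>)" for f
    proof -
      have "app \<rho>s (f \<odot> \<xi>) = f \<odot> app \<rho>s \<xi>"
        using \<xi> by - (rule app_smul[OF dual.anchor]; rule dual.sections_in_fibre; assumption)
      then show ?thesis using form_smul[OF \<alpha>] \<xi> by simp
    qed
  qed
  then obtain a where a: "a \<in> sections A" "\<And>\<xi>. \<xi> \<in> Gd \<Longrightarrow> pairing \<xi> a = pairing \<alpha> (app \<rho>s \<xi>)"
    by (rule sections_reflexive) blast
  have \<rho>a: "app \<rho> a = - app P \<alpha>"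
  proof (rule vector_fields_eqI[where M = M])
    show "app \<rho> a \<in> vector_fields M" "- app P \<alpha> \<in> vector_fields M"
      using a(1) \<alpha> by (simp_all add: vector_fields_uminus)
    fix f assume f: "f \<in> smooth_functions M"
    have "lie_fun (app \<rho> a) f = pairing \<alpha> (app P (differential M f))"
      using pairing_algd_fun[OF f a(1)] a(2)[of "dA f"] f by (simp add: P_differential)
    also have "\<dots> = - lie_fun (app P \<alpha>) f"
      using P_skew_forms[OF differential_one_form[OF f] \<alpha>] \<alpha> by (simp add: pairing_differential)
    finally show "lie_fun (app \<rho> a) f = lie_fun (- app P \<alpha>) f"
      by (simp add: lie_fun_field_uminus)
  qed
  have r_uminus: "app r (- X) = - app r X" if "X \<in> vector_fields M" for X
  proof -
    have "app r ((-1) *\<^sub>R X) = (-1) *\<^sub>R app r X"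
      by (rule app_scaleR[OF r_map], rule vector_field_at[OF that])
    then show ?thesis by simp
  qed
  have P\<beta>: "app P \<beta> = app \<rho>s ?\<mu>" by (rule app_comp)
  have "pairing \<alpha> (vf_bracket (app P \<beta>) (app r Z)) - pairing \<alpha> (app r (vf_bracket (app P \<beta>) Z)) =
      pairing \<alpha> (app \<rho>s (gder_dual M A D l r Z ?\<mu>))"
    using form_diff[OF \<alpha>] \<mu> Z unfolding P\<beta> IM3_dual[OF \<mu> Z]
    by (simp add: vector_fields_bracket)
  also have "\<dots> = pairing (gder_dual M A D l r Z ?\<mu>) a"
    using a(2) \<mu> Z by simp
  also have "\<dots> = lie_fun Z (pairing \<beta> (app \<rho> (app l a))) - lie_fun (app r Z) (pairing \<beta> (app \<rho> a))
      - pairing \<beta> (app \<rho> (D Z a))"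
    using \<mu> Z a(1) by (simp add: pairing_gder_dual pairing_transpose)
  finally have eq: "pairing \<alpha> (vf_bracket (app P \<beta>) (app r Z)) - pairing \<alpha> (app r (vf_bracket (app P \<beta>) Z)) =
      lie_fun Z (pairing \<beta> (app \<rho> (app l a))) - lie_fun (app r Z) (pairing \<beta> (app \<rho> a))
      - pairing \<beta> (app \<rho> (D Z a))" .
  \<comment> \<open>Skew-symmetry of \<open>P\<close> enters twice, in the anchor of
    \<open>a\<close> and in exchanging \<open>\<alpha>\<close> with \<open>app rt \<beta>\<close>,
    so no sign remains.\<close>
  have 1: "pairing \<beta> (app \<rho> (app l a)) = pairing \<alpha> (app r (app P \<beta>))"
  proof -
    have "pairing \<beta> (app \<rho> (app l a)) = - pairing (app rt \<beta>) (app P \<alpha>)"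
      using IM4[OF a(1), symmetric] \<alpha> \<beta> by (simp add: \<rho>a r_uminus form_uminus pairing_rt)
    also have "\<dots> = pairing \<alpha> (app P (app rt \<beta>))"
      using P_skew_forms[OF \<alpha> rt_form[OF \<beta>]] by simp
    finally show ?thesis using P_rt[OF \<beta>] by simp
  qed
  have 2: "pairing \<beta> (app \<rho> a) = pairing \<alpha> (app P \<beta>)"
    using \<alpha> \<beta> P_skew_forms[OF \<alpha> \<beta>] by (simp add: \<rho>a form_uminus)
  have 3: "pairing \<beta> (app \<rho> (D Z a)) =
      - (pairing \<beta> (vf_bracket (app P \<alpha>) (app r Z)) - pairing \<beta> (app r (vf_bracket (app P \<alpha>) Z)))"
  proof -
    have P\<alpha>: "app P \<alpha> \<in> vector_fields M" using \<alpha> by simp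
    have "app \<rho> (D Z a) = vf_bracket (app \<rho> a) (app r Z) - app r (vf_bracket (app \<rho> a) Z)"
      using IM3[OF a(1) Z] by simp
    also have "\<dots> = - vf_bracket (app P \<alpha>) (app r Z) + app r (vf_bracket (app P \<alpha>) Z)"
      unfolding \<rho>a using P\<alpha> Z
      by (simp add: vf_bracket_uminus_left[where M = M] r_uminus vector_fields_bracket)
    finally show ?thesis
      using \<beta> P\<alpha> Z by (simp add: form_diff vector_fields_bracket)
  qed
  show ?thesis unfolding eq 1 2 3 by simp
qed

lemma app_sharp: "\<alpha> \<in> one_forms M \<Longrightarrow> app (sharp M \<pi>) \<alpha> = app P \<alpha>"
  by (simp add: fun_eq_iff app_apply dual_sections_iff sharp_eq)

text \<open>On expanding the four Koszul brackets, all derivatives along images of \<open>P\<close>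
  cancel, as do the brackets of \<open>Z\<close> with the fields
  \<open>app r (app P \<alpha>)\<close> and \<open>app r (app P \<beta>)\<close>. The remaining
  identity is \<open>lie_derivative_r\<close>.\<close>

lemma pn: "pn_compatible M \<pi> r"
  unfolding pn_compatible_def Let_def
proof (intro conjI ballI allI)
  show "r p (sharp M \<pi> p \<alpha>) = sharp M \<pi> p (rt p \<alpha>)" if "\<alpha> \<in> fibre (cotangent_bundle M) p" for p \<alpha>
    using that by (simp add: sharp_eq rt_fibre P_rt_fibre)
  fix \<alpha> \<beta> Z assume \<alpha>: "\<alpha> \<in> one_forms M" and \<beta>: "\<beta> \<in> one_forms M" and Z: "Z \<in> vector_fields M"
  have sh: "app (sharp M \<pi>) \<gamma> = app P \<gamma>" "app (\<lambda>p \<xi>. r p (sharp M \<pi> p \<xi>)) \<gamma> = app r (app P \<gamma>)"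
    if "\<gamma> \<in> one_forms M" for \<gamma>
    using app_sharp[OF that] app_comp[of r "sharp M \<pi>" \<gamma>] by simp_all
  have "pairing \<alpha> (app P (app rt \<beta>)) = pairing \<alpha> (app r (app P \<beta>))" by (simp only: P_rt[OF \<beta>])
  then show "koszul_bracket (\<lambda>p \<xi>. r p (sharp M \<pi> p \<xi>)) \<alpha> \<beta> Z =
      koszul_bracket (sharp M \<pi>) (app rt \<alpha>) \<beta> Z + koszul_bracket (sharp M \<pi>) \<alpha> (app rt \<beta>) Z
      - koszul_bracket (sharp M \<pi>) \<alpha> \<beta> (app r Z)"
    using lie_derivative_r[OF \<alpha> \<beta> Z] \<alpha> \<beta> Z
    unfolding koszul_bracket_def lie_form_def ext_d_def sh(1)[OF \<alpha>] sh(1)[OF \<beta>] sh(2)[OF \<alpha>] sh(2)[OF \<beta>]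
      sh(1)[OF rt_form[OF \<alpha>]] sh(1)[OF rt_form[OF \<beta>]] P_rt[OF \<alpha>] P_rt[OF \<beta>]
    by (simp add: pairing_rt vector_fields_bracket algebra_simps)
qed

lemma poisson_nijenhuis_base: "poisson_nijenhuis M \<pi> r"
  unfolding poisson_nijenhuis_def
  using poisson r_map pn self_commuting unfolding gder_self_commuting_def by blast

end

theorem proposition4p6:
  fixes M :: "'m::{t2_space, second_countable_topology} manifold"
    and A :: "('m, 'v::real_vector) vbundle"
    and br :: "('m \<Rightarrow> 'v) \<Rightarrow> ('m \<Rightarrow> 'v) \<Rightarrow> 'm \<Rightarrow> 'v"
    and \<rho> :: "'m \<Rightarrow> 'v \<Rightarrow> 'm tangent"
    and brs :: "('m \<Rightarrow> 'v \<Rightarrow> real) \<Rightarrow> ('m \<Rightarrow> 'v \<Rightarrow> real) \<Rightarrow> 'm \<Rightarrow> 'v \<Rightarrow> real"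
    and \<rho>s :: "'m \<Rightarrow> ('v \<Rightarrow> real) \<Rightarrow> 'm tangent"
    and D :: "'m vfield \<Rightarrow> ('m \<Rightarrow> 'v) \<Rightarrow> 'm \<Rightarrow> 'v"
    and l :: "'m \<Rightarrow> 'v \<Rightarrow> 'v"
    and r :: "'m \<Rightarrow> 'm tangent \<Rightarrow> 'm tangent"
  assumes "smooth_manifold M"
    and "lie_nijenhuis_bialgebroid M A br \<rho> brs \<rho>s D l r"
  shows "poisson_nijenhuis M (bialgebroid_bivector A \<rho> \<rho>s) r \<and>
    (lie_algebroid M A (deformed_bracket br l) (\<lambda>p v. \<rho> p (l p v)) \<and>
     lie_bialgebroid M A (deformed_bracket br l) (\<lambda>p v. \<rho> p (l p v)) brs \<rho>s) \<and>
    lie_nijenhuis_bialgebroid M A (deformed_bracket br l) (\<lambda>p v. \<rho> p (l p v)) brs \<rho>s D l r"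
proof -
  interpret lie_nijenhuis M A br \<rho> brs \<rho>s D l r
    by unfold_locales
      (use assms in \<open>simp_all add: lie_nijenhuis_bialgebroid_def lie_bialgebroid_def\<close>)
  show ?thesis
    using poisson_nijenhuis_base deformed_algebroid deformed_bialgebroid deformed_lie_nijenhuis by blast
qed

end
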